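(* Let $K$ be a Galois number field, let $k\in\mathbb{Z}^+$, and let $a\in\mathcal{O}_K$ satisfy $|\sigma(a)|\ge 2$ for all $\sigma\in\mathrm{Gal}(K/\mathbb{Q})$. Assume the $abc$ conjecture holds in $K$. Then the number of non-Wieferich places $\mathfrak{p}$ base $a$ with $\mathrm{Nm}(\mathfrak{p})\le x$ and $\mathrm{Nm}(\mathfrak{p})\equiv 1\pmod{k}$ is $\gg_{K,a,k}\log x$.
   Context: $\mathcal{O}_K$ is the ring of integers of $K$; $|\sigma(a)|$ denotes the complex absolute value of $\sigma(a)$ under a fixed embedding $K\hookrightarrow\mathbb{C}$ (the set $\{|\sigma(a)|:\sigma\in\mathrm{Gal}(K/\mathbb{Q})\}$ does not depend on the embedding). $\mathrm{Nm}(\mathfrak{p})$ is the absolute norm of a prime ideal $\mathfrak{p}$. For a prime ideal $\mathfrak{p}$, $v_{\mathfrak{p}}(x)$ is the exponent of $\mathfrak{p}$ in the ideal $(x)$. For $a\in\mathcal{O}_K\setminus\{0\}$ and a prime ideal $\mathfrak{p}$ with $q=\mathrm{Nm}(\mathfrak{p})$: $\mathfrak{p}$ is a Wieferich place base $a$ if $v_{\mathfrak{p}}(a^{q-1}-1)>1$, and a non-Wieferich place base $a$ if $v_{\mathfrak{p}}(a^{q-1}-1)=1$. The $abc$ conjecture for $K$: for $a_1,a_2,a_3\in K^\times$ define $H(a_1,a_2,a_3)=\prod_v \max(\|a_1\|_v,\|a_2\|_v,\|a_3\|_v)$, the product over the infinite places $v$ of $K$ with $\|a\|_v=|v(a)|^{1/[K:\mathbb{Q}]}$,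 and $N(a_1,a_2,a_3)=\prod_{\mathfrak{p}\in I}\mathrm{Nm}(\mathfrak{p})^{1/[K:\mathbb{Q}]}$, where $I$ is the finite set of finite places $\mathfrak{p}$ at which $\|a_1\|_{\mathfrak{p}},\|a_2\|_{\mathfrak{p}},\|a_3\|_{\mathfrak{p}}$ are not all equal to $1$. The conjecture asserts: for every $\epsilon>0$ there is a constant $C(\epsilon,K)$ with $H(\alpha,\beta,\alpha+\beta)\le C(\epsilon,K)N(\alpha,\beta,\alpha+\beta)^{1+\epsilon}$ for all $\alpha,\beta\in K$ with $\alpha,\beta,\alpha+\beta\ne0$. Notation: $f(x)\gg_S g(x)$ means $f(x)\ge c\,g(x)$ for all sufficiently large $x$, with $c>0$ depending only on $S$. *)

theory Defs
  imports
    "HOL-Algebra.Algebra"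
    "HOL-Algebra.Algebraic_Closure_Type"
    "HOL-Number_Theory.Number_Theory"
    "HOL-Library.Extended_Nat"
begin

section \<open>Number fields inside the complex numbers\<close>

text \<open>
  Every number field is isomorphic to a subfield of the complex numbers. A number field is given
  here as such a subfield, so the fixed embedding is the inclusion and \<open>cmod\<close> is the absolute value.
\<close>

abbreviation complex_ring :: "complex ring"
  where "complex_ring \<equiv> ring_of_type_algebra"

definition number_field :: "complex set \<Rightarrow> bool"
  where "number_field K \<longleftrightarrow>
    subfield K complex_ring \<and> ring.finite_dimension complex_ring \<rat> K"

definition field_degree :: "complex set \<Rightarrow> nat"
  where "field_degree K = ring.dim complex_ring \<rat> K"

definition field_ring :: "complex set \<Rightarrow> complex ring"
  where "field_ring K = complex_ring \<lparr>carrier := K\<rparr>"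

text \<open>
  Homomorphisms are only meaningful on \<open>K\<close>. Requiring them to be extensional makes each of them
  a single element, so that sets of them have the right cardinality.
\<close>

definition embeddings :: "complex set \<Rightarrow> (complex \<Rightarrow> complex) set"
  where "embeddings K = ring_hom (field_ring K) complex_ring \<inter> extensional K"

definition Gal :: "complex set \<Rightarrow> (complex \<Rightarrow> complex) set"
  where "Gal K =
    {\<sigma> \<in> ring_iso (field_ring K) (field_ring K) \<inter> extensional K. \<forall>q\<in>\<rat>. \<sigma> q = q}"

definition galois_number_field :: "complex set \<Rightarrow> bool"
  where "galois_number_field K \<longleftrightarrow>
    number_field K \<and> {x \<in> K. \<forall>\<sigma>\<in>Gal K. \<sigma> x = x} = \<rat>"

definition ring_of_integers :: "complex set \<Rightarrow> complex ring"
  where "ring_of_integers K = complex_ring \<lparr>carrier := {x \<in> K. algebraic_int x}\<rparr>"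


section \<open>Finite places\<close>

definition finite_places :: "complex set \<Rightarrow> complex set set"
  where "finite_places K = {P. primeideal P (ring_of_integers K) \<and> P \<noteq> {0}}"

definition ideal_norm :: "complex set \<Rightarrow> complex set \<Rightarrow> nat"
  where "ideal_norm K P = card (carrier (ring_of_integers K Quot P))"

text \<open>
  The exponent of \<open>P\<close> in the principal ideal generated by an algebraic integer \<open>x\<close> is the largest
  \<open>n\<close> such that \<open>P\<^sup>n\<close> divides that ideal in the monoid of ideals. It is \<open>\<infinity>\<close> for \<open>x = 0\<close>.
\<close>

definition ideal_ord :: "complex set \<Rightarrow> complex set \<Rightarrow> complex \<Rightarrow> enat"
  where "ideal_ord K P x =
    Sup {enat n | n::nat.
      (P [^]\<^bsub>ideals_set (ring_of_integers K)\<^esub> n)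
        divides\<^bsub>ideals_set (ring_of_integers K)\<^esub> (PIdl\<^bsub>ring_of_integers K\<^esub> x)}"

text \<open>
  For \<open>x = \<alpha> / \<beta>\<close> in \<open>K\<close>, the fractional ideal of \<open>x\<close> is the quotient of the ideals of \<open>\<alpha>\<close> and \<open>\<beta>\<close>.
  The value does not depend on the choice of \<open>\<alpha>\<close> and \<open>\<beta>\<close>. Only nonzero \<open>x\<close> are meant.
\<close>

definition valuation :: "complex set \<Rightarrow> complex set \<Rightarrow> complex \<Rightarrow> int"
  where "valuation K P x =
    (THE m. \<exists>\<alpha>\<in>carrier (ring_of_integers K) - {0}. \<exists>\<beta>\<in>carrier (ring_of_integers K) - {0}.
      x = \<alpha> / \<beta> \<and>
      m = int (the_enat (ideal_ord K P \<alpha>)) - int (the_enat (ideal_ord K P \<beta>)))"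

definition non_wieferich_place :: "complex set \<Rightarrow> complex \<Rightarrow> complex set \<Rightarrow> bool"
  where "non_wieferich_place K a P \<longleftrightarrow>
    P \<in> finite_places K \<and> ideal_ord K P (a ^ (ideal_norm K P - 1) - 1) = 1"


section \<open>The abc conjecture for a number field\<close>

definition finite_abs :: "complex set \<Rightarrow> complex set \<Rightarrow> complex \<Rightarrow> real"
  where "finite_abs K P x =
    real (ideal_norm K P) powr (- of_int (valuation K P x) / real (field_degree K))"

definition infinite_abs :: "complex set \<Rightarrow> (complex \<Rightarrow> complex) \<Rightarrow> complex \<Rightarrow> real"
  where "infinite_abs K v x = cmod (v x) powr (1 / real (field_degree K))"

definition abc_places :: "complex set \<Rightarrow> complex \<Rightarrow> complex \<Rightarrow> complex \<Rightarrow> complex set set"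
  where "abc_places K a1 a2 a3 =
    {P \<in> finite_places K.
      \<not> (finite_abs K P a1 = 1 \<and> finite_abs K P a2 = 1 \<and> finite_abs K P a3 = 1)}"

text \<open>
  The height is the product over all places. The archimedean factor runs over the embeddings into
  the complex numbers, so a complex place is counted twice, which gives it the exponent
  \<open>2 / [K : \<rat>]\<close>. The factor of a finite place outside \<open>abc_places\<close> is \<open>1\<close>; restricting to this
  finite set is needed because \<open>\<Prod>\<close> over an infinite set is \<open>1\<close> by convention.

  With either the finite places or the second factor at complex places left out, the product
  formula fails and the height is not invariant under scaling. The conjecture would then be
  refutable from the triples \<open>(2\<^sup>n, 2\<^sup>n, 2\<^sup>n\<^sup>+\<^sup>1)\<close> with \<open>n\<close> an integer (of either sign), whose
  conductor is bounded.
\<close>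

definition abc_height :: "complex set \<Rightarrow> complex \<Rightarrow> complex \<Rightarrow> complex \<Rightarrow> real"
  where "abc_height K a1 a2 a3 =
    (\<Prod>v\<in>embeddings K.
       Max {infinite_abs K v a1, infinite_abs K v a2, infinite_abs K v a3}) *
    (\<Prod>P\<in>abc_places K a1 a2 a3.
       Max {finite_abs K P a1, finite_abs K P a2, finite_abs K P a3})"

definition abc_conductor :: "complex set \<Rightarrow> complex \<Rightarrow> complex \<Rightarrow> complex \<Rightarrow> real"
  where "abc_conductor K a1 a2 a3 =
    (\<Prod>P\<in>abc_places K a1 a2 a3. real (ideal_norm K P) powr (1 / real (field_degree K)))"

definition abc_conjecture :: "complex set \<Rightarrow> bool"
  where "abc_conjecture K \<longleftrightarrow>
    (\<forall>\<epsilon>::real. \<epsilon> > 0 \<longrightarrow>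
      (\<exists>C::real. \<forall>\<alpha>\<in>K. \<forall>\<beta>\<in>K. \<alpha> \<noteq> 0 \<longrightarrow> \<beta> \<noteq> 0 \<longrightarrow> \<alpha> + \<beta> \<noteq> 0 \<longrightarrow>
        abc_height K \<alpha> \<beta> (\<alpha> + \<beta>) \<le> C * abc_conductor K \<alpha> \<beta> (\<alpha> + \<beta>) powr (1 + \<epsilon>)))"

end

theory Submission
  imports Defs "Jordan_Normal_Form.Char_Poly"
begin

text \<open>
  The primes dividing \<open>a\<^sup>n - 1\<close> exactly once are non-Wieferich places, and the norm of such a place is
  congruent to \<open>1\<close> modulo the order \<open>d\<close> of \<open>a\<close> modulo that prime. By the \<open>abc\<close> conjecture for
  \<open>(a\<^sup>n - 1) + 1 = a\<^sup>n\<close> these primes make up most of \<open>a\<^sup>n - 1\<close>. For \<open>n = k\<^bsup>k + 2\<^esup> m\<close> those whose order is not a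
  multiple of \<open>k\<close> already divide some \<open>a\<^bsup>n / p\<^bsup>k + 2\<^esup>\<^esup> - 1\<close> with \<open>p\<close> a prime factor of \<open>k\<close>, and are negligible. So the
  logarithmic norms of the good primes add up to a positive proportion of \<open>n\<close>. Summing over \<open>m \<le> N\<close> gives
  order \<open>N\<^sup>2\<close>. A prime of order \<open>d\<close> has logarithmic norm \<open>O(d)\<close> and is counted \<open>O(N / d)\<close> times, hence there
  are at least of order \<open>N\<close> good primes, all of logarithmic norm \<open>O(N)\<close>.

  The only facts about ideals that enter are that a prime dividing \<open>x\<close> as an element divides it as an ideal,
  and that the norms of the primes dividing \<open>x\<close>, with multiplicities up to two, have product at most
  \<open>\<bar>N(x)\<bar>\<close>. Both are derived from the finiteness of \<open>\<O> / x \<O>\<close> by pigeonhole arguments.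
\<close>

section \<open>Algebraic integers and linear systems\<close>

text \<open>A single exponent \<open>n\<close> would not do: all of \<open>a ^ n - 1\<close> might
  sit in very few primes of large norm. Averaging over \<open>m\<close> turns total size into a
  number of distinct primes, because a prime of small order, which recurs often, also has small
  norm. The lower bound 2 on the conjugates gives
  \<open>|\<sigma>(a)^n - 1| \<le> |\<sigma>(a)|^(n + 1)\<close> and excludes
  \<open>a ^ n = 1\<close>. With \<open>L = ln |N(a)|\<close> and up to bounded errors, the exponent
  4/3 in the conjecture leaves half of \<open>n L\<close> to the primes dividing exactly once. The
  factor \<open>k ^ (k + 2)\<close> is chosen so that orders not divisible by \<open>k\<close> cost
  at most half of that half, since \<open>k / 2 ^ (k + 2) \<le> 1/4\<close>. The index of an ideal
  enters only through finite sets of pairwise incongruent elements: an upper bound for their size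
  needs neither an integral basis nor a quotient known to be finite, and a lower bound is given by
  explicit representatives.\<close>

definition int_span :: "complex set \<Rightarrow> complex set"
  where "int_span W = range (\<lambda>c :: complex \<Rightarrow> int. \<Sum>w\<in>W. of_int (c w) * w)"

lemma int_spanI: "x = (\<Sum>w\<in>W. of_int (c w) * w) \<Longrightarrow> x \<in> int_span W"
  unfolding int_span_def by blast

lemma int_span_add:
  assumes "x \<in> int_span W" "y \<in> int_span W"
  shows "x + y \<in> int_span W"
proof -
  obtain c d :: "complex \<Rightarrow> int" where "x = (\<Sum>w\<in>W. of_int (c w) * w)" "y = (\<Sum>w\<in>W. of_int (d w) * w)"
    using assms unfolding int_span_def by blast
  then have "x + y = (\<Sum>w\<in>W. of_int (c w + d w) * w)"
    by (simp add: sum.distrib ring_distribs)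
  then show ?thesis by (rule int_spanI)
qed

lemma int_span_scale:
  assumes "x \<in> int_span W"
  shows "of_int k * x \<in> int_span W"
proof -
  obtain c :: "complex \<Rightarrow> int" where "x = (\<Sum>w\<in>W. of_int (c w) * w)"
    using assms unfolding int_span_def by blast
  then have "of_int k * x = (\<Sum>w\<in>W. of_int (k * c w) * w)"
    by (simp add: sum_distrib_left mult.assoc)
  then show ?thesis by (rule int_spanI)
qed

lemma int_span_zero: "0 \<in> int_span W"
  unfolding int_span_def by (rule image_eqI[of _ _ "\<lambda>_. 0"]) auto

lemma int_span_sum: "(\<And>i. i \<in> I \<Longrightarrow> f i \<in> int_span W) \<Longrightarrow> sum f I \<in> int_span W"
  by (induction I rule: infinite_finite_induct) (auto intro: int_span_zero int_span_add)

lemma int_span_base: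
  assumes "finite W" "w \<in> W"
  shows "w \<in> int_span W"
proof -
  have "w = (\<Sum>v\<in>W. of_int (if v = w then 1 else 0) * v)"
    using assms by (subst sum.remove[of W w]) auto
  then show ?thesis by (rule int_spanI)
qed

text \<open>The determinant trick: the vector of generators is an eigenvector, with eigenvalue
  \<open>z\<close>, of the integer matrix that expresses multiplication by \<open>z\<close>, and the
  characteristic polynomial of this matrix is monic and integral. The element \<open>v\<close> keeps
  the vector nonzero.\<close>

lemma algebraic_int_of_stable_span:
  fixes z :: complex
  assumes fin: "finite W" and ne: "v \<in> W" "v \<noteq> 0"
    and stable: "\<And>w. w \<in> W \<Longrightarrow> z * w \<in> int_span W"
  shows "algebraic_int z"
proof -
  obtain ws where ws: "set ws = W" "distinct ws" using finite_distinct_list[OF fin] by blast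
  define n where "n = length ws"
  have "\<forall>w\<in>W. \<exists>c :: complex \<Rightarrow> int. z * w = (\<Sum>u\<in>W. of_int (c u) * u)"
    using stable unfolding int_span_def by blast
  then obtain c :: "complex \<Rightarrow> complex \<Rightarrow> int"
    where c: "\<And>w. w \<in> W \<Longrightarrow> z * w = (\<Sum>u\<in>W. of_int (c w u) * u)" by metis
  define A :: "int mat" where "A = mat n n (\<lambda>(i, j). c (ws ! i) (ws ! j))"
  define B :: "complex mat" where "B = map_mat of_int A"
  have A: "A \<in> carrier_mat n n" and B: "B \<in> carrier_mat n n" by (auto simp: A_def B_def)
  have sum_ws: "(\<Sum>u\<in>W. f u) = (\<Sum>j<n. f (ws ! j))" for f :: "complex \<Rightarrow> complex"
    using sum.reindex_bij_betw[OF bij_betw_nth[OF ws(2) refl ws(1)[symmetric]], of f]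
    by (simp add: n_def)
  define u where "u = vec n (\<lambda>i. ws ! i)"
  have dims: "dim_row B = n" "dim_col B = n" "dim_vec u = n" using B by (simp_all add: u_def)
  have eq: "(B *\<^sub>v u) $ i = z * ws ! i" if i: "i < n" for i
  proof -
    have "(B *\<^sub>v u) $ i = (\<Sum>j<n. B $$ (i, j) * ws ! j)"
      using i dims by (simp add: scalar_prod_def u_def lessThan_atLeast0)
    also have "\<dots> = (\<Sum>j<n. of_int (c (ws ! i) (ws ! j)) * ws ! j)"
      using i by (intro sum.cong refl) (simp add: B_def A_def)
    also have "\<dots> = z * ws ! i"
      unfolding c[OF nth_mem[of i ws, unfolded ws, folded n_def, OF i]] sum_ws ..
    finally show ?thesis .
  qed
  obtain i where i: "i < n" "ws ! i = v" using ne ws unfolding n_def by (metis in_set_conv_nth)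
  have "eigenvector B u z"
    unfolding eigenvector_def dims
  proof (intro conjI)
    show "u \<in> carrier_vec n" by (simp add: u_def)
    have "u $ i \<noteq> 0" using i ne by (simp add: u_def)
    then show "u \<noteq> 0\<^sub>v n" using i(1) by auto
    show "B *\<^sub>v u = z \<cdot>\<^sub>v u"
    proof (rule eq_vecI)
      fix i assume "i < dim_vec (z \<cdot>\<^sub>v u)"
      then have "i < n" by (simp add: dims)
      then show "(B *\<^sub>v u) $ i = (z \<cdot>\<^sub>v u) $ i" using eq[of i] dims by (simp add: u_def del: index_mult_mat_vec)
    qed (simp add: dims)
  qed
  then have "eigenvalue B z" unfolding eigenvalue_def by blast
  then have root: "poly (char_poly B) z = 0" using eigenvalue_root_char_poly[OF B] by simp
  have hom: "char_poly B = map_poly of_int (char_poly A)"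
    unfolding B_def by (rule of_int_hom.char_poly_hom[OF A])
  have "lead_coeff (char_poly A) = 1" using degree_monic_char_poly[OF A] by simp
  then show ?thesis using root unfolding hom algebraic_int_altdef_ipoly by blast
qed

lemma algebraic_int_monic_relation:
  fixes x :: complex
  assumes "algebraic_int x"
  obtains n c where "n > 0" "x ^ n = (\<Sum>i<n. of_int (c i) * x ^ i)"
proof -
  obtain p :: "int poly" where p: "poly (map_poly of_int p) x = 0" "lead_coeff p = 1"
    using assms algebraic_int_altdef_ipoly by blast
  define n where "n = degree p"
  have "poly (map_poly of_int p) x = (\<Sum>i\<le>n. of_int (coeff p i) * x ^ i)"
    by (simp add: poly_altdef n_def degree_map_poly coeff_map_poly)
  also have "{..n} = insert n {..<n}" by auto
  finally have eq: "x ^ n + (\<Sum>i<n. of_int (coeff p i) * x ^ i) = 0" using p by (simp add: n_def)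
  \<comment> \<open>For \<open>n = 0\<close> the relation would read 1 = 0.\<close>
  have "n > 0" using eq by (intro gr0I) auto
  moreover have "x ^ n = (\<Sum>i<n. of_int (- coeff p i) * x ^ i)"
    using eq by (simp add: sum_negf add_eq_0_iff)
  ultimately show ?thesis by (rule that)
qed

text \<open>The monomials \<open>x ^ i * y ^ j\<close> with exponents below the two degrees span a
  group that is stable under multiplication by \<open>x\<close> and by \<open>y\<close>, hence by
  their sum and product.\<close>

lemma algebraic_int_sum_prod:
  fixes x y :: complex
  assumes "algebraic_int x" "algebraic_int y"
  shows "algebraic_int (x + y) \<and> algebraic_int (x * y)"
proof -
  obtain n c where n: "n > 0" "x ^ n = (\<Sum>i<n. of_int (c i) * x ^ i)"
    using algebraic_int_monic_relation[OF assms(1)] .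
  obtain m d where m: "m > 0" "y ^ m = (\<Sum>i<m. of_int (d i) * y ^ i)"
    using algebraic_int_monic_relation[OF assms(2)] .
  define W where "W = (\<lambda>(i, j). x ^ i * y ^ j) ` ({..<n} \<times> {..<m})"
  have fin: "finite W" by (simp add: W_def)
  have base: "x ^ i * y ^ j \<in> int_span W" if "i < n" "j < m" for i j
  proof (rule int_span_base[OF fin])
    show "x ^ i * y ^ j \<in> W"
      unfolding W_def by (rule image_eqI[of _ _ "(i, j)"]) (simp_all add: that)
  qed
  have W_elim: "\<exists>i<n. \<exists>j<m. w = x ^ i * y ^ j" if "w \<in> W" for w
    using that by (auto simp: W_def)
  have xs: "x * w \<in> int_span W" if w: "w \<in> W" for w
  proof -
    obtain i j where ij: "i < n" "j < m" "w = x ^ i * y ^ j" using W_elim[OF w] by blast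
    show ?thesis
    proof (cases "Suc i < n")
      case True
      then show ?thesis using base[of "Suc i" j] ij by (simp add: mult.assoc)
    next
      case False
      then have "Suc i = n" using ij by simp
      then have "x * w = (\<Sum>i<n. of_int (c i) * (x ^ i * y ^ j))"
      proof -
        have "x * w = x ^ Suc i * y ^ j" by (simp add: ij(3))
        also have "\<dots> = (\<Sum>i<n. of_int (c i) * x ^ i) * y ^ j" unfolding \<open>Suc i = n\<close> n(2) ..
        finally show ?thesis by (simp add: sum_distrib_right mult.assoc)
      qed
      then show ?thesis using ij by (auto intro!: int_span_sum int_span_scale base)
    qed
  qed
  have ys: "y * w \<in> int_span W" if w: "w \<in> W" for w
  proof -
    obtain i j where ij: "i < n" "j < m" "w = x ^ i * y ^ j" using W_elim[OF w] by blast
    show ?thesis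
    proof (cases "Suc j < m")
      case True
      then show ?thesis using base[of i "Suc j"] ij by (simp add: algebra_simps)
    next
      case False
      then have "Suc j = m" using ij by simp
      then have "y * w = x ^ i * (\<Sum>j<m. of_int (d j) * y ^ j)"
      proof -
        have "y * w = x ^ i * y ^ Suc j" by (simp add: ij(3))
        then show ?thesis unfolding \<open>Suc j = m\<close> m(2) .
      qed
      then have "y * w = (\<Sum>j<m. of_int (d j) * (x ^ i * y ^ j))"
        by (simp add: sum_distrib_left mult.left_commute)
      then show ?thesis using ij by (auto intro!: int_span_sum int_span_scale base)
    qed
  qed
  have ext: "t * u \<in> int_span W" if "\<And>w. w \<in> W \<Longrightarrow> t * w \<in> int_span W" "u \<in> int_span W" for t u
  proof -
    obtain e :: "complex \<Rightarrow> int" where "u = (\<Sum>w\<in>W. of_int (e w) * w)"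
      using \<open>u \<in> int_span W\<close> unfolding int_span_def by blast
    then have "t * u = (\<Sum>w\<in>W. of_int (e w) * (t * w))"
      by (simp add: sum_distrib_left mult.left_commute)
    then show ?thesis using that by (auto intro!: int_span_sum int_span_scale)
  qed
  have one: "1 \<in> W" using n m unfolding W_def by (intro image_eqI[of _ _ "(0, 0)"]) auto
  have "(x + y) * w \<in> int_span W" if "w \<in> W" for w
    using int_span_add[OF xs[OF that] ys[OF that]] by (simp add: ring_distribs)
  moreover have "(x * y) * w \<in> int_span W" if "w \<in> W" for w
    using ext[OF xs ys[OF that]] by (simp add: mult.assoc)
  ultimately show ?thesis
    using algebraic_int_of_stable_span[OF fin one] by simp
qed

lemmas algebraic_int_add = algebraic_int_sum_prod[THEN conjunct1]
lemmas algebraic_int_mult = algebraic_int_sum_prod[THEN conjunct2]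

text \<open>Gaussian elimination. The subfield \<open>F\<close> is given by closure properties
  because the lemma serves both for the rationals and for \<open>K\<close>; the closure under
  division is harmless at 0 since \<open>x / 0 = 0\<close>.\<close>

lemma nontrivial_solution:
  fixes F :: "complex set" and A :: "'e \<Rightarrow> 'b \<Rightarrow> complex"
  assumes "finite E" "finite B" "card E < card B"
    and zero: "0 \<in> F" and one: "1 \<in> F"
    and diff: "\<And>x y. x \<in> F \<Longrightarrow> y \<in> F \<Longrightarrow> x - y \<in> F"
    and mult: "\<And>x y. x \<in> F \<Longrightarrow> y \<in> F \<Longrightarrow> x * y \<in> F"
    and divide: "\<And>x y. x \<in> F \<Longrightarrow> y \<in> F \<Longrightarrow> x / y \<in> F"
    and "\<And>e b. e \<in> E \<Longrightarrow> b \<in> B \<Longrightarrow> A e b \<in> F"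
  shows "\<exists>c. (\<forall>b. c b \<in> F) \<and> (\<exists>b\<in>B. c b \<noteq> 0) \<and> (\<forall>e\<in>E. (\<Sum>b\<in>B. A e b * c b) = 0)"
  using assms(1,2,3,9)
proof (induction E arbitrary: A B rule: finite_induct)
  case empty
  then obtain b where "b \<in> B" by fastforce
  then show ?case using zero one by (intro exI[of _ "\<lambda>_. 1"]) auto
next
  case (insert e E)
  note AF = insert.prems(3)
  show ?case
  proof (cases "\<forall>b\<in>B. A e b = 0")
    case True
    have "card E < card B" using insert by simp
    then obtain c where "\<forall>b. c b \<in> F" "\<exists>b\<in>B. c b \<noteq> 0" "\<forall>e\<in>E. (\<Sum>b\<in>B. A e b * c b) = 0"
      using insert.IH[OF insert.prems(1)] insert.prems(3) by (metis insertI2)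
    then show ?thesis using True by (intro exI[of _ c]) auto
  next
    case False
    then obtain b0 where b0: "b0 \<in> B" "A e b0 \<noteq> 0" by blast
    define B' where "B' = B - {b0}"
    \<comment> \<open>Solving equation \<open>e\<close> for the unknown at \<open>b0\<close> and
      substituting into equation \<open>e'\<close> leaves these coefficients.\<close>
    define A' where "A' e' b = A e' b - A e b / A e b0 * A e' b0" for e' b
    have A'F: "A' e' b \<in> F" if "e' \<in> E" "b \<in> B'" for e' b
      unfolding A'_def using that b0 insert.prems(3) by (intro diff mult divide) (auto simp: B'_def)
    have "finite B'" "card E < card B'" using insert b0 by (auto simp: B'_def)
    then obtain c where c: "\<forall>b. c b \<in> F" "\<exists>b\<in>B'. c b \<noteq> 0" "\<forall>e'\<in>E. (\<Sum>b\<in>B'. A' e' b * c b) = 0"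
      using insert.IH[of B' A'] A'F by metis
    define s where "s = (\<Sum>b\<in>B'. A e b * c b)"
    define c' where "c' = c(b0 := 0 - s / A e b0)"
    have sumF: "(\<Sum>b\<in>S. A e b * c b) \<in> F" if "S \<subseteq> B'" for S
    proof -
      have "finite S" using that \<open>finite B'\<close> finite_subset by blast
      then show ?thesis using that
      proof (induction S rule: finite_induct)
        case (insert b S)
        have "A e b * c b \<in> F" using insert.prems c(1) AF[of e b]
          by (intro mult) (auto simp: B'_def)
        moreover have "0 - (\<Sum>b\<in>S. A e b * c b) \<in> F" using insert zero by (intro diff) auto
        ultimately have "A e b * c b - (0 - (\<Sum>b\<in>S. A e b * c b)) \<in> F" by (rule diff)
        then show ?case using insert by simp
      qed (simp add: zero)
    qed
    have "s \<in> F" unfolding s_def by (rule sumF) simp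
    then have "0 - s / A e b0 \<in> F" using AF[of e b0] b0 zero by (intro diff divide) auto
    then have "c' b \<in> F" for b using c(1) by (simp add: c'_def)
    moreover have "\<exists>b\<in>B. c' b \<noteq> 0" using c(2) by (auto simp: c'_def B'_def)
    moreover have "(\<Sum>b\<in>B. A e' b * c' b) = A e' b0 * (- (s / A e b0)) + (\<Sum>b\<in>B'. A e' b * c b)" for e'
    proof -
      have "(\<Sum>b\<in>B. A e' b * c' b) = A e' b0 * c' b0 + (\<Sum>b\<in>B'. A e' b * c' b)"
        unfolding B'_def using insert.prems(1) b0(1) by (rule sum.remove)
      also have "(\<Sum>b\<in>B'. A e' b * c' b) = (\<Sum>b\<in>B'. A e' b * c b)"
        by (rule sum.cong) (auto simp: c'_def B'_def)
      finally show ?thesis by (simp add: c'_def)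
    qed
    note expand = this
    have "(\<Sum>b\<in>B. A e' b * c' b) = 0" if "e' \<in> insert e E" for e'
    proof (cases "e' = e")
      case True
      then show ?thesis using expand[of e] b0 by (simp add: s_def)
    next
      case False
      then have "(\<Sum>b\<in>B'. A' e' b * c b) = 0" using c(3) that by auto
      moreover have "(\<Sum>b\<in>B'. A' e' b * c b)
          = (\<Sum>b\<in>B'. A e' b * c b) - (\<Sum>b\<in>B'. A e' b0 / A e b0 * (A e b * c b))"
        unfolding sum_subtractf[symmetric] by (rule sum.cong) (simp_all add: A'_def algebra_simps)
      ultimately have "(\<Sum>b\<in>B'. A e' b * c b) = (\<Sum>b\<in>B'. A e' b0 / A e b0 * (A e b * c b))"
        by simp
      also have "\<dots> = A e' b0 / A e b0 * s" by (simp add: s_def sum_distrib_left)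
      finally show ?thesis using expand[of e'] by simp
    qed
    ultimately show ?thesis by blast
  qed
qed

section \<open>Number fields and their embeddings\<close>

lemma complex_ring_simps [simp]:
  "carrier complex_ring = UNIV" "x \<otimes>\<^bsub>complex_ring\<^esub> y = x * y" "\<one>\<^bsub>complex_ring\<^esub> = 1"
  "\<zero>\<^bsub>complex_ring\<^esub> = 0" "x \<oplus>\<^bsub>complex_ring\<^esub> y = x + y"
  by (simp_all add: ring_of_type_algebra_def)

lemma complex_ring_a_inv [simp]: "\<ominus>\<^bsub>complex_ring\<^esub> x = - x"
proof -
  interpret C: ring complex_ring by (rule ring_from_type_algebra)
  show ?thesis by (rule C.minus_equality) simp_all
qed

lemma subfield_complexE:
  assumes "subfield F complex_ring"
  shows "0 \<in> F" "1 \<in> F" "x \<in> F \<Longrightarrow> y \<in> F \<Longrightarrow> x + y \<in> F" "x \<in> F \<Longrightarrow> y \<in> F \<Longrightarrow> x * y \<in> F"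
    "x \<in> F \<Longrightarrow> - x \<in> F" "x \<in> F \<Longrightarrow> y \<in> F \<Longrightarrow> x - y \<in> F" "x \<in> F \<Longrightarrow> y \<in> F \<Longrightarrow> x / y \<in> F"
proof -
  have sr: "subring F complex_ring" using subfieldE(1)[OF assms] .
  show z: "0 \<in> F" and "1 \<in> F" and add: "x \<in> F \<Longrightarrow> y \<in> F \<Longrightarrow> x + y \<in> F"
    and mult: "\<And>x y. x \<in> F \<Longrightarrow> y \<in> F \<Longrightarrow> x * y \<in> F" and "x \<in> F \<Longrightarrow> - x \<in> F" for x y
    using subringE[OF sr] by (metis complex_ring_simps complex_ring_a_inv)+
  then show "x \<in> F \<Longrightarrow> y \<in> F \<Longrightarrow> x - y \<in> F" by (metis diff_conv_add_uminus)
  have units: "Units (complex_ring\<lparr>carrier := F\<rparr>) = F - {0}"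
    using subfield.subfield_Units[OF assms] by simp
  have inv: "inverse y \<in> F" if y: "y \<in> F" "y \<noteq> 0" for y
  proof -
    have "y \<in> Units (complex_ring\<lparr>carrier := F\<rparr>)" using y units by simp
    then obtain z where "z \<in> F" "y * z = 1" unfolding Units_def by auto
    then show ?thesis using inverse_unique by metis
  qed
  show "x / y \<in> F" if "x \<in> F" "y \<in> F"
    using mult[OF that(1) inv[OF that(2)]] z by (cases "y = 0") (simp_all add: divide_inverse)
qed

lemma subfield_Rats: "subfield \<rat> complex_ring"
proof -
  interpret C: ring complex_ring by (rule ring_from_type_algebra)
  show ?thesis
  proof (rule C.subfieldI)
    show "subcring \<rat> complex_ring"
      by (rule C.subcringI, rule C.subringI) (simp_all add: mult.commute)
    have "x \<in> Units (complex_ring\<lparr>carrier := \<rat>\<rparr>)" if "x \<in> \<rat>" "x \<noteq> 0" for x :: complex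
      unfolding Units_def using that by (auto intro!: bexI[of _ "inverse x"])
    then show "Units (complex_ring\<lparr>carrier := \<rat>\<rparr>) = \<rat> - {\<zero>\<^bsub>complex_ring\<^esub>}"
      by (auto simp: Units_def)
  qed
qed

text \<open>Each line extension in the inductive definition of dimension contributes its vector
  \<open>v\<close> to the spanning set. The clause \<open>0 \<in> E\<close> strengthens the
  induction: it places \<open>v\<close> itself in the extension.\<close>

lemma finite_spanning_set:
  assumes "ring.dimension complex_ring n \<rat> E"
  shows "\<exists>B. finite B \<and> B \<subseteq> E \<and> 0 \<in> E \<and> (\<forall>x\<in>E. \<exists>q. (\<forall>b. q b \<in> \<rat>) \<and> x = (\<Sum>b\<in>B. q b * b))"
proof -
  interpret C: ring complex_ring by (rule ring_from_type_algebra)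
  show ?thesis using assms
  proof (induction n "\<rat> :: complex set" E rule: C.dimension.induct)
    case zero_dim
    show ?case by (intro exI[of _ "{}"]) (auto intro: exI[of _ "\<lambda>_. 0"])
  next
    case (Suc_dim v E n)
    obtain B where B: "finite B" "B \<subseteq> E" "0 \<in> E"
      "\<And>x. x \<in> E \<Longrightarrow> \<exists>q. (\<forall>b. q b \<in> \<rat>) \<and> x = (\<Sum>b\<in>B. q b * b)" using Suc_dim(4) by blast
    have mem: "u \<in> C.line_extension \<rat> v E \<longleftrightarrow> (\<exists>k\<in>\<rat>. \<exists>e\<in>E. u = k * v + e)" for u
      using C.line_extension_mem_iff by simp
    have "v \<notin> B" using Suc_dim(2) B(2) by blast
    have "\<exists>q. (\<forall>b. q b \<in> \<rat>) \<and> x = (\<Sum>b\<in>insert v B. q b * b)"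
      if x: "x \<in> C.line_extension \<rat> v E" for x
    proof -
      obtain k e where ke: "k \<in> \<rat>" "e \<in> E" "x = k * v + e" using x unfolding mem by blast
      obtain q where q: "\<forall>b. q b \<in> \<rat>" "e = (\<Sum>b\<in>B. q b * b)" using B(4)[OF ke(2)] by blast
      have "(\<Sum>b\<in>B. (q(v := k)) b * b) = (\<Sum>b\<in>B. q b * b)"
        using \<open>v \<notin> B\<close> by (intro sum.cong) auto
      then have "x = (\<Sum>b\<in>insert v B. (q(v := k)) b * b)"
        using \<open>v \<notin> B\<close> B(1) ke q by simp
      then show ?thesis using q(1) ke(1) by (intro exI[of _ "q(v := k)"]) auto
    qed
    moreover have "insert v B \<subseteq> C.line_extension \<rat> v E"
    proof -
      have "v \<in> C.line_extension \<rat> v E" unfolding mem using B(3) by (intro bexI[of _ 1] bexI[of _ 0]) auto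
      moreover have "e \<in> C.line_extension \<rat> v E" if "e \<in> E" for e
        unfolding mem using that by (intro bexI[of _ 0] bexI[of _ e]) auto
      ultimately show ?thesis using B(2) by blast
    qed
    moreover have "0 \<in> C.line_extension \<rat> v E" unfolding mem using B(3) by (intro bexI[of _ 0]) auto
    ultimately show ?case using B(1) by (intro exI[of _ "insert v B"]) blast
  qed
qed

locale complex_number_field =
  fixes K :: "complex set"
  assumes number_field: "number_field K"
begin

lemma subfield_K: "subfield K complex_ring"
  using number_field unfolding number_field_def by blast

lemmas K_closed = subfield_complexE[OF subfield_K]

lemma K_sum: "(\<And>i. i \<in> I \<Longrightarrow> f i \<in> K) \<Longrightarrow> sum f I \<in> K"
  by (induction I rule: infinite_finite_induct) (auto intro: K_closed)

lemma K_prod: "(\<And>i. i \<in> I \<Longrightarrow> f i \<in> K) \<Longrightarrow> prod f I \<in> K"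
  by (induction I rule: infinite_finite_induct) (auto intro: K_closed)

lemma K_power: "x \<in> K \<Longrightarrow> x ^ n \<in> K"
  by (induction n) (auto intro: K_closed)

lemma of_nat_in_K: "of_nat n \<in> K"
  by (induction n) (auto intro: K_closed)

lemma of_int_in_K: "of_int n \<in> K"
  by (cases n rule: int_cases2) (auto intro: K_closed of_nat_in_K)

lemma Rats_subset_K: "\<rat> \<subseteq> K"
  by (auto elim!: Rats_cases' intro!: K_closed of_int_in_K)

lemma finite_dimension_K: "ring.finite_dimension complex_ring \<rat> K"
  using number_field unfolding number_field_def by blast

lemma field_degree_pos: "field_degree K > 0"
proof (rule gr0I)
  interpret C: field complex_ring by (rule field_from_type_algebra)
  assume "field_degree K = 0"
  moreover have "C.dimension (field_degree K) \<rat> K"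
    unfolding field_degree_def C.dim_def
    by (rule theI') (rule C.unique_dimension[OF subfield_Rats finite_dimension_K])
  ultimately have "K = {\<zero>\<^bsub>complex_ring\<^esub>}" using C.dimension_zero[OF subfield_Rats] by metis
  then show False using K_closed(2) by simp
qed

lemma embedding_hom:
  assumes "v \<in> embeddings K"
  shows "x \<in> K \<Longrightarrow> y \<in> K \<Longrightarrow> v (x + y) = v x + v y" "x \<in> K \<Longrightarrow> y \<in> K \<Longrightarrow> v (x * y) = v x * v y"
    "v 1 = 1" "v 0 = 0" "x \<in> K \<Longrightarrow> v (- x) = - v x" "x \<in> K \<Longrightarrow> y \<in> K \<Longrightarrow> v (x - y) = v x - v y"
proof -
  have h: "v \<in> Ring.ring_hom (field_ring K) complex_ring" using assms unfolding embeddings_def by blast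
  show add: "v (x + y) = v x + v y" if "x \<in> K" "y \<in> K" for x y
    using ring_hom_add[OF h, of x y] that by (simp add: field_ring_def)
  show "v (x * y) = v x * v y" if "x \<in> K" "y \<in> K" for x y
    using ring_hom_mult[OF h, of x y] that by (simp add: field_ring_def)
  show "v 1 = 1" using ring_hom_one[OF h] by (simp add: field_ring_def)
  show v0: "v 0 = 0" using add[of 0 0] K_closed(1) by simp
  show minus: "v (- x) = - v x" if "x \<in> K" for x
    using add[of x "- x"] that K_closed v0 by (simp add: add_eq_0_iff)
  show "v (x - y) = v x - v y" if "x \<in> K" "y \<in> K" for x y
    using add[of x "- y"] minus[of y] K_closed(5)[of y] that by simp
qed

lemma embedding_sum:
  assumes "v \<in> embeddings K" "\<And>i. i \<in> I \<Longrightarrow> f i \<in> K"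
  shows "v (sum f I) = (\<Sum>i\<in>I. v (f i))"
  using assms(2)
proof (induction I rule: infinite_finite_induct)
  case (insert i I)
  then show ?case using embedding_hom(1)[OF assms(1), of "f i" "sum f I"] K_sum[of I f] by simp
qed (simp_all add: embedding_hom(4)[OF assms(1)])

lemma embedding_prod:
  assumes "v \<in> embeddings K" "\<And>i. i \<in> I \<Longrightarrow> f i \<in> K"
  shows "v (prod f I) = (\<Prod>i\<in>I. v (f i))"
  using assms(2)
proof (induction I rule: infinite_finite_induct)
  case (insert i I)
  then show ?case using embedding_hom(2)[OF assms(1), of "f i" "prod f I"] K_prod[of I f] by simp
qed (simp_all add: embedding_hom(3)[OF assms(1)])

lemma embedding_power:
  assumes "v \<in> embeddings K" "x \<in> K"
  shows "v (x ^ n) = v x ^ n"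
  using embedding_prod[OF assms(1), of "{..<n}" "\<lambda>_. x"] assms(2) by simp

lemma embedding_of_int:
  assumes "v \<in> embeddings K"
  shows "v (of_int n) = of_int n"
proof -
  have nat: "v (of_nat n) = of_nat n" for n
    by (induction n) (simp_all add: embedding_hom[OF assms] of_nat_in_K K_closed)
  show ?thesis
    by (cases n rule: int_cases2) (simp_all add: nat embedding_hom[OF assms] of_nat_in_K)
qed

lemma embedding_nonzero:
  assumes "v \<in> embeddings K" "x \<in> K" "x \<noteq> 0"
  shows "v x \<noteq> 0"
proof -
  have "v x * v (1 / x) = v (x * (1 / x))"
    using assms K_closed by (intro embedding_hom(2)[symmetric]) auto
  then show ?thesis using assms embedding_hom(3)[OF assms(1)] by auto
qed

lemma embedding_inj: "v \<in> embeddings K \<Longrightarrow> x \<in> K \<Longrightarrow> y \<in> K \<Longrightarrow> v x = v y \<Longrightarrow> x = y"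
  using embedding_nonzero[of v "x - y"] embedding_hom(6)[of v x y] K_closed by auto

lemma embedding_Rats:
  assumes "v \<in> embeddings K" "q \<in> \<rat>"
  shows "v q = q"
proof -
  obtain a b :: int where ab: "b > 0" "q = of_int a / of_int b" using assms(2) by (auto elim: Rats_cases')
  then have "q * of_int b = of_int a" by simp
  then have "v q * of_int b = of_int a"
    using embedding_hom(2)[OF assms(1), of q "of_int b"] assms Rats_subset_K
    by (metis embedding_of_int of_int_in_K subsetD)
  moreover have "q * of_int b = of_int a" using ab by simp
  ultimately have "v q * of_int b = q * of_int b" by simp
  then show ?thesis using ab(1) by simp
qed

lemma embedding_poly:
  assumes "v \<in> embeddings K" "x \<in> K" "\<And>i. coeff p i \<in> \<rat>"
  shows "poly p (v x) = v (poly p x)"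
proof -
  have K: "coeff p i \<in> K" for i using assms(3) Rats_subset_K by blast
  have "poly p (v x) = (\<Sum>i\<le>degree p. v (coeff p i * x ^ i))"
    unfolding poly_altdef
    by (intro sum.cong) (simp_all add: embedding_hom(2)[OF assms(1)] K assms K_power embedding_power embedding_Rats)
  also have "\<dots> = v (poly p x)"
    unfolding poly_altdef using K assms by (intro embedding_sum[symmetric]) (auto intro: K_closed K_power)
  finally show ?thesis .
qed

lemma spanning_set:
  obtains B where "finite B" "B \<subseteq> K"
    "\<forall>x\<in>K. \<exists>q. (\<forall>b. q b \<in> \<rat>) \<and> x = (\<Sum>b\<in>B. q b * b)"
proof -
  obtain n where "ring.dimension complex_ring n \<rat> K"
    using finite_dimension_K ring.finite_dimension_def[OF ring_from_type_algebra] by blast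
  from finite_spanning_set[OF this] show thesis
    by (elim exE conjE) (rule that, assumption+)
qed

text \<open>The powers of \<open>x\<close> up to exponent \<open>card B\<close> are one more than
  the coordinates with respect to the spanning set \<open>B\<close>, so they are linearly
  dependent.\<close>

lemma algebraic_over_Rats:
  assumes "x \<in> K"
  shows "\<exists>p. p \<noteq> 0 \<and> (\<forall>i. coeff p i \<in> \<rat>) \<and> poly p x = 0"
proof -
  obtain B where B: "finite B" "B \<subseteq> K" "\<forall>x\<in>K. \<exists>q. (\<forall>b. q b \<in> \<rat>) \<and> x = (\<Sum>b\<in>B. q b * b)"
    using spanning_set .
  have "\<forall>j. \<exists>q. (\<forall>b. q b \<in> \<rat>) \<and> x ^ j = (\<Sum>b\<in>B. q b * b)" using B(3) K_power[OF assms] by blast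
  then obtain q where q: "\<And>j b. q j b \<in> \<rat>" "\<And>j. x ^ j = (\<Sum>b\<in>B. q j b * b)" by metis
  define m where "m = card B"
  have "\<exists>c. (\<forall>j. c j \<in> \<rat>) \<and> (\<exists>j\<in>{..m}. c j \<noteq> 0) \<and> (\<forall>b\<in>B. (\<Sum>j\<in>{..m}. q j b * c j) = 0)"
    by (rule nontrivial_solution) (use B(1) q(1) m_def in auto)
  then obtain c :: "nat \<Rightarrow> complex" where c: "\<And>j. c j \<in> \<rat>" "\<exists>j\<in>{..m}. c j \<noteq> 0"
    "\<And>b. b \<in> B \<Longrightarrow> (\<Sum>j\<in>{..m}. q j b * c j) = 0" by blast
  define p where "p = (\<Sum>j\<le>m. monom (c j) j)"
  have coeff: "coeff p i = (if i \<le> m then c i else 0)" for i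
    by (simp add: p_def coeff_sum)
  have "poly p x = (\<Sum>j\<le>m. c j * x ^ j)" by (simp add: p_def poly_sum poly_monom)
  also have "\<dots> = (\<Sum>j\<le>m. \<Sum>b\<in>B. c j * (q j b * b))"
    unfolding q(2) by (simp add: sum_distrib_left)
  also have "\<dots> = (\<Sum>b\<in>B. \<Sum>j\<le>m. c j * (q j b * b))" by (rule sum.swap)
  also have "\<dots> = (\<Sum>b\<in>B. (\<Sum>j\<le>m. q j b * c j) * b)"
    by (simp add: sum_distrib_left sum_distrib_right mult_ac)
  also have "\<dots> = 0" using c(3) by simp
  finally have "poly p x = 0" .
  moreover have "p \<noteq> 0" using coeff c(2) by (metis atMost_iff coeff_0)
  ultimately show ?thesis using coeff c(1) by (intro exI[of _ p]) auto
qed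

text \<open>An embedding is determined by its values on a finite spanning set, and each of these is
  a root of a fixed rational polynomial.\<close>

lemma finite_embeddings: "finite (embeddings K)"
proof -
  obtain B where B: "finite B" "B \<subseteq> K"
    "\<forall>x\<in>K. \<exists>q. (\<forall>b. q b \<in> \<rat>) \<and> x = (\<Sum>b\<in>B. q b * b)"
    using spanning_set .
  have "\<forall>b\<in>B. \<exists>p. p \<noteq> 0 \<and> (\<forall>i. coeff p i \<in> \<rat>) \<and> poly p b = 0"
    using algebraic_over_Rats B(2) by blast
  then obtain p where p: "\<And>b. b \<in> B \<Longrightarrow> p b \<noteq> 0" "\<And>b i. b \<in> B \<Longrightarrow> coeff (p b) i \<in> \<rat>"
    "\<And>b. b \<in> B \<Longrightarrow> poly (p b) b = 0" by metis
  have "(\<lambda>v. restrict v B) ` embeddings K \<subseteq> Pi\<^sub>E B (\<lambda>b. {z. poly (p b) z = 0})"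
  proof
    fix w assume "w \<in> (\<lambda>v. restrict v B) ` embeddings K"
    then obtain v where v: "v \<in> embeddings K" "w = restrict v B" by blast
    have "poly (p b) (v b) = 0" if "b \<in> B" for b
      using embedding_poly[OF v(1), of b "p b"] p(2,3)[OF that] B(2) that embedding_hom(4)[OF v(1)] by auto
    then show "w \<in> Pi\<^sub>E B (\<lambda>b. {z. poly (p b) z = 0})" using v(2) by auto
  qed
  then have "finite ((\<lambda>v. restrict v B) ` embeddings K)"
    by (rule finite_subset) (intro finite_PiE B(1) poly_roots_finite p(1))
  moreover have "inj_on (\<lambda>v. restrict v B) (embeddings K)"
  proof (rule inj_onI)
    fix v w assume v: "v \<in> embeddings K" and w: "w \<in> embeddings K" and eq: "restrict v B = restrict w B"
    have eqB: "v b = w b" if "b \<in> B" for b using eq that by (metis restrict_apply')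
    have "v x = w x" if "x \<in> K" for x
    proof -
      obtain q where q: "\<forall>b. q b \<in> \<rat>" "x = (\<Sum>b\<in>B. q b * b)" using B(3) \<open>x \<in> K\<close> by blast
      have "u x = (\<Sum>b\<in>B. q b * u b)" if "u \<in> embeddings K" for u
      proof -
        have "u x = (\<Sum>b\<in>B. u (q b * b))"
          unfolding q(2) using q(1) B(2) Rats_subset_K by (intro embedding_sum[OF that] K_closed) auto
        also have "\<dots> = (\<Sum>b\<in>B. q b * u b)"
          using q(1) B(2) Rats_subset_K
          by (intro sum.cong) (auto simp: embedding_hom(2)[OF that] embedding_Rats[OF that] subset_iff)
        finally show ?thesis .
      qed
      from this[OF v] this[OF w] eqB show ?thesis by simp
    qed
    then show "v = w"
      using v w unfolding embeddings_def by (intro extensionalityI[of v K w]) auto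
  qed
  ultimately show ?thesis using finite_imageD by blast
qed

end

section \<open>Galois conjugates\<close>

lemma common_denominator:
  fixes d :: "'b \<Rightarrow> complex"
  assumes "finite B" "\<And>b. b \<in> B \<Longrightarrow> d b \<in> \<rat>"
  shows "\<exists>m::int. m > 0 \<and> (\<forall>b\<in>B. of_int m * d b \<in> \<int>)"
  using assms
proof (induction B rule: finite_induct)
  case (insert b B)
  then obtain m :: int where m: "m > 0" "\<forall>b\<in>B. of_int m * d b \<in> \<int>" by auto
  obtain p q :: int where pq: "q > 0" "d b = of_int p / of_int q"
    using insert.prems[of b] by (auto elim: Rats_cases')
  then have "of_int q * d b = of_int p" by simp
  then have "of_int (m * q) * d b = of_int (m * p)" by (simp add: mult.assoc)
  then have "of_int (m * q) * d b \<in> \<int>" by (metis Ints_of_int)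
  moreover have "of_int (m * q) * d c \<in> \<int>" if "c \<in> B" for c
  proof -
    have "of_int (m * q) * d c = of_int q * (of_int m * d c)" by simp
    moreover have "of_int q * (of_int m * d c) \<in> \<int>" using m(2) that by (blast intro: Ints_mult[OF Ints_of_int])
    ultimately show ?thesis by (simp only:)
  qed
  ultimately show ?case using m(1) pq(1) by (intro exI[of _ "m * q"]) auto
qed (auto intro: exI[of _ 1])

locale galois_field =
  fixes K :: "complex set"
  assumes galois: "galois_number_field K"

sublocale galois_field \<subseteq> complex_number_field K
  using galois unfolding galois_number_field_def by unfold_locales blast

context galois_field
begin

lemma Gal_iff:
  "\<sigma> \<in> Gal K \<longleftrightarrow> \<sigma> \<in> embeddings K \<and> bij_betw \<sigma> K K"
proof
  assume s: "\<sigma> \<in> Gal K"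
  then have h: "\<sigma> \<in> ring_iso (field_ring K) (field_ring K)" "\<sigma> \<in> extensional K"
    unfolding Gal_def by auto
  then have "\<sigma> \<in> Ring.ring_hom (field_ring K) complex_ring"
    unfolding ring_iso_def Ring.ring_hom_def field_ring_def by auto
  then show "\<sigma> \<in> embeddings K \<and> bij_betw \<sigma> K K"
    using h unfolding embeddings_def ring_iso_def field_ring_def by auto
next
  assume s: "\<sigma> \<in> embeddings K \<and> bij_betw \<sigma> K K"
  have "\<sigma> \<in> Ring.ring_hom (field_ring K) (field_ring K)"
  proof (rule ring_hom_memI)
    fix x assume "x \<in> carrier (field_ring K)"
    then show "\<sigma> x \<in> carrier (field_ring K)"
      using s bij_betwE by (fastforce simp: field_ring_def)
  qed (use s in \<open>auto simp: field_ring_def embedding_hom\<close>)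
  then show "\<sigma> \<in> Gal K"
    using s unfolding Gal_def ring_iso_def by (auto simp: embeddings_def field_ring_def embedding_Rats)
qed

lemma Gal_embedding: "\<sigma> \<in> Gal K \<Longrightarrow> \<sigma> \<in> embeddings K"
  using Gal_iff by blast

lemma Gal_closed: "\<sigma> \<in> Gal K \<Longrightarrow> x \<in> K \<Longrightarrow> \<sigma> x \<in> K"
  using Gal_iff bij_betwE by blast

lemma finite_Gal: "finite (Gal K)"
  using finite_subset[OF _ finite_embeddings] Gal_embedding by blast

lemma id_in_Gal: "restrict (\<lambda>x. x) K \<in> Gal K"
  unfolding Gal_iff
proof
  show "restrict (\<lambda>x. x) K \<in> embeddings K"
    unfolding embeddings_def Ring.ring_hom_def field_ring_def
    by (auto simp: K_closed)
  show "bij_betw (restrict (\<lambda>x. x) K) K K"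
    by (auto simp: bij_betw_def inj_on_def)
qed

lemma Gal_compose:
  assumes "\<sigma> \<in> Gal K" "\<tau> \<in> Gal K"
  shows "compose K \<sigma> \<tau> \<in> Gal K"
  unfolding Gal_iff
proof
  note hom = embedding_hom[OF Gal_embedding[OF assms(1)]] embedding_hom[OF Gal_embedding[OF assms(2)]]
  show "compose K \<sigma> \<tau> \<in> embeddings K"
    unfolding embeddings_def Ring.ring_hom_def field_ring_def
    by (auto simp: compose_def K_closed hom Gal_closed[OF assms(1)] Gal_closed[OF assms(2)])
  show "bij_betw (compose K \<sigma> \<tau>) K K"
    using assms Gal_iff by (blast intro: bij_betw_compose)
qed

text \<open>Left translation in a finite group; it reindexes sums and products over conjugates.
  \<open>compose K\<close> is used because it keeps the composite extensional.\<close>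

lemma bij_Gal_compose:
  assumes "\<tau> \<in> Gal K"
  shows "bij_betw (compose K \<tau>) (Gal K) (Gal K)"
proof -
  have "inj_on (compose K \<tau>) (Gal K)"
  proof (rule inj_onI)
    fix \<sigma> \<sigma>' assume s: "\<sigma> \<in> Gal K" "\<sigma>' \<in> Gal K" and eq: "compose K \<tau> \<sigma> = compose K \<tau> \<sigma>'"
    have "\<sigma> x = \<sigma>' x" if "x \<in> K" for x
    proof -
      have "\<tau> (\<sigma> x) = \<tau> (\<sigma>' x)" using fun_cong[OF eq, of x] that by (simp add: compose_def)
      then show ?thesis
        using embedding_inj[OF Gal_embedding[OF assms]] Gal_closed s that by blast
    qed
    then show "\<sigma> = \<sigma>'"
      using s Gal_embedding unfolding embeddings_def by (intro extensionalityI[of \<sigma> K \<sigma>']) auto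
  qed
  then show ?thesis
    using endo_inj_surj[OF finite_Gal] Gal_compose[OF assms] unfolding bij_betw_def by blast
qed

lemma card_Gal_pos: "card (Gal K) > 0"
  using id_in_Gal finite_Gal card_gt_0_iff by blast

lemma Gal_fixed_Rats: "x \<in> K \<Longrightarrow> (\<And>\<sigma>. \<sigma> \<in> Gal K \<Longrightarrow> \<sigma> x = x) \<Longrightarrow> x \<in> \<rat>"
  using galois unfolding galois_number_field_def by blast

text \<open>For finite sets this agrees with independence over the rationals, by clearing
  denominators. Integer coefficients fit \<open>int_span\<close>.\<close>

definition int_independent :: "complex set \<Rightarrow> bool"
  where "int_independent B \<longleftrightarrow>
    (\<forall>c :: complex \<Rightarrow> int. (\<Sum>b\<in>B. of_int (c b) * b) = 0 \<longrightarrow> (\<forall>b\<in>B. c b = 0))"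

text \<open>
  Artin's argument: a solution in \<open>K\<close> of minimal support of the conjugated linear relations,
  normalised to have a coefficient \<open>1\<close>, is fixed by the Galois group and hence rational.
\<close>

lemma int_independent_card:
  assumes "finite B" "B \<subseteq> K" "int_independent B"
  shows "card B \<le> card (Gal K)"
proof (rule ccontr)
  assume "\<not> card B \<le> card (Gal K)"
  then have less: "card (Gal K) < card B" by simp
  define S where "S = {c. (\<forall>b. c b \<in> K) \<and> (\<exists>b\<in>B. c b \<noteq> 0) \<and> (\<forall>\<sigma>\<in>Gal K. (\<Sum>b\<in>B. \<sigma> b * c b) = 0)}"
  define supp where "supp c = card {b\<in>B. c b \<noteq> 0}" for c :: "complex \<Rightarrow> complex"
  have "\<exists>c. (\<forall>b. c b \<in> K) \<and> (\<exists>b\<in>B. c b \<noteq> 0) \<and> (\<forall>\<sigma>\<in>Gal K. (\<Sum>b\<in>B. \<sigma> b * c b) = 0)"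
    by (rule nontrivial_solution[where A = "\<lambda>\<sigma> b. \<sigma> b"])
      (use finite_Gal assms less K_closed Gal_closed in auto)
  then obtain c0 where "c0 \<in> S" unfolding S_def by blast
  then obtain c where c: "c \<in> S" and min: "\<And>c'. c' \<in> S \<Longrightarrow> supp c \<le> supp c'"
    using ex_has_least_nat[of "\<lambda>c. c \<in> S" c0 supp] by blast
  obtain b0 where b0: "b0 \<in> B" "c b0 \<noteq> 0" using c unfolding S_def by blast
  define d where "d b = c b / c b0" for b
  have dK: "d b \<in> K" for b using c unfolding S_def d_def by (auto intro: K_closed)
  have d_sol: "(\<Sum>b\<in>B. \<sigma> b * d b) = 0" if "\<sigma> \<in> Gal K" for \<sigma>
  proof -
    have "(\<Sum>b\<in>B. \<sigma> b * d b) = (\<Sum>b\<in>B. \<sigma> b * c b) / c b0"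
      by (simp add: d_def sum_divide_distrib)
    then show ?thesis using c that unfolding S_def by simp
  qed
  have d_rat: "d b \<in> \<rat>" if b: "b \<in> B" for b
  proof (rule Gal_fixed_Rats[OF dK])
    fix \<tau> assume t: "\<tau> \<in> Gal K"
    note hom = embedding_hom[OF Gal_embedding[OF t]]
    \<comment> \<open>The difference of the normalised solution and its conjugate solves the system
      too, but vanishes at \<open>b0\<close> and so has smaller support; by minimality it is zero on
      \<open>B\<close>.\<close>
    define e where "e b = d b - \<tau> (d b)" for b
    have conj_sol: "(\<Sum>b\<in>B. \<rho> b * \<tau> (d b)) = 0" if r: "\<rho> \<in> Gal K" for \<rho>
    proof -
      obtain \<sigma> where s: "\<sigma> \<in> Gal K" "\<rho> = compose K \<tau> \<sigma>"
        using bij_betw_imp_surj_on[OF bij_Gal_compose[OF t]] r by blast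
      have "(\<Sum>b\<in>B. \<rho> b * \<tau> (d b)) = (\<Sum>b\<in>B. \<tau> (\<sigma> b * d b))"
        using assms(2) s(1) dK by (intro sum.cong) (auto simp: s(2) compose_def hom Gal_closed subset_iff)
      also have "\<dots> = \<tau> (\<Sum>b\<in>B. \<sigma> b * d b)"
        using assms(2)
        by (intro embedding_sum[OF Gal_embedding[OF t], symmetric] K_closed(4)[OF Gal_closed[OF s(1)] dK]) auto
      finally show ?thesis using d_sol[OF s(1)] hom(4) by simp
    qed
    have "\<tau> (d b0) = 1" and "d b0 = 1" using b0 hom(3) by (simp_all add: d_def)
    then have "e b0 = 0" by (simp add: e_def)
    have "{b\<in>B. e b \<noteq> 0} \<subset> {b\<in>B. c b \<noteq> 0}"
    proof
      show "{b\<in>B. e b \<noteq> 0} \<subseteq> {b\<in>B. c b \<noteq> 0}" using hom(4) by (auto simp: e_def d_def)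
      show "{b\<in>B. e b \<noteq> 0} \<noteq> {b\<in>B. c b \<noteq> 0}" using b0 \<open>e b0 = 0\<close> by blast
    qed
    then have "supp e < supp c" unfolding supp_def using assms(1) by (intro psubset_card_mono) auto
    then have "e \<notin> S" using min[of e] by linarith
    moreover have "\<forall>b. e b \<in> K" unfolding e_def using K_closed(6)[OF dK Gal_closed[OF t dK]] by blast
    moreover have "\<forall>\<sigma>\<in>Gal K. (\<Sum>b\<in>B. \<sigma> b * e b) = 0"
      by (simp add: e_def right_diff_distrib sum_subtractf d_sol conj_sol)
    ultimately have "e b = 0" using b unfolding S_def by blast
    then show "\<tau> (d b) = d b" by (simp add: e_def)
  qed
  \<comment> \<open>The relation for the identity automorphism, cleared of denominators, is an
    integral dependence of \<open>B\<close> whose coefficient at \<open>b0\<close> is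
    \<open>m\<close>.\<close>
  obtain m :: int where m: "m > 0" "\<forall>b\<in>B. of_int m * d b \<in> \<int>"
    using common_denominator[of B d, OF assms(1) d_rat] by blast
  have "\<forall>b\<in>B. \<exists>k::int. of_int m * d b = of_int k" using m(2) by (auto elim: Ints_cases)
  then obtain k :: "complex \<Rightarrow> int" where k: "\<And>b. b \<in> B \<Longrightarrow> of_int m * d b = of_int (k b)" by metis
  have "(\<Sum>b\<in>B. b * d b) = (\<Sum>b\<in>B. restrict (\<lambda>x. x) K b * d b)"
    using assms(2) by (intro sum.cong) auto
  then have "(\<Sum>b\<in>B. b * d b) = 0" using d_sol[OF id_in_Gal] by simp
  moreover have "(\<Sum>b\<in>B. of_int (k b) * b) = of_int m * (\<Sum>b\<in>B. b * d b)"
    unfolding sum_distrib_left by (rule sum.cong) (simp_all add: k[symmetric])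
  ultimately have "k b0 = 0" using assms(3) b0(1) unfolding int_independent_def by simp
  then show False using k[OF b0(1)] b0 m(1) by (simp add: d_def)
qed

section \<open>The ring of integers and the norm\<close>

definition integers :: "complex set"
  where "integers = {x \<in> K. algebraic_int x}"

lemma integers_0: "0 \<in> integers" and integers_1: "1 \<in> integers"
  unfolding integers_def using K_closed by (auto intro: int_imp_algebraic_int)

lemma integers_of_int: "of_int n \<in> integers"
  unfolding integers_def using of_int_in_K by (auto intro: int_imp_algebraic_int)

lemma integers_of_nat: "of_nat n \<in> integers"
  using integers_of_int[of "int n"] by simp

lemma integers_add: "x \<in> integers \<Longrightarrow> y \<in> integers \<Longrightarrow> x + y \<in> integers"
  unfolding integers_def using K_closed algebraic_int_add by auto

lemma integers_mult: "x \<in> integers \<Longrightarrow> y \<in> integers \<Longrightarrow> x * y \<in> integers"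
  unfolding integers_def using K_closed algebraic_int_mult by auto

lemma integers_minus: "x \<in> integers \<Longrightarrow> - x \<in> integers"
  unfolding integers_def using K_closed by auto

lemma integers_diff: "x \<in> integers \<Longrightarrow> y \<in> integers \<Longrightarrow> x - y \<in> integers"
  using integers_add[OF _ integers_minus, of x y] by simp

lemma integers_power: "x \<in> integers \<Longrightarrow> x ^ n \<in> integers"
  by (induction n) (auto intro: integers_mult integers_1)

lemma integers_sum: "(\<And>i. i \<in> I \<Longrightarrow> f i \<in> integers) \<Longrightarrow> sum f I \<in> integers"
  by (induction I rule: infinite_finite_induct) (auto intro: integers_0 integers_add)

lemma integers_prod: "(\<And>i. i \<in> I \<Longrightarrow> f i \<in> integers) \<Longrightarrow> prod f I \<in> integers"
  by (induction I rule: infinite_finite_induct) (auto intro: integers_1 integers_mult)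

lemmas integers_closed = integers_0 integers_1 integers_of_int integers_of_nat integers_add
  integers_mult integers_minus integers_diff integers_power integers_sum integers_prod

lemma integers_subset_K: "x \<in> integers \<Longrightarrow> x \<in> K"
  unfolding integers_def by simp

text \<open>A polynomial with integer coefficients vanishes at \<open>x\<close> exactly when it
  vanishes at \<open>v x\<close>.\<close>

lemma embedding_algebraic_int_iff:
  assumes "v \<in> embeddings K" "x \<in> K"
  shows "algebraic_int (v x) \<longleftrightarrow> algebraic_int x"
proof -
  have "poly p (v x) = 0 \<longleftrightarrow> poly p x = 0" if p: "\<forall>i. coeff p i \<in> \<int>" for p
  proof -
    have "coeff p i \<in> \<rat>" for i using p Ints_subset_Rats by blast
    moreover from this have "poly p x \<in> K"
      unfolding poly_altdef using Rats_subset_K assms(2) by (auto intro!: K_sum K_closed K_power)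
    ultimately show ?thesis
      using embedding_poly[OF assms, of p] embedding_nonzero[OF assms(1)] embedding_hom(4)[OF assms(1)] by metis
  qed
  then show ?thesis unfolding algebraic_int.simps by metis
qed

lemma Gal_integers: "\<sigma> \<in> Gal K \<Longrightarrow> x \<in> integers \<Longrightarrow> \<sigma> x \<in> integers"
  using embedding_algebraic_int_iff Gal_embedding Gal_closed unfolding integers_def by blast

lemma Gal_integers_surj:
  assumes "\<sigma> \<in> Gal K" "y \<in> integers"
  shows "\<exists>x\<in>integers. y = \<sigma> x"
proof -
  have "y \<in> \<sigma> ` K" using assms Gal_iff bij_betw_imp_surj_on integers_subset_K by metis
  then show ?thesis
    using embedding_algebraic_int_iff[OF Gal_embedding[OF assms(1)]] assms(2) unfolding integers_def by auto
qed

text \<open>The absolute value of the field norm, as \<open>K\<close> is Galois.\<close>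

definition norm_K :: "complex \<Rightarrow> real"
  where "norm_K x = (\<Prod>\<sigma>\<in>Gal K. cmod (\<sigma> x))"

text \<open>Conjugation permutes the factors, so the product is rational, and a rational algebraic
  integer is an integer.\<close>

lemma Gal_prod_Ints:
  assumes "x \<in> integers"
  shows "(\<Prod>\<sigma>\<in>Gal K. \<sigma> x) \<in> \<int>"
proof -
  let ?N = "\<Prod>\<sigma>\<in>Gal K. \<sigma> x"
  have x: "x \<in> K" using assms integers_subset_K by blast
  have "\<tau> ?N = ?N" if t: "\<tau> \<in> Gal K" for \<tau>
  proof -
    have "\<tau> ?N = (\<Prod>\<sigma>\<in>Gal K. \<tau> (\<sigma> x))"
      by (rule embedding_prod[OF Gal_embedding[OF t]]) (rule Gal_closed[OF _ x])
    also have "\<dots> = (\<Prod>\<sigma>\<in>Gal K. compose K \<tau> \<sigma> x)"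
      using x by (simp add: compose_def)
    also have "\<dots> = ?N"
      using prod.reindex_bij_betw[OF bij_Gal_compose[OF t], of "\<lambda>\<sigma>. \<sigma> x"] .
    finally show ?thesis .
  qed
  moreover have N: "?N \<in> integers" by (rule integers_prod) (rule Gal_integers[OF _ assms])
  ultimately have "?N \<in> \<rat>" using Gal_fixed_Rats integers_subset_K by blast
  then show ?thesis using N rational_algebraic_int_is_int unfolding integers_def by blast
qed

lemma Gal_prod_of_nat:
  assumes "x \<in> integers"
  shows "\<exists>n. norm_K x = real n \<and> ((\<Prod>\<sigma>\<in>Gal K. \<sigma> x) = of_nat n \<or> (\<Prod>\<sigma>\<in>Gal K. \<sigma> x) = - of_nat n)"
proof -
  obtain m :: int where m: "(\<Prod>\<sigma>\<in>Gal K. \<sigma> x) = of_int m" using Gal_prod_Ints[OF assms] by (auto elim: Ints_cases)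
  have "norm_K x = cmod (of_int m)" unfolding norm_K_def m[symmetric] by (rule prod_norm)
  then have "norm_K x = real (nat \<bar>m\<bar>)" by simp
  moreover have "(of_int m :: complex) = of_nat (nat \<bar>m\<bar>) \<or> (of_int m :: complex) = - of_nat (nat \<bar>m\<bar>)"
    by (cases "m \<ge> 0") (simp_all add: of_nat_nat)
  ultimately show ?thesis unfolding m by blast
qed

lemma norm_K_pos: "x \<in> K \<Longrightarrow> x \<noteq> 0 \<Longrightarrow> norm_K x > 0"
  unfolding norm_K_def using embedding_nonzero Gal_embedding by (intro prod_pos) auto

text \<open>Up to sign, the cofactor is the product of the other conjugates, which lie in
  \<open>K\<close> because \<open>K\<close> is Galois.\<close>

lemma norm_K_multiple:
  assumes "x \<in> integers"
  shows "\<exists>n. norm_K x = real n \<and> (\<exists>y\<in>integers. of_nat n = x * y)"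
proof -
  let ?\<iota> = "restrict (\<lambda>x. x) K"
  obtain n where n: "norm_K x = real n"
    "(\<Prod>\<sigma>\<in>Gal K. \<sigma> x) = of_nat n \<or> (\<Prod>\<sigma>\<in>Gal K. \<sigma> x) = - of_nat n"
    using Gal_prod_of_nat[OF assms] by blast
  define y where "y = (\<Prod>\<sigma>\<in>Gal K - {?\<iota>}. \<sigma> x)"
  have "(\<Prod>\<sigma>\<in>Gal K. \<sigma> x) = ?\<iota> x * y"
    unfolding y_def by (rule prod.remove[OF finite_Gal id_in_Gal])
  then have eq: "(\<Prod>\<sigma>\<in>Gal K. \<sigma> x) = x * y" using assms integers_subset_K by simp
  have "y \<in> integers" unfolding y_def by (rule integers_prod) (rule Gal_integers[OF _ assms], simp)
  moreover have "of_nat n = x * y \<or> of_nat n = x * (- y)" using n(2) unfolding eq by auto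
  ultimately show ?thesis using n(1) integers_minus by blast
qed

end

section \<open>The index of a principal ideal\<close>

lemma int_span_minus: "x \<in> int_span W \<Longrightarrow> - x \<in> int_span W"
  using int_span_scale[of x W "-1"] by simp

text \<open>Elements whose coordinates agree modulo \<open>m\<close> differ by \<open>m\<close>
  times an element of the span. One choice of coordinates for each element suffices, so
  \<open>B\<close> may be dependent.\<close>

lemma card_le_of_span_separated:
  fixes m :: nat
  assumes "finite B" "finite Z" "Z \<subseteq> int_span B" "m > 0"
    and sep: "\<And>x y u. x \<in> Z \<Longrightarrow> y \<in> Z \<Longrightarrow> u \<in> int_span B \<Longrightarrow> x - y = of_nat m * u \<Longrightarrow> x = y"
  shows "card Z \<le> m ^ card B"
proof -
  have "\<forall>z\<in>Z. \<exists>c :: complex \<Rightarrow> int. z = (\<Sum>b\<in>B. of_int (c b) * b)"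
    using assms(3) unfolding int_span_def by blast
  then obtain c :: "complex \<Rightarrow> complex \<Rightarrow> int"
    where c: "\<And>z. z \<in> Z \<Longrightarrow> z = (\<Sum>b\<in>B. of_int (c z b) * b)" by metis
  define f where "f z = (\<lambda>b\<in>B. c z b mod int m)" for z
  have "inj_on f Z"
  proof (rule inj_onI)
    fix x y assume x: "x \<in> Z" and y: "y \<in> Z" and eq: "f x = f y"
    have "\<exists>k. c x b - c y b = int m * k" if b: "b \<in> B" for b
    proof -
      have "c x b mod int m = c y b mod int m" using fun_cong[OF eq, of b] b by (simp add: f_def)
      then have "int m dvd c x b - c y b" by (simp add: mod_eq_dvd_iff)
      then show ?thesis by (auto simp: dvd_def)
    qed
    then obtain k where k: "\<And>b. b \<in> B \<Longrightarrow> c x b - c y b = int m * k b" by metis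
    have "x - y = (\<Sum>b\<in>B. of_int (c x b - c y b) * b)"
      by (subst c[OF x], subst c[OF y]) (simp add: sum_subtractf left_diff_distrib)
    also have "\<dots> = of_nat m * (\<Sum>b\<in>B. of_int (k b) * b)"
      unfolding sum_distrib_left by (rule sum.cong) (simp_all add: k mult.assoc)
    finally show "x = y" by (rule sep[OF x y int_spanI[OF refl]])
  qed
  moreover have "f ` Z \<subseteq> Pi\<^sub>E B (\<lambda>_. {0..<int m})" using assms(4) by (auto simp: f_def)
  ultimately have "card Z \<le> card (Pi\<^sub>E B (\<lambda>_. {0..<int m}))"
    using assms(1) by (intro card_inj_on_le finite_PiE) auto
  then show ?thesis using assms(1) by (simp add: card_PiE)
qed

lemma ex_max_card:
  assumes "P S" "\<And>T. P T \<Longrightarrow> card T \<le> b"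
  shows "\<exists>S. P S \<and> (\<forall>T. P T \<longrightarrow> card T \<le> card S)"
  by (rule ex_has_greatest_nat[of P S card "Suc b"]) (simp_all add: assms less_Suc_eq_le)

context galois_field
begin

definition principal :: "complex \<Rightarrow> complex set"
  where "principal x = (\<lambda>y. x * y) ` integers"

text \<open>Pairwise incongruent elements modulo \<open>I\<close>. The largest size of such a set is
  the index of \<open>I\<close>, which can thus be bounded before it is known to be finite.\<close>

definition separated :: "complex set \<Rightarrow> complex set \<Rightarrow> bool"
  where "separated I U \<longleftrightarrow> U \<subseteq> integers \<and> (\<forall>x\<in>U. \<forall>y\<in>U. x - y \<in> I \<longrightarrow> x = y)"

lemma separatedD: "separated I U \<Longrightarrow> x \<in> U \<Longrightarrow> y \<in> U \<Longrightarrow> x - y \<in> I \<Longrightarrow> x = y"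
  unfolding separated_def by blast

lemma separated_mono: "separated J U \<Longrightarrow> I \<subseteq> J \<Longrightarrow> separated I U"
  unfolding separated_def by blast

lemma principalI: "y \<in> integers \<Longrightarrow> x * y \<in> principal x"
  unfolding principal_def by blast

lemma int_span_integers: "B \<subseteq> integers \<Longrightarrow> x \<in> int_span B \<Longrightarrow> x \<in> integers"
  unfolding int_span_def by (auto intro!: integers_sum integers_mult integers_of_int)

text \<open>Artin's bound makes a largest independent set exist; adjoining \<open>y\<close> to it
  creates a relation, in which the coefficient of \<open>y\<close> cannot vanish.\<close>

lemma maximal_independent_set:
  "\<exists>B. finite B \<and> B \<subseteq> integers \<and> card B \<le> card (Gal K) \<and>
    (\<forall>y\<in>integers. \<exists>m::nat. m > 0 \<and> of_nat m * y \<in> int_span B)"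
proof -
  let ?P = "\<lambda>B. finite B \<and> B \<subseteq> integers \<and> int_independent B"
  have bound: "card B \<le> card (Gal K)" if "?P B" for B
    using int_independent_card[of B] that integers_subset_K by blast
  have "?P {}" by (simp add: int_independent_def)
  then have "\<exists>B. ?P B \<and> (\<forall>T. ?P T \<longrightarrow> card T \<le> card B)"
    by (rule ex_max_card) (rule bound)
  then obtain B where B_max: "?P B \<and> (\<forall>T. ?P T \<longrightarrow> card T \<le> card B)" by (rule exE)
  note B = B_max[THEN conjunct1] and max = B_max[THEN conjunct2]
  have "\<exists>m::nat. m > 0 \<and> of_nat m * y \<in> int_span B" if y: "y \<in> integers" for y
  proof (cases "y \<in> B")
    case True
    then show ?thesis using int_span_base[of B y] B by (intro exI[of _ 1]) auto
  next
    case False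
    then have "\<not> int_independent (insert y B)" using max[rule_format, of "insert y B"] B y by auto
    then obtain c :: "complex \<Rightarrow> int" where c: "(\<Sum>b\<in>insert y B. of_int (c b) * b) = 0"
      "\<exists>b\<in>insert y B. c b \<noteq> 0" unfolding int_independent_def by blast
    have sum: "of_int (c y) * y = - (\<Sum>b\<in>B. of_int (c b) * b)"
      using c(1) False B by (simp add: add_eq_0_iff)
    have "c y \<noteq> 0"
    proof
      assume "c y = 0"
      then have "(\<Sum>b\<in>B. of_int (c b) * b) = 0" using sum by simp
      then have "\<forall>b\<in>B. c b = 0" using B unfolding int_independent_def by blast
      then show False using c(2) \<open>c y = 0\<close> by blast
    qed
    have "of_int (c y) * y \<in> int_span B"
      unfolding sum by (rule int_span_minus) (rule int_spanI[OF refl])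
    then have "of_int (sgn (c y)) * (of_int (c y) * y) \<in> int_span B" by (rule int_span_scale)
    moreover have "of_int (sgn (c y)) * (of_int (c y) * y) = of_nat (nat \<bar>c y\<bar>) * y"
      by (cases "c y > 0") (auto simp: sgn_if)
    ultimately show ?thesis using \<open>c y \<noteq> 0\<close> by (intro exI[of _ "nat \<bar>c y\<bar>"]) auto
  qed
  then show ?thesis using B bound by blast
qed

lemma common_multiplier:
  assumes "finite U" "\<And>y. y \<in> U \<Longrightarrow> \<exists>m::nat. m > 0 \<and> of_nat m * y \<in> int_span B"
  shows "\<exists>m::nat. m > 0 \<and> (\<forall>y\<in>U. of_nat m * y \<in> int_span B)"
  using assms
proof (induction U rule: finite_induct)
  case (insert x U)
  obtain m :: nat where m: "m > 0" "\<forall>y\<in>U. of_nat m * y \<in> int_span B" using insert by auto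
  obtain l :: nat where l: "l > 0" "of_nat l * x \<in> int_span B" using insert.prems[of x] by auto
  have "of_nat (m * l) * y \<in> int_span B" if y: "y \<in> insert x U" for y
  proof (cases "y = x")
    case True
    have "of_nat (m * l) * y = of_int (int m) * (of_nat l * x)" using True by simp
    then show ?thesis using int_span_scale[OF l(2), of "int m"] by metis
  next
    case False
    have "of_nat (m * l) * y = of_int (int l) * (of_nat m * y)" by simp
    then show ?thesis using int_span_scale[of "of_nat m * y" B "int l"] m(2) y False by (metis insertE)
  qed
  then show ?case using m(1) l(1) by (intro exI[of _ "m * l"]) auto
qed (auto intro: exI[of _ 1])

text \<open>
  The index of \<open>n \<O>\<close> is at most \<open>n\<^sup>r\<close>, where \<open>r\<close> is the rank. This is seen without knowing that the
  ring of integers is finitely generated, by comparing a group \<open>A\<close> containing \<open>U\<close> with a lattice \<open>\<Lambda>\<close>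
  of finite index in it: \<open>[A : n A] = [\<Lambda> : n \<Lambda>]\<close> because \<open>[A : \<Lambda>] = [n A : n \<Lambda>]\<close>.
\<close>

lemma card_separated_of_nat:
  assumes n: "n > 0" and U: "finite U" "separated (principal (of_nat n)) U"
  shows "card U \<le> n ^ card (Gal K)"
proof -
  obtain B where B: "finite B" "B \<subseteq> integers" "card B \<le> card (Gal K)"
    "\<And>y. y \<in> integers \<Longrightarrow> \<exists>m::nat. m > 0 \<and> of_nat m * y \<in> int_span B"
    using maximal_independent_set by blast
  define L where "L = int_span B"
  have XO: "U \<subseteq> integers" using U(2) unfolding separated_def by blast
  then obtain D :: nat where D: "D > 0" "\<And>y. y \<in> U \<Longrightarrow> of_nat D * y \<in> L"
    using common_multiplier[OF U(1), of B] B(4) unfolding L_def by blast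
  define A where "A = {y \<in> integers. of_nat D * y \<in> L}"
  let ?P = "\<lambda>R. finite R \<and> R \<subseteq> A \<and> separated L R"
  \<comment> \<open>Multiplication by \<open>D\<close> embeds \<open>A\<close> in \<open>L\<close>,
    so \<open>A\<close> has at most \<open>D ^ card B\<close> classes modulo \<open>L\<close>; a
    largest \<open>R\<close> then represents all of them.\<close>
  have bound: "card R \<le> D ^ card B" if R: "?P R" for R
  proof -
    have inj: "inj_on (\<lambda>r. of_nat D * r :: complex) R" using D(1) by (auto intro: inj_onI)
    have "card ((\<lambda>r. of_nat D * r) ` R) \<le> D ^ card B"
    proof (rule card_le_of_span_separated[OF B(1) _ _ D(1)])
      show "finite ((\<lambda>r. of_nat D * r) ` R)" using R by blast
      show "(\<lambda>r. of_nat D * r) ` R \<subseteq> int_span B" using R unfolding A_def L_def by blast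
      fix x y u assume "x \<in> (\<lambda>r. of_nat D * r) ` R" "y \<in> (\<lambda>r. of_nat D * r) ` R"
        and u: "u \<in> int_span B" and eq: "x - y = of_nat D * u"
      then obtain r s where rs: "r \<in> R" "s \<in> R" "x = of_nat D * r" "y = of_nat D * s" by blast
      then have "of_nat D * (r - s) = of_nat D * u" using eq by (simp add: right_diff_distrib)
      then have "r - s = u" using D(1) by simp
      then show "x = y" using separatedD[of L R r s] R rs u unfolding L_def by simp
    qed
    then show ?thesis using card_image[OF inj] by simp
  qed
  have P0: "?P {0}" using integers_0 int_span_zero by (auto simp: A_def L_def separated_def)
  then have "\<exists>R. ?P R \<and> (\<forall>T. ?P T \<longrightarrow> card T \<le> card R)"
    by (rule ex_max_card) (rule bound)
  then obtain R where R_max: "?P R \<and> (\<forall>T. ?P T \<longrightarrow> card T \<le> card R)" by (rule exE)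
  note R = R_max[THEN conjunct1] and max = R_max[THEN conjunct2]
  have Rpos: "card R > 0" using max[rule_format, OF P0] by simp
  have cover: "\<exists>r\<in>R. y - r \<in> L" if y: "y \<in> A" for y
  proof (rule ccontr)
    assume contr: "\<not> (\<exists>r\<in>R. y - r \<in> L)"
    then have "y \<notin> R" using int_span_zero[of B] unfolding L_def by force
    have "separated L (insert y R)"
      unfolding separated_def
    proof (intro conjI ballI impI)
      show "insert y R \<subseteq> integers" using R y unfolding A_def by blast
      fix u v assume uv: "u \<in> insert y R" "v \<in> insert y R" "u - v \<in> L"
      have "v - u \<in> L" using int_span_minus[of "u - v" B] uv(3) unfolding L_def by simp
      then show "u = v" using uv contr R separatedD[of L R u v] by blast
    qed
    then have "?P (insert y R)" using R y by blast
    from max[rule_format, OF this] show False using \<open>y \<notin> R\<close> R by simp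
  qed
  \<comment> \<open>These sums are pairwise incongruent modulo \<open>n L\<close>: the class modulo
    \<open>n\<close> in the ring of integers recovers \<open>x\<close>, and then \<open>r\<close> is
    determined by its class modulo \<open>L\<close>.\<close>
  define t where "t = (\<lambda>(x, r). x + of_nat n * r :: complex)"
  define T where "T = t ` (U \<times> R)"
  have L_int: "u \<in> integers" if "u \<in> L" for u using int_span_integers[OF B(2)] that unfolding L_def .
  have RO: "R \<subseteq> integers" using R unfolding A_def by blast
  have T_sep: "p = q" if pq: "p \<in> U \<times> R" "q \<in> U \<times> R" and u: "u \<in> L" "t p - t q = of_nat n * u" for p q u
  proof -
    obtain x r x' r' where p: "p = (x, r)" and q: "q = (x', r')" by (metis surj_pair)
    have mem: "x \<in> U" "x' \<in> U" "r \<in> R" "r' \<in> R" using pq p q by auto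
    have "x - x' = of_nat n * (r' - r + u)" using u(2) by (simp add: t_def p q algebra_simps)
    moreover have "r' - r + u \<in> integers" using mem RO L_int[OF u(1)] by (blast intro: integers_add integers_diff)
    ultimately have "x - x' \<in> principal (of_nat n)" using principalI by metis
    then have xx: "x = x'" using separatedD[OF U(2)] mem by blast
    then have "of_nat n * (r - r') = of_nat n * u" using u(2) by (simp add: t_def p q algebra_simps)
    then have "r - r' = u" using n by simp
    then show ?thesis using separatedD[of L R r r'] R mem u(1) xx p q by simp
  qed
  have "inj_on t (U \<times> R)"
    by (rule inj_onI, rule T_sep[of _ _ 0]) (auto simp: L_def int_span_zero)
  then have cardT: "card T = card U * card R" by (simp add: T_def card_image card_cartesian_product)
  have finT: "finite T" using U(1) R by (simp add: T_def)
  have TA: "t p \<in> A" if p: "p \<in> U \<times> R" for p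
  proof -
    obtain x r where xr: "p = (x, r)" "x \<in> U" "r \<in> R" using p by blast
    have eq: "of_nat D * (x + of_nat n * r) = of_nat D * x + of_int (int n) * (of_nat D * r)"
      by (simp add: algebra_simps)
    have "of_nat D * r \<in> L" using R xr unfolding A_def by blast
    then have "of_nat D * (x + of_nat n * r) \<in> L"
      unfolding eq using D(2)[OF xr(2)] unfolding L_def by (intro int_span_add int_span_scale)
    moreover have "x + of_nat n * r \<in> integers"
      using XO RO xr by (blast intro: integers_add integers_mult integers_of_nat)
    ultimately show ?thesis by (simp add: A_def t_def xr(1))
  qed
  \<comment> \<open>A translate of one coset of \<open>L\<close> lies in \<open>L\<close>, where at
    most \<open>n ^ card B\<close> elements are incongruent modulo \<open>n L\<close>. Since
    \<open>R\<close> indexes the cosets, its cardinality cancels at the end.\<close>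
  have fibre: "card {y\<in>T. y - r \<in> L} \<le> n ^ card B" for r
  proof -
    let ?Z = "(\<lambda>y. y - r) ` {y\<in>T. y - r \<in> L}"
    have "card ?Z \<le> n ^ card B"
    proof (rule card_le_of_span_separated[OF B(1) _ _ n])
      show "finite ?Z" using finT by simp
      show "?Z \<subseteq> int_span B" unfolding L_def by blast
      fix x y u assume "x \<in> ?Z" "y \<in> ?Z" and u: "u \<in> int_span B" "x - y = of_nat n * u"
      then obtain p q where pq: "p \<in> U \<times> R" "q \<in> U \<times> R" "x = t p - r" "y = t q - r"
        unfolding T_def by blast
      have "t p - t q = of_nat n * u" using u(2) pq by simp
      then show "x = y" using T_sep[OF pq(1,2), of u] u(1) pq unfolding L_def by simp
    qed
    moreover have "inj_on (\<lambda>y. y - r) {y\<in>T. y - r \<in> L}" by (auto intro: inj_onI)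
    ultimately show ?thesis using card_image by metis
  qed
  have "T \<subseteq> (\<Union>r\<in>R. {y\<in>T. y - r \<in> L})" using cover TA unfolding T_def by blast
  then have "card T \<le> card (\<Union>r\<in>R. {y\<in>T. y - r \<in> L})"
    using finT R by (intro card_mono) auto
  also have "\<dots> \<le> (\<Sum>r\<in>R. card {y\<in>T. y - r \<in> L})" using R by (intro card_UN_le) blast
  also have "\<dots> \<le> (\<Sum>r\<in>R. n ^ card B)" by (intro sum_mono fibre)
  finally have "card U * card R \<le> n ^ card B * card R" using cardT by (simp add: mult.commute)
  then have "card U \<le> n ^ card B" using Rpos by simp
  also have "\<dots> \<le> n ^ card (Gal K)" using n B(3) by (intro power_increasing) auto
  finally show ?thesis .
qed

text \<open>Half of the multiplicativity of the index: in \<open>a + x * b\<close> the class modulo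
  \<open>x\<close> recovers \<open>a\<close>, and after cancelling \<open>x\<close> the class modulo
  \<open>y\<close> recovers \<open>b\<close>.\<close>

lemma separated_product:
  assumes U: "finite U" "separated (principal x) U" and Y: "finite Y" "separated (principal y) Y"
    and x: "x \<in> integers" "x \<noteq> 0" and y: "y \<in> integers"
  shows "\<exists>Z. finite Z \<and> separated (principal (x * y)) Z \<and> card Z = card U * card Y"
proof -
  define t where "t = (\<lambda>(a, b). a + x * b)"
  have XO: "U \<subseteq> integers" and YO: "Y \<subseteq> integers" using U Y unfolding separated_def by blast+
  have sep: "p = q" if pq: "p \<in> U \<times> Y" "q \<in> U \<times> Y" and u: "t p - t q \<in> principal (x * y)" for p q
  proof -
    obtain a b a' b' where p: "p = (a, b)" and q: "q = (a', b')" by (metis surj_pair)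
    have mem: "a \<in> U" "a' \<in> U" "b \<in> Y" "b' \<in> Y" using pq p q by auto
    obtain z where z: "z \<in> integers" "t p - t q = x * y * z" using u unfolding principal_def by blast
    have "a - a' = x * (b' - b + y * z)" using z(2) by (simp add: t_def p q algebra_simps)
    moreover have "b' - b + y * z \<in> integers" using mem YO z(1) y
      by (blast intro: integers_add integers_diff integers_mult)
    ultimately have "a - a' \<in> principal x" using principalI by metis
    then have aa: "a = a'" using separatedD[OF U(2)] mem by blast
    then have "x * (b - b') = x * (y * z)" using z(2) by (simp add: t_def p q algebra_simps)
    then have "b - b' = y * z" using x(2) by simp
    then show ?thesis using separatedD[OF Y(2), of b b'] mem principalI[OF z(1), of y] aa p q by simp
  qed
  have zero: "0 \<in> principal (x * y)" using principalI[OF integers_0, of "x * y"] by simp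
  have "inj_on t (U \<times> Y)" by (rule inj_onI, rule sep) (auto simp: zero)
  moreover have "separated (principal (x * y)) (t ` (U \<times> Y))"
    unfolding separated_def
  proof (intro conjI ballI impI)
    show "t ` (U \<times> Y) \<subseteq> integers"
      using XO YO x(1) by (auto simp: t_def intro!: integers_add integers_mult)
    fix u v assume "u \<in> t ` (U \<times> Y)" "v \<in> t ` (U \<times> Y)" "u - v \<in> principal (x * y)"
    then show "u = v" using sep by blast
  qed
  ultimately show ?thesis using U(1) Y(1)
    by (intro exI[of _ "t ` (U \<times> Y)"]) (simp add: card_image card_cartesian_product)
qed

text \<open>
  All conjugates of \<open>x\<close> have the same index \<open>f(x) = [\<O> : x \<O>]\<close>, and the product of the conjugates is a
  rational integer \<open>N\<close>, so that \<open>f(x)\<^sup>r \<le> f(N) \<le> \<bar>N\<bar>\<^sup>r\<close> with \<open>r\<close> the order of the Galois group.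
\<close>

lemma card_separated_le_norm:
  assumes x: "x \<in> integers" "x \<noteq> 0" and U: "finite U" "separated (principal x) U"
  shows "real (card U) \<le> norm_K x"
proof -
  have conj_sep: "separated (principal (\<sigma> x)) (\<sigma> ` U)" "card (\<sigma> ` U) = card U" if s: "\<sigma> \<in> Gal K" for \<sigma>
  proof -
    have XO: "U \<subseteq> integers" using U unfolding separated_def by blast
    note hom = embedding_hom[OF Gal_embedding[OF s]]
    have inj: "inj_on \<sigma> U"
    proof (rule inj_onI)
      fix a b assume "a \<in> U" "b \<in> U" "\<sigma> a = \<sigma> b"
      then show "a = b" using embedding_inj[OF Gal_embedding[OF s], of a b] XO integers_subset_K by blast
    qed
    show "card (\<sigma> ` U) = card U" by (rule card_image[OF inj])
    show "separated (principal (\<sigma> x)) (\<sigma> ` U)"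
      unfolding separated_def
    proof (intro conjI ballI impI)
      show "\<sigma> ` U \<subseteq> integers" using XO Gal_integers[OF s] by blast
      fix u v assume "u \<in> \<sigma> ` U" "v \<in> \<sigma> ` U" and uv: "u - v \<in> principal (\<sigma> x)"
      then obtain a b where ab: "a \<in> U" "b \<in> U" "u = \<sigma> a" "v = \<sigma> b" by blast
      obtain z where z: "z \<in> integers" "u - v = \<sigma> x * z" using uv unfolding principal_def by blast
      obtain w where w: "w \<in> integers" "z = \<sigma> w" using Gal_integers_surj[OF s z(1)] by blast
      have K: "a \<in> K" "b \<in> K" "w \<in> K" "x \<in> K" using ab XO w x integers_subset_K by blast+
      have "\<sigma> (a - b) = \<sigma> (x * w)" using z(2) ab w K by (simp add: hom)
      then have "a - b = x * w"
        by (rule embedding_inj[OF Gal_embedding[OF s] K_closed(6)[OF K(1,2)] K_closed(4)[OF K(4,3)]])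
      then show "u = v" using separatedD[OF U(2) ab(1,2)] principalI[OF w(1)] ab by simp
    qed
  qed
  have prod_sep: "\<exists>Z. finite Z \<and> separated (principal (\<Prod>\<sigma>\<in>S. \<sigma> x)) Z \<and> card Z = card U ^ card S"
    if "finite S" "S \<subseteq> Gal K" for S
    using that
  proof (induction S rule: finite_induct)
    case empty
    show ?case using integers_0 by (intro exI[of _ "{0}"]) (simp add: separated_def)
  next
    case (insert \<sigma> S)
    then obtain Z where Z: "finite Z" "separated (principal (\<Prod>\<sigma>\<in>S. \<sigma> x)) Z" "card Z = card U ^ card S"
      by auto
    have s: "\<sigma> \<in> Gal K" using insert by simp
    have "(\<Prod>\<sigma>\<in>S. \<sigma> x) \<in> integers"
      using insert.prems by (intro integers_prod Gal_integers[OF _ x(1)]) auto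
    moreover have "\<sigma> x \<in> integers" "\<sigma> x \<noteq> 0"
      using Gal_integers[OF s x(1)] embedding_nonzero[OF Gal_embedding[OF s]] x integers_subset_K by auto
    ultimately have "\<exists>Z'. finite Z' \<and> separated (principal (\<sigma> x * (\<Prod>\<sigma>\<in>S. \<sigma> x))) Z' \<and>
        card Z' = card (\<sigma> ` U) * card Z"
      using separated_product[OF _ conj_sep(1)[OF s] Z(1,2)] U(1) by blast
    then show ?case using insert conj_sep(2)[OF s] Z(3) by simp
  qed
  obtain Z where Z: "finite Z" "separated (principal (\<Prod>\<sigma>\<in>Gal K. \<sigma> x)) Z"
    "card Z = card U ^ card (Gal K)" using prod_sep[OF finite_Gal] by blast
  obtain n where n: "norm_K x = real n"
    "(\<Prod>\<sigma>\<in>Gal K. \<sigma> x) = of_nat n \<or> (\<Prod>\<sigma>\<in>Gal K. \<sigma> x) = - of_nat n"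
    using Gal_prod_of_nat[OF x(1)] by blast
  \<comment> \<open>The product of the conjugates is \<open>n\<close> up to sign, which the ideal
    does not see.\<close>
  have "principal (of_nat n) \<subseteq> principal (\<Prod>\<sigma>\<in>Gal K. \<sigma> x)"
  proof
    fix w assume "w \<in> principal (of_nat n)"
    then obtain y where y: "y \<in> integers" "w = of_nat n * y" unfolding principal_def by blast
    then have "w = (\<Prod>\<sigma>\<in>Gal K. \<sigma> x) * y \<or> w = (\<Prod>\<sigma>\<in>Gal K. \<sigma> x) * (- y)" using n(2) by auto
    then show "w \<in> principal (\<Prod>\<sigma>\<in>Gal K. \<sigma> x)" using principalI y(1) integers_minus by metis
  qed
  then have "separated (principal (of_nat n)) Z" by (rule separated_mono[OF Z(2)])
  moreover have "n > 0" using norm_K_pos[of x] x integers_subset_K n(1) by simp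
  ultimately have "card U ^ card (Gal K) \<le> n ^ card (Gal K)"
    using card_separated_of_nat Z(1,3) by metis
  then have "card U \<le> n" using card_Gal_pos by (simp add: power_mono_iff)
  then show ?thesis using n(1) by simp
qed

section \<open>Invertibility of prime ideals\<close>

lemma ring_of_integers_simps [simp]:
  "carrier (ring_of_integers K) = integers" "x \<otimes>\<^bsub>ring_of_integers K\<^esub> y = x * y"
  "\<one>\<^bsub>ring_of_integers K\<^esub> = 1" "\<zero>\<^bsub>ring_of_integers K\<^esub> = 0"
  "x \<oplus>\<^bsub>ring_of_integers K\<^esub> y = x + y"
  unfolding ring_of_integers_def integers_def by simp_all

lemma cring_integers: "cring (ring_of_integers K)"
proof -
  interpret C: cring complex_ring by (rule cring_from_type_algebra)
  have "subring integers complex_ring"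
    by (rule C.subringI) (simp_all add: integers_closed)
  then show ?thesis
    using C.subcringI' C.subcring_iff[of integers] unfolding ring_of_integers_def integers_def by simp
qed

lemma principal_subset_integers: "x \<in> integers \<Longrightarrow> principal x \<subseteq> integers"
  unfolding principal_def by (auto intro: integers_mult)

lemma principal_closed:
  "0 \<in> principal x" "u \<in> principal x \<Longrightarrow> v \<in> principal x \<Longrightarrow> u + v \<in> principal x"
  "u \<in> principal x \<Longrightarrow> v \<in> principal x \<Longrightarrow> u - v \<in> principal x"
  "r \<in> integers \<Longrightarrow> u \<in> principal x \<Longrightarrow> r * u \<in> principal x"
proof -
  show "0 \<in> principal x" using principalI[OF integers_0, of x] by simp
  show "u + v \<in> principal x" if uv: "u \<in> principal x" "v \<in> principal x" for u v
  proof -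
    obtain a b where "a \<in> integers" "b \<in> integers" "u = x * a" "v = x * b" using uv unfolding principal_def by blast
    then show ?thesis using principalI[OF integers_add, of a b x] by (simp add: ring_distribs)
  qed
  show "u - v \<in> principal x" if uv: "u \<in> principal x" "v \<in> principal x" for u v
  proof -
    obtain a b where "a \<in> integers" "b \<in> integers" "u = x * a" "v = x * b" using uv unfolding principal_def by blast
    then show ?thesis using principalI[OF integers_diff, of a b x] by (simp add: ring_distribs)
  qed
  show "r * u \<in> principal x" if ru: "r \<in> integers" "u \<in> principal x" for r u
  proof -
    obtain a where "a \<in> integers" "u = x * a" using ru unfolding principal_def by blast
    then show ?thesis using principalI[OF integers_mult[OF ru(1)], of a x] by (simp add: mult.left_commute)
  qed
qed

text \<open>A separated set of largest size meets every class, since otherwise it could be enlarged.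
  Its size is bounded by the norm of \<open>x\<close>, because separated modulo \<open>J\<close>
  implies separated modulo the smaller set \<open>principal x\<close>.\<close>

lemma residue_system:
  assumes x: "x \<in> integers" "x \<noteq> 0" and sub: "principal x \<subseteq> J"
    and minus: "\<And>u. u \<in> J \<Longrightarrow> - u \<in> J" and zero: "0 \<in> J"
  shows "\<exists>R. finite R \<and> separated J R \<and> (\<forall>y\<in>integers. \<exists>r\<in>R. y - r \<in> J)"
proof -
  let ?P = "\<lambda>R. finite R \<and> separated J R"
  obtain n where n: "norm_K x = real n" using norm_K_multiple[OF x(1)] by blast
  have bound: "card R \<le> n" if R: "?P R" for R
    using card_separated_le_norm[OF x, of R] separated_mono[OF _ sub] R n by simp
  have "?P {}" by (simp add: separated_def)
  then have "\<exists>R. ?P R \<and> (\<forall>T. ?P T \<longrightarrow> card T \<le> card R)" by (rule ex_max_card) (rule bound)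
  then obtain R where R_max: "?P R \<and> (\<forall>T. ?P T \<longrightarrow> card T \<le> card R)" by (rule exE)
  note R = R_max[THEN conjunct1] and max = R_max[THEN conjunct2]
  have "\<exists>r\<in>R. y - r \<in> J" if y: "y \<in> integers" for y
  proof (rule ccontr)
    assume contr: "\<not> (\<exists>r\<in>R. y - r \<in> J)"
    then have "y \<notin> R" using zero by force
    have "separated J (insert y R)"
      unfolding separated_def
    proof (intro conjI ballI impI)
      show "insert y R \<subseteq> integers" using R y unfolding separated_def by blast
      fix u v assume uv: "u \<in> insert y R" "v \<in> insert y R" "u - v \<in> J"
      have "v - u \<in> J" using minus[OF uv(3)] by simp
      then show "u = v" using uv contr R separatedD[of J R u v] by blast
    qed
    then have "?P (insert y R)" using R by blast
    from max[rule_format, OF this] show False using \<open>y \<notin> R\<close> R by simp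
  qed
  then show ?thesis using R by blast
qed

lemma principal_residue_system:
  assumes "x \<in> integers" "x \<noteq> 0"
  shows "\<exists>R. finite R \<and> R \<subseteq> integers \<and> (\<forall>y\<in>integers. \<exists>r\<in>R. y - r \<in> principal x)"
proof -
  have minus: "- u \<in> principal x" if u: "u \<in> principal x" for u
    using principal_closed(3)[OF principal_closed(1) u] by simp
  obtain R where "finite R" "separated (principal x) R" "\<forall>y\<in>integers. \<exists>r\<in>R. y - r \<in> principal x"
    using residue_system[OF assms subset_refl minus principal_closed(1)] by auto
  then show ?thesis unfolding separated_def by blast
qed

text \<open>Applied to the powers of an element \<open>r\<close> it gives
  \<open>r ^ i * (r ^ l - 1)\<close> in \<open>principal x\<close> for some \<open>l > 0\<close>,
  the source of inverses modulo a prime.\<close>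

lemma pigeonhole_principal:
  fixes f :: "nat \<Rightarrow> complex"
  assumes x: "x \<in> integers" "x \<noteq> 0" and f: "\<And>n. f n \<in> integers"
  shows "\<exists>i j. i < j \<and> f j - f i \<in> principal x"
proof -
  obtain R where R: "finite R" "\<forall>y\<in>integers. \<exists>r\<in>R. y - r \<in> principal x"
    using principal_residue_system[OF x] by blast
  have "\<forall>n. \<exists>r\<in>R. f n - r \<in> principal x" using R(2) f by blast
  then obtain g where g: "\<And>n. g n \<in> R" "\<And>n. f n - g n \<in> principal x" by metis
  have "\<not> inj g"
  proof
    assume "inj g"
    moreover have "finite (range g)" using g(1) R(1) finite_subset[of "range g" R] by blast
    ultimately show False using finite_imageD infinite_UNIV_nat by blast
  qed
  then obtain a b where ab: "a \<noteq> b" "g a = g b" unfolding inj_def by blast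
  have eq: "f b - f a \<in> principal x" "f a - f b \<in> principal x"
    using principal_closed(3)[OF g(2)[of b] g(2)[of a]] principal_closed(3)[OF g(2)[of a] g(2)[of b]] ab(2) by simp_all
  show ?thesis
  proof (cases "a < b")
    case True
    then show ?thesis using eq(1) by blast
  next
    case False
    then have "b < a" using ab(1) by simp
    then show ?thesis using eq(2) by blast
  qed
qed

text \<open>
  Two of the elements \<open>p y\<^sup>n\<close> are congruent modulo \<open>p\<close>, which makes \<open>y\<close> a root of a polynomial
  \<open>Y\<^sup>j - Y\<^sup>i - w\<close> with integral \<open>w\<close>.
\<close>

lemma almost_integral_imp_integral:
  assumes p: "p \<in> integers" "p \<noteq> 0" and y: "y \<in> K" and yn: "\<And>n. p * y ^ n \<in> integers"
  shows "y \<in> integers"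
proof -
  obtain i j where ij: "i < j" "p * y ^ j - p * y ^ i \<in> principal p"
    using pigeonhole_principal[OF p yn] by blast
  obtain w where w: "w \<in> integers" "p * y ^ j - p * y ^ i = p * w" using ij(2) unfolding principal_def by blast
  have "p * (y ^ j - y ^ i) = p * w" using w(2) by (simp add: right_diff_distrib)
  then have eq: "y ^ j - y ^ i = w" using p(2) by simp
  define q :: "complex poly" where "q = monom 1 j + (- monom 1 i)"
  have deg: "degree q = j"
    unfolding q_def using ij(1) by (subst degree_add_eq_left) (simp_all add: degree_monom_eq)
  have "algebraic_int y"
  proof (rule algebraic_int_root)
    show "algebraic_int w" using w(1) unfolding integers_def by simp
    show "poly q y = w" using eq by (simp add: q_def poly_monom)
    show "\<forall>i. coeff q i \<in> \<int>" by (simp add: q_def)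
    show "lead_coeff q = 1" unfolding deg using ij(1) by (simp add: q_def)
    show "degree q > 0" using deg ij(1) by simp
  qed
  then show ?thesis using y unfolding integers_def by simp
qed

end

locale place = galois_field +
  fixes P :: "complex set"
  assumes place: "P \<in> finite_places K"
begin

definition P2 :: "complex set"
  where "P2 = ideal_prod (ring_of_integers K) P P"

lemma primeideal_P: "primeideal P (ring_of_integers K)"
  using place unfolding finite_places_def by blast

lemma ideal_P: "ideal P (ring_of_integers K)"
  using primeideal.axioms(1)[OF primeideal_P] .

lemma P_subset: "x \<in> P \<Longrightarrow> x \<in> integers"
  using ideal.Icarr[OF ideal_P] by simp

lemma P_0: "0 \<in> P"
  using additive_subgroup.zero_closed[OF ideal.axioms(1)[OF ideal_P]] by simp

lemma P_add: "x \<in> P \<Longrightarrow> y \<in> P \<Longrightarrow> x + y \<in> P"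
  using additive_subgroup.a_closed[OF ideal.axioms(1)[OF ideal_P], of x y] by simp

lemma P_mult: "r \<in> integers \<Longrightarrow> x \<in> P \<Longrightarrow> r * x \<in> P"
  using ideal.I_l_closed[OF ideal_P, of x r] by simp

lemma P_mult2: "r \<in> integers \<Longrightarrow> x \<in> P \<Longrightarrow> x * r \<in> P"
  using P_mult[of r x] by (simp add: mult.commute)

lemma P_minus: "x \<in> P \<Longrightarrow> - x \<in> P"
  using P_mult[of "- 1" x] integers_minus[OF integers_1] by simp

lemma P_diff: "x \<in> P \<Longrightarrow> y \<in> P \<Longrightarrow> x - y \<in> P"
  using P_add[OF _ P_minus, of x y] by simp

lemma P_prime: "x \<in> integers \<Longrightarrow> y \<in> integers \<Longrightarrow> x * y \<in> P \<Longrightarrow> x \<in> P \<or> y \<in> P"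
  using primeideal.I_prime[OF primeideal_P, of x y] by simp

lemma one_notin_P: "1 \<notin> P"
proof
  assume "1 \<in> P"
  then have "integers \<subseteq> P" using P_mult[of _ 1] by auto
  then have "integers = P" using P_subset by blast
  then show False using primeideal.I_notcarr[OF primeideal_P] by simp
qed

lemma P_nonzero: "\<exists>x\<in>P. x \<noteq> 0"
  using place P_0 unfolding finite_places_def by blast

lemma principal_subset_P: "x \<in> P \<Longrightarrow> principal x \<subseteq> P"
  unfolding principal_def using P_mult2 by auto

lemma P_power: "x \<in> integers \<Longrightarrow> x ^ n \<in> P \<Longrightarrow> x \<in> P"
proof (induction n)
  case 0
  then show ?case using one_notin_P by simp
next
  case (Suc n)
  then show ?case using P_prime[OF Suc.prems(1) integers_power[OF Suc.prems(1)], of n] by auto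
qed

text \<open>Two powers of \<open>r\<close> agree modulo a nonzero element of \<open>P\<close>;
  cancelling the smaller one, which is outside \<open>P\<close>, leaves \<open>r ^ Suc k\<close>
  congruent to 1, so \<open>r ^ k\<close> is an inverse.\<close>

lemma P_inverse:
  assumes "r \<in> integers" "r \<notin> P"
  shows "\<exists>s\<in>integers. \<exists>p\<in>P. 1 = s * r + p"
proof -
  obtain x where x: "x \<in> P" "x \<noteq> 0" using P_nonzero by blast
  obtain i j where ij: "i < j" "r ^ j - r ^ i \<in> principal x"
    using pigeonhole_principal[OF P_subset[OF x(1)] x(2), of "\<lambda>n. r ^ n"] integers_power[OF assms(1)] by blast
  obtain k where k: "j = i + Suc k" using ij(1) less_imp_Suc_add by fastforce
  have "r ^ i * (r ^ Suc k - 1) \<in> P"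
    using principal_subset_P[OF x(1)] ij(2) unfolding k by (auto simp: power_add algebra_simps)
  moreover have "r ^ i \<notin> P" using P_power assms by blast
  moreover have "r ^ Suc k - 1 \<in> integers" by (intro integers_diff integers_power integers_1 assms(1))
  ultimately have "r ^ Suc k - 1 \<in> P" using P_prime integers_power[OF assms(1)] by blast
  then have "1 - r ^ Suc k \<in> P" using P_minus by fastforce
  then show ?thesis
    using integers_power[OF assms(1), of k] by (intro bexI[of _ "r ^ k"] bexI[of _ "1 - r ^ Suc k"]) (auto simp: mult.commute)
qed

text \<open>Passes from the cosets counted by \<open>ideal_norm\<close> to representatives. It also
  shows that the quotient is finite, so that \<open>card\<close> does not take its default value
  0.\<close>

lemma norm_residue_system:
  "\<exists>R. finite R \<and> separated P R \<and> card R = ideal_norm K P \<and> (\<forall>y\<in>integers. \<exists>r\<in>R. y - r \<in> P)"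
proof -
  obtain x where x: "x \<in> P" "x \<noteq> 0" using P_nonzero by blast
  obtain R where R: "finite R" "separated P R" "\<forall>y\<in>integers. \<exists>r\<in>R. y - r \<in> P"
    using residue_system[OF P_subset[OF x(1)] x(2) principal_subset_P[OF x(1)] P_minus P_0] by auto
  have RO: "R \<subseteq> integers" using R(2) unfolding separated_def by blast
  define coset where "coset a = (\<lambda>h. h + a) ` P" for a
  have carrier: "carrier (ring_of_integers K Quot P) = coset ` integers"
    unfolding FactRing_def A_RCOSETS_def' a_r_coset_def' coset_def by auto
  have coset_eq: "coset a = coset b \<longleftrightarrow> a - b \<in> P" for a b
  proof
    assume "coset a = coset b"
    then have "0 + a \<in> coset b" using P_0 unfolding coset_def by blast
    then obtain h where "h \<in> P" "0 + a = h + b" unfolding coset_def by blast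
    then show "a - b \<in> P" by simp
  next
    have sub: "coset a \<subseteq> coset b" if ab: "a - b \<in> P" for a b
    proof
      fix u assume "u \<in> coset a"
      then obtain h where h: "h \<in> P" "u = h + a" unfolding coset_def by blast
      have "u = (h + (a - b)) + b" using h(2) by simp
      then show "u \<in> coset b" unfolding coset_def using P_add[OF h(1) ab] by blast
    qed
    assume ab: "a - b \<in> P"
    have "b - a \<in> P" using P_minus[OF ab] by simp
    then show "coset a = coset b" using sub[OF ab] sub by blast
  qed
  have "coset ` integers = coset ` R"
  proof
    show "coset ` integers \<subseteq> coset ` R" using R(3) coset_eq by blast
    show "coset ` R \<subseteq> coset ` integers" using RO by blast
  qed
  moreover have "inj_on coset R"
    using separatedD[OF R(2)] unfolding inj_on_def coset_eq by blast
  ultimately have "card R = ideal_norm K P" unfolding ideal_norm_def carrier by (simp add: card_image)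
  then show ?thesis using R by blast
qed

lemma ideal_norm_pos: "ideal_norm K P > 0"
proof -
  obtain R where R: "finite R" "card R = ideal_norm K P" "\<forall>y\<in>integers. \<exists>r\<in>R. y - r \<in> P"
    using norm_residue_system by blast
  have "R \<noteq> {}" using R(3) integers_0 by blast
  then show ?thesis using R(1,2) card_gt_0_iff by metis
qed

text \<open>
  An element \<open>b\<close> whose annihilator modulo \<open>x\<close> is \<open>P\<close>: starting with \<open>b = 1\<close>, one element of \<open>P\<close> after the
  other is made to annihilate \<open>b\<close>, while the annihilator stays inside \<open>P\<close>.
\<close>

lemma annihilator_element:
  assumes x: "x \<in> P" "x \<noteq> 0"
  shows "\<exists>b\<in>integers. b \<notin> principal x \<and> (\<forall>z\<in>P. z * b \<in> principal x)"
proof -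
  have xO: "x \<in> integers" using P_subset x by blast
  define loc where "loc b \<longleftrightarrow> b \<in> integers \<and> (\<forall>r\<in>integers. r * b \<in> principal x \<longrightarrow> r \<in> P)" for b
  have step: "\<exists>b. loc b \<and> (\<forall>z\<in>Z. z * b \<in> principal x)" if "finite Z" "Z \<subseteq> P" for Z
    using that
  proof (induction Z rule: finite_induct)
    case empty
    have "loc 1" unfolding loc_def using integers_1 principal_subset_P[OF x(1)] by auto
    then show ?case by blast
  next
    case (insert z Z)
    obtain b where b: "loc b" "\<forall>z\<in>Z. z * b \<in> principal x" using insert by auto
    have zO: "z \<in> integers" and zP: "z \<in> P" using insert.prems P_subset by auto
    have bO: "b \<in> integers" using b(1) unfolding loc_def by blast
    obtain i j where ij: "i < j" "z ^ j - z ^ i \<in> principal x"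
      using pigeonhole_principal[OF xO x(2), of "\<lambda>n. z ^ n"] integers_power[OF zO] by blast
    obtain k where k: "j = i + Suc k" using ij(1) less_imp_Suc_add by fastforce
    \<comment> \<open>This element is outside \<open>P\<close> but annihilates
      \<open>z ^ i * b\<close>, so multiplying \<open>b\<close> by powers of \<open>z\<close>
      eventually pushes the annihilator out of \<open>P\<close>.\<close>
    define s where "s = z ^ Suc k - 1"
    have sO: "s \<in> integers" unfolding s_def by (intro integers_diff integers_power integers_1 zO)
    have "s \<notin> P"
    proof
      assume "s \<in> P"
      moreover have "z ^ Suc k \<in> P" using P_mult2[OF integers_power[OF zO] zP] by simp
      ultimately have "z ^ Suc k - s \<in> P" using P_diff by blast
      then show False using one_notin_P by (simp add: s_def)
    qed
    have "b * (z ^ j - z ^ i) \<in> principal x" by (rule principal_closed(4)[OF bO ij(2)])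
    then have "s * (z ^ i * b) \<in> principal x" unfolding k s_def by (simp add: power_add algebra_simps)
    then have "\<not> loc (z ^ i * b)" using sO \<open>s \<notin> P\<close> unfolding loc_def by blast
    then obtain n where n: "\<not> loc (z ^ n * b)" "\<And>m. m < n \<Longrightarrow> loc (z ^ m * b)"
      using exists_least_iff[of "\<lambda>n. \<not> loc (z ^ n * b)"] by blast
    have "n \<noteq> 0" using n(1) b(1) by (intro notI) simp
    then obtain m where m: "n = Suc m" using not0_implies_Suc by blast
    \<comment> \<open>The last multiple whose annihilator is inside \<open>P\<close>. Some
      \<open>t\<close> outside \<open>P\<close> annihilates \<open>z * b'\<close>; then
      \<open>z\<close> annihilates \<open>t * b'\<close>, and primality of \<open>P\<close> keeps
      the annihilator of \<open>t * b'\<close> inside \<open>P\<close>.\<close>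
    define b' where "b' = z ^ m * b"
    have lb': "loc b'" using n(2)[of m] m unfolding b'_def by simp
    have "z * b' \<in> integers" unfolding b'_def by (intro integers_mult integers_power zO bO)
    moreover have "\<not> loc (z * b')" using n(1) unfolding m b'_def by (simp add: mult.assoc)
    ultimately obtain t where t: "t \<in> integers" "t * (z * b') \<in> principal x" "t \<notin> P" unfolding loc_def by blast
    have b'O: "b' \<in> integers" using lb' unfolding loc_def by blast
    have "loc (t * b')"
      unfolding loc_def
    proof (intro conjI ballI impI)
      show "t * b' \<in> integers" by (rule integers_mult[OF t(1) b'O])
      fix r assume r: "r \<in> integers" "r * (t * b') \<in> principal x"
      then have "(r * t) * b' \<in> principal x" by (simp add: mult.assoc)
      then have "r * t \<in> P" using lb' integers_mult[OF r(1) t(1)] unfolding loc_def by blast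
      then show "r \<in> P" using P_prime[OF r(1) t(1)] t(3) by blast
    qed
    moreover have "z' * (t * b') \<in> principal x" if z': "z' \<in> insert z Z" for z'
    proof (cases "z' = z")
      case True
      then show ?thesis using t(2) by (simp add: mult.left_commute)
    next
      case False
      then have "z' * b \<in> principal x" using z' b(2) by blast
      then have "(t * z ^ m) * (z' * b) \<in> principal x"
        by (rule principal_closed(4)[OF integers_mult[OF t(1) integers_power[OF zO]]])
      then show ?thesis unfolding b'_def by (simp add: mult_ac)
    qed
    ultimately show ?case by blast
  qed
  \<comment> \<open>Finitely many elements of \<open>P\<close> are enough, one for each class modulo
    \<open>x\<close> that meets \<open>P\<close> in a representative, as multiples of
    \<open>x\<close> annihilate everything.\<close>
  obtain R where R: "finite R" "R \<subseteq> integers" "\<forall>y\<in>integers. \<exists>r\<in>R. y - r \<in> principal x"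
    using principal_residue_system[OF xO x(2)] by blast
  obtain b where b: "loc b" "\<forall>z\<in>R \<inter> P. z * b \<in> principal x" using step[of "R \<inter> P"] R(1) by blast
  have bO: "b \<in> integers" using b(1) unfolding loc_def by blast
  have "z * b \<in> principal x" if z: "z \<in> P" for z
  proof -
    obtain r where r: "r \<in> R" "z - r \<in> principal x" using R(3) P_subset[OF z] by blast
    have "z - (z - r) \<in> P" using P_diff[OF z] principal_subset_P[OF x(1)] r(2) by blast
    then have "r * b \<in> principal x" using b(2) r(1) by simp
    moreover have "b * (z - r) \<in> principal x" by (rule principal_closed(4)[OF bO r(2)])
    ultimately have "r * b + b * (z - r) \<in> principal x" by (rule principal_closed(2))
    then show ?thesis by (simp add: algebra_simps)
  qed
  moreover have "b \<notin> principal x"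
  proof
    assume "b \<in> principal x"
    then have "1 * b \<in> principal x" by simp
    then show False using b(1) one_notin_P integers_1 unfolding loc_def by blast
  qed
  ultimately show ?thesis using bO by blast
qed

text \<open>This is the invertibility of \<open>P\<close>: with \<open>y = b / x\<close> one has \<open>y P \<subseteq> \<O>\<close> and \<open>1 \<in> P + y P\<close>.\<close>

lemma P_invertible:
  assumes x: "x \<in> P" "x \<noteq> 0"
  shows "\<exists>b\<in>integers. \<exists>p\<in>P. \<exists>r\<in>integers. \<exists>q\<in>P. (\<forall>z\<in>P. z * b \<in> principal x) \<and> x = r * p * b + q * x"
proof -
  have xO: "x \<in> integers" using P_subset x by blast
  obtain b where b: "b \<in> integers" "b \<notin> principal x" "\<And>z. z \<in> P \<Longrightarrow> z * b \<in> principal x"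
    using annihilator_element[OF x] by blast
  define y where "y = b / x"
  have yK: "y \<in> K" unfolding y_def using b(1) xO integers_subset_K K_closed(7) by blast
  have bxy: "b = x * y" using x(2) by (simp add: y_def)
  have yP: "y * z \<in> integers" if z: "z \<in> P" for z
  proof -
    obtain w where w: "w \<in> integers" "z * b = x * w" using b(3)[OF z] unfolding principal_def by blast
    then have "y * z = w" using x(2) by (simp add: y_def field_simps)
    then show ?thesis using w(1) by simp
  qed
  \<comment> \<open>If \<open>y\<close> mapped \<open>P\<close> into itself, every
    \<open>x * y ^ n\<close> would be integral; then so would \<open>y\<close>, and
    \<open>b = x * y\<close> would lie in \<open>principal x\<close>.\<close>
  have "\<exists>p\<in>P. y * p \<notin> P"
  proof (rule ccontr)
    assume "\<not> (\<exists>p\<in>P. y * p \<notin> P)"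
    then have stable: "\<And>p. p \<in> P \<Longrightarrow> y * p \<in> P" by blast
    have "x * y ^ n \<in> P" for n
    proof (induction n)
      case (Suc n)
      then show ?case using stable[of "x * y ^ n"] by (simp add: mult_ac)
    qed (simp add: x)
    then have "y \<in> integers" using almost_integral_imp_integral[OF xO x(2) yK] P_subset by blast
    then show False using b(2) bxy principalI by metis
  qed
  then obtain p where p: "p \<in> P" "y * p \<notin> P" by blast
  \<comment> \<open>\<open>y * p\<close> is integral and outside \<open>P\<close>, hence invertible
    modulo \<open>P\<close>. Multiplying the relation by \<open>x\<close> clears the denominator of
    \<open>y\<close>.\<close>
  obtain r q where rq: "r \<in> integers" "q \<in> P" "1 = r * (y * p) + q" using P_inverse[OF yP[OF p(1)] p(2)] by blast
  have "x = x * (r * (y * p) + q)" using rq(3) by simp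
  also have "\<dots> = r * p * b + q * x" unfolding bxy by (simp add: algebra_simps)
  finally show ?thesis using b rq p(1) by blast
qed

section \<open>The square of a prime ideal and steps between ideals\<close>

lemma P2_add: "u \<in> P2 \<Longrightarrow> v \<in> P2 \<Longrightarrow> u + v \<in> P2"
  unfolding P2_def using ideal_prod.sum[of u "ring_of_integers K" P P v] by simp

lemma P2_prod: "u \<in> P \<Longrightarrow> v \<in> P \<Longrightarrow> u * v \<in> P2"
  unfolding P2_def using ideal_prod.prod[of u P v P "ring_of_integers K"] by simp

lemma P2_induct:
  assumes "u \<in> P2" "\<And>p q. p \<in> P \<Longrightarrow> q \<in> P \<Longrightarrow> Q (p * q)"
    "\<And>u v. Q u \<Longrightarrow> Q v \<Longrightarrow> Q (u + v)"
  shows "Q u"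
  using assms(1) unfolding P2_def by (induction rule: ideal_prod.induct) (simp_all add: assms(2,3))

lemma P2_mult: "r \<in> integers \<Longrightarrow> u \<in> P2 \<Longrightarrow> r * u \<in> P2"
  by (rule P2_induct[of u]) (auto simp: mult.assoc[symmetric] ring_distribs intro: P2_prod P2_add P_mult)

lemma P2_subset: "u \<in> P2 \<Longrightarrow> u \<in> P"
  by (rule P2_induct[of u]) (auto intro: P_add P_mult P_subset)

lemma P2_minus: "u \<in> P2 \<Longrightarrow> - u \<in> P2"
  using P2_mult[OF integers_minus[OF integers_1], of u] by simp

lemma P2_diff: "u \<in> P2 \<Longrightarrow> v \<in> P2 \<Longrightarrow> u - v \<in> P2"
  using P2_add[OF _ P2_minus, of u v] by simp

text \<open>An inverse of \<open>w\<close> modulo \<open>P\<close> is enough: its error term lies in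
  \<open>P\<close> and is multiplied by \<open>u\<close>, which also lies in
  \<open>P\<close>.\<close>

lemma P2_coprime:
  assumes "w \<in> integers" "w \<notin> P" "u \<in> P" "w * u \<in> P2"
  shows "u \<in> P2"
proof -
  obtain s p where sp: "s \<in> integers" "p \<in> P" "1 = s * w + p" using P_inverse[OF assms(1,2)] by blast
  have "u = (s * w + p) * u" using sp(3) by simp
  also have "\<dots> = s * (w * u) + p * u" by (simp add: algebra_simps)
  finally show ?thesis using P2_add[OF P2_mult[OF sp(1) assms(4)] P2_prod[OF sp(2) assms(3)]] by simp
qed

text \<open>Multiplication by \<open>y = b / x\<close> maps \<open>P\<close> into the ring of
  integers, hence \<open>P2\<close> into \<open>P\<close>. With \<open>p\<close> in
  \<open>P2\<close>, the relation \<open>1 = r * (y * p) + q\<close> would put 1 into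
  \<open>P\<close>.\<close>

lemma P_not_idempotent: "\<exists>p\<in>P. p \<notin> P2"
proof -
  obtain x where x: "x \<in> P" "x \<noteq> 0" using P_nonzero by blast
  obtain b p r q where b: "b \<in> integers" "\<forall>z\<in>P. z * b \<in> principal x" and p: "p \<in> P"
    and r: "r \<in> integers" and q: "q \<in> P" and eq: "x = r * p * b + q * x"
    using P_invertible[OF x] by blast
  have "p \<notin> P2"
  proof
    assume "p \<in> P2"
    then have "\<exists>w\<in>P. p * b = x * w"
    proof (rule P2_induct)
      fix p' q' assume pq: "p' \<in> P" "q' \<in> P"
      obtain w where w: "w \<in> integers" "q' * b = x * w" using b(2) pq(2) unfolding principal_def by blast
      have "p' * q' * b = x * (w * p')" using w(2) by (simp add: mult_ac)
      then show "\<exists>w\<in>P. p' * q' * b = x * w" using P_mult[OF w(1) pq(1)] by blast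
    next
      fix u v assume "\<exists>w\<in>P. u * b = x * w" "\<exists>w\<in>P. v * b = x * w"
      then obtain w w' where ww: "w \<in> P" "w' \<in> P" "u * b = x * w" "v * b = x * w'" by blast
      have "(u + v) * b = x * (w + w')" using ww(3,4) by (simp add: ring_distribs)
      then show "\<exists>w\<in>P. (u + v) * b = x * w" using P_add[OF ww(1,2)] by blast
    qed
    then obtain w where w: "w \<in> P" "p * b = x * w" by blast
    have "x = r * (p * b) + q * x" using eq by (simp add: mult.assoc)
    also have "\<dots> = x * (r * w + q)" unfolding w(2) by (simp add: algebra_simps)
    finally have "x = x * (r * w + q)" .
    then have "r * w + q = 1" using x(2) by simp
    moreover have "r * w + q \<in> P" by (rule P_add[OF P_mult[OF r w(1)] q])
    ultimately show False using one_notin_P by simp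
  qed
  then show ?thesis using p by blast
qed

text \<open>Passing from \<open>I\<close> to \<open>J\<close> multiplies the index by at least the norm of \<open>P\<close> if \<open>P w \<subseteq> J\<close> for some \<open>w \<in> I - J\<close>.\<close>

lemma separated_step:
  assumes Y: "finite Y" "separated I Y" and w: "w \<in> I" "w \<notin> J" "w \<in> integers" and JI: "J \<subseteq> I"
    and Pw: "\<And>z. z \<in> P \<Longrightarrow> z * w \<in> J"
    and I: "\<And>u v. u \<in> I \<Longrightarrow> v \<in> I \<Longrightarrow> u - v \<in> I" "\<And>r u. r \<in> integers \<Longrightarrow> u \<in> I \<Longrightarrow> r * u \<in> I"
    and J: "\<And>u v. u \<in> J \<Longrightarrow> v \<in> J \<Longrightarrow> u + v \<in> J" "\<And>r u. r \<in> integers \<Longrightarrow> u \<in> J \<Longrightarrow> r * u \<in> J"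
  shows "\<exists>Z. finite Z \<and> separated J Z \<and> card Z = card Y * ideal_norm K P"
proof -
  obtain R where R: "finite R" "separated P R" "card R = ideal_norm K P" using norm_residue_system by blast
  have YO: "Y \<subseteq> integers" and RO: "R \<subseteq> integers" using Y R unfolding separated_def by blast+
  define t where "t = (\<lambda>(y, r). y + r * w)"
  have sep: "a = b" if ab: "a \<in> Y \<times> R" "b \<in> Y \<times> R" and u: "t a - t b \<in> J" for a b
  proof -
    obtain y r y' r' where a: "a = (y, r)" and b: "b = (y', r')" by (metis surj_pair)
    have mem: "y \<in> Y" "y' \<in> Y" "r \<in> R" "r' \<in> R" using ab a b by auto
    have rr: "r - r' \<in> integers" using mem RO by (blast intro: integers_diff)
    have "(t a - t b) - (r - r') * w \<in> I" by (rule I(1)[OF subsetD[OF JI u] I(2)[OF rr w(1)]])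
    then have "y - y' \<in> I" by (simp add: t_def a b algebra_simps)
    then have yy: "y = y'" using separatedD[OF Y(2)] mem by blast
    have J': "(r - r') * w \<in> J" using u by (simp add: t_def a b yy algebra_simps)
    \<comment> \<open>Otherwise \<open>r - r'\<close> is invertible modulo \<open>P\<close>, and
      since \<open>P w\<close> lies in \<open>J\<close>, so would \<open>w\<close>.\<close>
    have "r - r' \<in> P"
    proof (rule ccontr)
      assume "r - r' \<notin> P"
      then obtain s p where sp: "s \<in> integers" "p \<in> P" "1 = s * (r - r') + p" using P_inverse[OF rr] by blast
      have "w = (s * (r - r') + p) * w" using sp(3) by simp
      also have "\<dots> = s * ((r - r') * w) + p * w" by (simp add: algebra_simps)
      finally show False using J(1)[OF J(2)[OF sp(1) J'] Pw[OF sp(2)]] w(2) by simp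
    qed
    then show ?thesis using separatedD[OF R(2)] mem yy a b by blast
  qed
  have zero: "0 \<in> J" using Pw[OF P_0] by simp
  have "inj_on t (Y \<times> R)" by (rule inj_onI, rule sep) (auto simp: zero)
  moreover have "separated J (t ` (Y \<times> R))"
    unfolding separated_def
  proof (intro conjI ballI impI)
    show "t ` (Y \<times> R) \<subseteq> integers"
      using YO RO w(3) by (auto simp: t_def intro!: integers_add integers_mult)
    fix u v assume "u \<in> t ` (Y \<times> R)" "v \<in> t ` (Y \<times> R)" "u - v \<in> J"
    then show "u = v" using sep by blast
  qed
  ultimately show ?thesis using Y(1) R(1,3)
    by (intro exI[of _ "t ` (Y \<times> R)"]) (simp add: card_image card_cartesian_product)
qed

end

section \<open>The exponent of a prime in a principal ideal\<close>

context galois_field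
begin

abbreviation ideals_monoid :: "complex set ring"
  where "ideals_monoid \<equiv> ideals_set (ring_of_integers K)"

abbreviation ideal_mult :: "complex set \<Rightarrow> complex set \<Rightarrow> complex set"
  where "ideal_mult \<equiv> ideal_prod (ring_of_integers K)"

lemma ideal_closed:
  assumes "ideal J (ring_of_integers K)"
  shows "x \<in> J \<Longrightarrow> x \<in> integers" "0 \<in> J" "x \<in> J \<Longrightarrow> y \<in> J \<Longrightarrow> x + y \<in> J"
    "r \<in> integers \<Longrightarrow> x \<in> J \<Longrightarrow> r * x \<in> J"
  using ideal.Icarr[OF assms, of x] additive_subgroup.zero_closed[OF ideal.axioms(1)[OF assms]]
    additive_subgroup.a_closed[OF ideal.axioms(1)[OF assms], of x y] ideal.I_l_closed[OF assms, of x r]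
  by simp_all

lemma idealI_integers:
  assumes "J \<subseteq> integers" "0 \<in> J" "\<And>x y. x \<in> J \<Longrightarrow> y \<in> J \<Longrightarrow> x + y \<in> J"
    and mult: "\<And>r x. r \<in> integers \<Longrightarrow> x \<in> J \<Longrightarrow> r * x \<in> J"
  shows "ideal J (ring_of_integers K)"
proof -
  interpret R: cring "ring_of_integers K" by (rule cring_integers)
  have inv: "\<ominus>\<^bsub>ring_of_integers K\<^esub> x = - x" if x: "x \<in> integers" for x
    using x integers_minus[OF x] by (intro R.minus_equality) simp_all
  have neg: "- x \<in> J" if x: "x \<in> J" for x
    using mult[OF integers_minus[OF integers_1] x] by simp
  show ?thesis
  proof (rule idealI[OF R.ring_axioms])
    show "subgroup J (add_monoid (ring_of_integers K))"
    proof (rule R.add.subgroupI)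
      show "J \<noteq> {}" using assms(2) by blast
      fix x assume x: "x \<in> J"
      show "\<ominus>\<^bsub>ring_of_integers K\<^esub> x \<in> J" using inv[of x] x assms(1) neg[OF x] by auto
    qed (use assms in auto)
  next
    fix u x assume ux: "u \<in> J" "x \<in> carrier (ring_of_integers K)"
    show "x \<otimes>\<^bsub>ring_of_integers K\<^esub> u \<in> J" using mult[of x u] ux by simp
    show "u \<otimes>\<^bsub>ring_of_integers K\<^esub> x \<in> J" using mult[of x u] ux by (simp add: mult.commute)
  qed
qed

lemma ideal_mult_mem: "u \<in> I \<Longrightarrow> v \<in> J \<Longrightarrow> u * v \<in> ideal_mult I J"
  using ideal_prod.prod[of u I v J "ring_of_integers K"] by simp

lemma ideal_mult_induct:
  assumes "u \<in> ideal_mult I J" "\<And>p q. p \<in> I \<Longrightarrow> q \<in> J \<Longrightarrow> Q (p * q)"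
    "\<And>u v. Q u \<Longrightarrow> Q v \<Longrightarrow> Q (u + v)"
  shows "Q u"
  using assms(1) by (induction rule: ideal_prod.induct) (simp_all add: assms(2,3))

lemma ideal_mult_ideal:
  "ideal I (ring_of_integers K) \<Longrightarrow> ideal J (ring_of_integers K) \<Longrightarrow> ideal (ideal_mult I J) (ring_of_integers K)"
  using ring.ideal_prod_is_ideal cring.axioms(1)[OF cring_integers] by blast

lemma PIdl_eq_principal: "PIdl\<^bsub>ring_of_integers K\<^esub> x = principal x"
  unfolding cgenideal_def principal_def by (auto simp: mult.commute)

lemma ideal_principal: "x \<in> integers \<Longrightarrow> ideal (principal x) (ring_of_integers K)"
  by (rule idealI_integers) (use principal_subset_integers principal_closed in auto)

lemma principal_self: "x \<in> principal x"
  using principalI[OF integers_1, of x] by simp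

lemma principal_subset_ideal:
  "ideal J (ring_of_integers K) \<Longrightarrow> x \<in> J \<Longrightarrow> principal x \<subseteq> J"
  unfolding principal_def using ideal_closed(4)[of J _ x] by (auto simp: mult.commute)

lemma ideals_divides_iff:
  "I divides\<^bsub>ideals_monoid\<^esub> J \<longleftrightarrow> (\<exists>C. ideal C (ring_of_integers K) \<and> J = ideal_mult I C)"
  unfolding factor_def ideals_set_def by auto

text \<open>The colon ideal \<open>(J : I)\<close>, which supplies the cofactors in proofs of
  divisibility.\<close>

lemma ideal_quotient:
  assumes I: "ideal I (ring_of_integers K)" and J: "ideal J (ring_of_integers K)"
  shows "ideal {c \<in> integers. \<forall>z\<in>I. z * c \<in> J} (ring_of_integers K)"
proof (rule idealI_integers)
  show "r * c \<in> {c \<in> integers. \<forall>z\<in>I. z * c \<in> J}"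
    if r: "r \<in> integers" and c: "c \<in> {c \<in> integers. \<forall>z\<in>I. z * c \<in> J}" for r c
  proof -
    have "z * (r * c) \<in> J" if "z \<in> I" for z
      using ideal_closed(4)[OF J r, of "z * c"] that c by (simp add: mult.left_commute)
    then show ?thesis using r c integers_mult by blast
  qed
qed (use ideal_closed[OF J] in \<open>auto simp: ring_distribs intro: integers_closed\<close>)

end

context place
begin

section \<open>Powers of a prime and the exponent function\<close>

definition P_pow :: "nat \<Rightarrow> complex set"
  where "P_pow n = P [^]\<^bsub>ideals_monoid\<^esub> n"

lemma P_pow_0: "P_pow 0 = integers"
  unfolding P_pow_def using Group.nat_pow_0[of ideals_monoid P] by (simp add: ideals_set_def)

lemma P_pow_Suc: "P_pow (Suc n) = ideal_mult (P_pow n) P"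
  unfolding P_pow_def using Group.nat_pow_Suc[of ideals_monoid P n] by (simp add: ideals_set_def)

lemma ideal_P_pow: "ideal (P_pow n) (ring_of_integers K)"
proof (induction n)
  case 0
  show ?case unfolding P_pow_0 by (rule idealI_integers) (auto intro: integers_closed)
qed (simp only: P_pow_Suc ideal_mult_ideal ideal_P)

lemma ideal_mult_integers: "ideal J (ring_of_integers K) \<Longrightarrow> ideal_mult integers J = J"
  using cring.ideals_set_is_comm_monoid[OF cring_integers, THEN comm_monoid.axioms(1), THEN monoid.l_one, of J]
  by (simp add: ideals_set_def)

lemma P_pow_1: "P_pow 1 = P"
  using P_pow_Suc[of 0] ideal_mult_integers[OF ideal_P] by (simp add: P_pow_0)

lemma P_pow_2_subset: "P_pow (Suc (Suc n)) \<subseteq> P2"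
proof (induction n)
  case 0
  show ?case using P_pow_Suc[of 1] P_pow_1 unfolding P2_def by simp
next
  case (Suc n)
  show ?case
  proof
    fix u assume "u \<in> P_pow (Suc (Suc (Suc n)))"
    then have "u \<in> ideal_mult (P_pow (Suc (Suc n))) P" unfolding P_pow_Suc[of "Suc (Suc n)"] .
    then show "u \<in> P2"
    proof (rule ideal_mult_induct)
      fix p q assume "p \<in> P_pow (Suc (Suc n))" "q \<in> P"
      then show "p * q \<in> P2" using P2_mult[OF P_subset, of q p] Suc by (auto simp: mult.commute)
    qed (rule P2_add)
  qed
qed

text \<open>The cofactor is the colon ideal of \<open>principal x\<close> by \<open>P\<close>. It
  contains \<open>b\<close> and \<open>x\<close>, so the relation
  \<open>x = r * p * b + q * x\<close> exhibits \<open>x\<close> in the product; the other inclusion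
  holds by the choice of the colon ideal.\<close>

lemma P_divides:
  assumes x: "x \<in> P" "x \<noteq> 0"
  shows "P divides\<^bsub>ideals_monoid\<^esub> (principal x)"
proof -
  let ?C = "{c \<in> integers. \<forall>z\<in>P. z * c \<in> principal x}"
  have xO: "x \<in> integers" using P_subset x by blast
  have C: "ideal ?C (ring_of_integers K)" by (rule ideal_quotient[OF ideal_P ideal_principal[OF xO]])
  have PC: "ideal (ideal_mult P ?C) (ring_of_integers K)" by (rule ideal_mult_ideal[OF ideal_P C])
  obtain b p r q where b: "b \<in> integers" "\<forall>z\<in>P. z * b \<in> principal x" and p: "p \<in> P"
    and r: "r \<in> integers" and q: "q \<in> P" and eq: "x = r * p * b + q * x"
    using P_invertible[OF x] by blast
  have "x \<in> ?C" using xO principalI[OF P_subset] by (auto simp: mult.commute)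
  then have "q * x \<in> ideal_mult P ?C" by (rule ideal_mult_mem[OF q])
  moreover have "r * p * b \<in> ideal_mult P ?C" using b by (intro ideal_mult_mem P_mult r p) blast
  ultimately have "r * p * b + q * x \<in> ideal_mult P ?C" using ideal_closed(3)[OF PC] by blast
  then have "x \<in> ideal_mult P ?C" using eq by simp
  then have "principal x \<subseteq> ideal_mult P ?C" by (rule principal_subset_ideal[OF PC])
  moreover have "u \<in> principal x" if "u \<in> ideal_mult P ?C" for u
    using that by (rule ideal_mult_induct) (auto intro: principal_closed(2))
  ultimately have "principal x = ideal_mult P ?C" by blast
  then show ?thesis unfolding ideals_divides_iff using C by blast
qed

text \<open>\<open>P\<close> divides by \<open>P_divides\<close>; a higher power dividing the ideal
  would put \<open>x\<close> into \<open>P2\<close>.\<close>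

lemma ideal_ord_eq_1:
  assumes x: "x \<in> P" "x \<notin> P2"
  shows "ideal_ord K P x = 1"
proof -
  let ?A = "{enat n | n::nat. P_pow n divides\<^bsub>ideals_monoid\<^esub> (principal x)}"
  have ord: "ideal_ord K P x = Sup ?A" unfolding ideal_ord_def PIdl_eq_principal P_pow_def ..
  have "x \<noteq> 0" using x(2) P2_mult[OF integers_0 P2_prod[OF x(1) x(1)]] by auto
  then have "P_pow 1 divides\<^bsub>ideals_monoid\<^esub> (principal x)" using P_divides[OF x(1)] P_pow_1 by simp
  then have "enat 1 \<in> ?A" by blast
  then have "enat 1 \<le> Sup ?A" by (rule Sup_upper)
  moreover have "Sup ?A \<le> enat 1"
  proof (rule Sup_least)
    fix m assume "m \<in> ?A"
    then obtain n where n: "m = enat n" "P_pow n divides\<^bsub>ideals_monoid\<^esub> (principal x)" by blast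
    then obtain C where C: "ideal C (ring_of_integers K)" "principal x = ideal_mult (P_pow n) C"
      unfolding ideals_divides_iff by blast
    have "n \<le> 1"
    proof (rule ccontr)
      assume "\<not> n \<le> 1"
      then obtain k where k: "n = Suc (Suc k)" by (metis One_nat_def le_Suc_eq not0_implies_Suc zero_le)
      have "x \<in> ideal_mult (P_pow n) C" using principal_self[of x] C(2) by simp
      then have "x \<in> P2"
      proof (rule ideal_mult_induct)
        fix p q assume "p \<in> P_pow n" "q \<in> C"
        then show "p * q \<in> P2"
          using P2_mult[of q p] P_pow_2_subset[of k] ideal_closed(1)[OF C(1)] unfolding k
          by (auto simp: mult.commute)
      qed (rule P2_add)
      then show False using x(2) by blast
    qed
    then show "m \<le> enat 1" using n(1) by simp
  qed
  ultimately show ?thesis unfolding ord one_enat_def by (rule antisym[rotated])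
qed

text \<open>Multiply the error of a relation modulo \<open>P_pow n\<close> by a relation modulo
  \<open>P\<close>.\<close>

lemma P_pow_coprime:
  assumes "x \<in> integers" "x \<notin> P"
  shows "\<exists>r\<in>integers. \<exists>s\<in>P_pow n. 1 = r * x + s"
proof (induction n)
  case 0
  show ?case using integers_closed P_pow_0 by (intro bexI[of _ 0] bexI[of _ 1]) auto
next
  case (Suc n)
  then obtain r s where rs: "r \<in> integers" "s \<in> P_pow n" "1 = r * x + s" by blast
  obtain t p where tp: "t \<in> integers" "p \<in> P" "1 = t * x + p" using P_inverse[OF assms] by blast
  have sO: "s \<in> integers" using ideal_closed(1)[OF ideal_P_pow rs(2)] .
  have "1 = r * x + s * (t * x + p)" using rs(3) tp(3) by simp
  also have "\<dots> = (r + s * t) * x + s * p" by (simp add: algebra_simps)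
  finally have "1 = (r + s * t) * x + s * p" .
  moreover have "s * p \<in> P_pow (Suc n)" unfolding P_pow_Suc by (rule ideal_mult_mem[OF rs(2) tp(2)])
  moreover have "r + s * t \<in> integers" using rs(1) sO tp(1) by (intro integers_add integers_mult)
  ultimately show ?case by blast
qed

text \<open>A cofactor \<open>C\<close> for \<open>y\<close> becomes \<open>x C\<close> for
  \<open>x * y\<close>. Conversely every \<open>c\<close> in a cofactor for \<open>x * y\<close> is
  divisible by \<open>x\<close>: with \<open>1 = r * x + s\<close> and \<open>s\<close> in
  \<open>P_pow n\<close>, both \<open>r * x * c\<close> and \<open>s * c\<close> are multiples of
  \<open>x\<close>. So \<open>x\<close> can be divided out without unique factorization of
  ideals.\<close>

lemma ideal_ord_coprime_mult:
  assumes x: "x \<in> integers" "x \<notin> P" and y: "y \<in> integers"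
  shows "ideal_ord K P (x * y) = ideal_ord K P y"
proof -
  have x0: "x \<noteq> 0" using x(2) P_0 by blast
  have "P_pow n divides\<^bsub>ideals_monoid\<^esub> (principal (x * y)) \<longleftrightarrow> P_pow n divides\<^bsub>ideals_monoid\<^esub> (principal y)"
    (is "?L \<longleftrightarrow> ?R") for n
  proof
    assume ?R
    then obtain C where C: "ideal C (ring_of_integers K)" "principal y = ideal_mult (P_pow n) C"
      unfolding ideals_divides_iff by blast
    let ?C = "(\<lambda>c. x * c) ` C"
    have C': "ideal ?C (ring_of_integers K)"
    proof (rule idealI_integers)
      show "?C \<subseteq> integers" using ideal_closed(1)[OF C(1)] x(1) integers_mult by blast
      show "0 \<in> ?C" using ideal_closed(2)[OF C(1)] by force
      show "u + v \<in> ?C" if "u \<in> ?C" "v \<in> ?C" for u v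
        using that ideal_closed(3)[OF C(1)] by (auto simp: ring_distribs[symmetric])
      show "r * u \<in> ?C" if "r \<in> integers" "u \<in> ?C" for r u
        using that ideal_closed(4)[OF C(1)] by (auto simp: mult.left_commute[of r x])
    qed
    have "principal (x * y) = ideal_mult (P_pow n) ?C"
    proof
      have "\<exists>v\<in>ideal_mult (P_pow n) ?C. v = x * u" if "u \<in> ideal_mult (P_pow n) C" for u
        using that
      proof (rule ideal_mult_induct)
        fix p q assume "p \<in> P_pow n" "q \<in> C"
        then have "p * (x * q) \<in> ideal_mult (P_pow n) ?C" by (intro ideal_mult_mem) auto
        then show "\<exists>v\<in>ideal_mult (P_pow n) ?C. v = x * (p * q)" by (simp add: mult.left_commute)
      next
        fix u v assume "\<exists>w\<in>ideal_mult (P_pow n) ?C. w = x * u" "\<exists>w\<in>ideal_mult (P_pow n) ?C. w = x * v"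
        then show "\<exists>w\<in>ideal_mult (P_pow n) ?C. w = x * (u + v)"
          using ideal_closed(3)[OF ideal_mult_ideal[OF ideal_P_pow C'], of "x * u" n "x * v"]
          by (simp add: ring_distribs)
      qed
      then have "x * y \<in> ideal_mult (P_pow n) ?C" using principal_self[of y] C(2) by blast
      then show "principal (x * y) \<subseteq> ideal_mult (P_pow n) ?C"
        by (rule principal_subset_ideal[OF ideal_mult_ideal[OF ideal_P_pow C']])
      show "ideal_mult (P_pow n) ?C \<subseteq> principal (x * y)"
      proof
        fix u assume "u \<in> ideal_mult (P_pow n) ?C"
        then show "u \<in> principal (x * y)"
        proof (rule ideal_mult_induct)
          fix p q assume p: "p \<in> P_pow n" and "q \<in> ?C"
          then obtain c where c: "c \<in> C" "q = x * c" by blast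
          have "p * c \<in> principal y" unfolding C(2) by (rule ideal_mult_mem[OF p c(1)])
          then obtain w where w: "w \<in> integers" "p * c = y * w" unfolding principal_def by blast
          have "p * q = x * (p * c)" by (simp add: c(2) mult.left_commute)
          then have "p * q = x * y * w" using w(2) by (simp add: mult.assoc)
          then show "p * q \<in> principal (x * y)" using principalI[OF w(1)] by simp
        qed (rule principal_closed(2))
      qed
    qed
    then show ?L unfolding ideals_divides_iff using C' by blast
  next
    assume ?L
    then obtain C where C: "ideal C (ring_of_integers K)" "principal (x * y) = ideal_mult (P_pow n) C"
      unfolding ideals_divides_iff by blast
    obtain r s where rs: "r \<in> integers" "s \<in> P_pow n" "1 = r * x + s" using P_pow_coprime[OF x] by blast
    have Cx: "\<exists>d\<in>integers. c = x * d" if c: "c \<in> C" for c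
    proof -
      have "s * c \<in> principal (x * y)" unfolding C(2) by (rule ideal_mult_mem[OF rs(2) c])
      then obtain w where w: "w \<in> integers" "s * c = x * y * w" unfolding principal_def by blast
      have cO: "c \<in> integers" using ideal_closed(1)[OF C(1) c] .
      have "c = (r * x + s) * c" using rs(3) by simp
      also have "\<dots> = x * (r * c) + s * c" by (simp add: algebra_simps)
      also have "\<dots> = x * (r * c + y * w)" unfolding w(2) by (simp add: algebra_simps)
      finally have "c = x * (r * c + y * w)" .
      moreover have "r * c + y * w \<in> integers" using rs(1) cO y w(1) by (intro integers_add integers_mult)
      ultimately show ?thesis by blast
    qed
    let ?D = "{d \<in> integers. \<forall>z\<in>principal x. z * d \<in> C}"
    have D: "ideal ?D (ring_of_integers K)" by (rule ideal_quotient[OF ideal_principal[OF x(1)] C(1)])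
    have Cd: "\<exists>d\<in>?D. c = x * d" if c: "c \<in> C" for c
    proof -
      obtain d where d: "d \<in> integers" "c = x * d" using Cx[OF c] by blast
      have "z * d \<in> C" if z: "z \<in> principal x" for z
      proof -
        obtain w where w: "w \<in> integers" "z = x * w" using z unfolding principal_def by blast
        have "z * d = w * c" using w(2) d(2) by (simp add: mult_ac)
        then show ?thesis using ideal_closed(4)[OF C(1) w(1) c] by simp
      qed
      then show ?thesis using d by blast
    qed
    have Dc: "x * d \<in> C" if "d \<in> ?D" for d using that principal_self[of x] by blast
    have PD: "ideal (ideal_mult (P_pow n) ?D) (ring_of_integers K)" by (rule ideal_mult_ideal[OF ideal_P_pow D])
    have "principal y = ideal_mult (P_pow n) ?D"
    proof
      have "\<exists>v\<in>ideal_mult (P_pow n) ?D. u = x * v" if "u \<in> ideal_mult (P_pow n) C" for u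
        using that
      proof (rule ideal_mult_induct)
        fix p q assume p: "p \<in> P_pow n" and q: "q \<in> C"
        obtain d where d: "d \<in> ?D" "q = x * d" using Cd[OF q] by blast
        have "p * q = x * (p * d)" by (simp add: d(2) mult.left_commute)
        then show "\<exists>v\<in>ideal_mult (P_pow n) ?D. p * q = x * v" using ideal_mult_mem[OF p d(1)] by blast
      next
        fix u v assume "\<exists>w\<in>ideal_mult (P_pow n) ?D. u = x * w" "\<exists>w\<in>ideal_mult (P_pow n) ?D. v = x * w"
        then obtain w w' where w: "w \<in> ideal_mult (P_pow n) ?D" "w' \<in> ideal_mult (P_pow n) ?D"
          "u = x * w" "v = x * w'" by blast
        have "u + v = x * (w + w')" by (simp add: w ring_distribs)
        then show "\<exists>w\<in>ideal_mult (P_pow n) ?D. u + v = x * w" using ideal_closed(3)[OF PD w(1,2)] by blast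
      qed
      moreover have "x * y \<in> ideal_mult (P_pow n) C" using principal_self[of "x * y"] C(2) by simp
      ultimately obtain v where "v \<in> ideal_mult (P_pow n) ?D" "x * y = x * v" by blast
      then have "y \<in> ideal_mult (P_pow n) ?D" using x0 by simp
      then show "principal y \<subseteq> ideal_mult (P_pow n) ?D" by (rule principal_subset_ideal[OF PD])
      show "ideal_mult (P_pow n) ?D \<subseteq> principal y"
      proof
        fix u assume "u \<in> ideal_mult (P_pow n) ?D"
        then show "u \<in> principal y"
        proof (rule ideal_mult_induct)
          fix p q assume p: "p \<in> P_pow n" and q: "q \<in> ?D"
          have "p * (x * q) \<in> principal (x * y)" unfolding C(2) by (rule ideal_mult_mem[OF p Dc[OF q]])
          then obtain w where w: "w \<in> integers" "p * (x * q) = x * y * w" unfolding principal_def by blast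
          have "x * (p * q) = x * (y * w)" using w(2) by (simp add: mult_ac)
          then have "p * q = y * w" using x0 by simp
          then show "p * q \<in> principal y" using principalI[OF w(1)] by simp
        qed (rule principal_closed(2))
      qed
    qed
    then show ?R unfolding ideals_divides_iff using D by blast
  qed
  then show ?thesis unfolding ideal_ord_def PIdl_eq_principal P_pow_def by simp
qed

text \<open>\<open>valuation\<close> is a definite description, so all fractions must give one
  value: \<open>x = \<alpha> / \<beta>\<close> means \<open>\<alpha> = x * \<beta>\<close>, and a
  factor outside \<open>P\<close> does not change the exponent. This keeps such places out of the
  conductor.\<close>

lemma valuation_coprime:
  assumes x: "x \<in> integers" "x \<notin> P"
  shows "valuation K P x = 0"
  unfolding valuation_def
proof (rule the_equality)
  have x0: "x \<noteq> 0" using x(2) P_0 by blast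
  show "\<exists>\<alpha>\<in>carrier (ring_of_integers K) - {0}. \<exists>\<beta>\<in>carrier (ring_of_integers K) - {0}. x = \<alpha> / \<beta> \<and>
      0 = int (the_enat (ideal_ord K P \<alpha>)) - int (the_enat (ideal_ord K P \<beta>))"
    using ideal_ord_coprime_mult[OF x integers_1] x x0 integers_1
    by (intro bexI[of _ x] bexI[of _ 1]) auto
  fix m assume "\<exists>\<alpha>\<in>carrier (ring_of_integers K) - {0}. \<exists>\<beta>\<in>carrier (ring_of_integers K) - {0}. x = \<alpha> / \<beta> \<and>
      m = int (the_enat (ideal_ord K P \<alpha>)) - int (the_enat (ideal_ord K P \<beta>))"
  then obtain \<alpha> \<beta> where ab: "\<beta> \<in> integers" "\<beta> \<noteq> 0" "x = \<alpha> / \<beta>"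
    "m = int (the_enat (ideal_ord K P \<alpha>)) - int (the_enat (ideal_ord K P \<beta>))" by auto
  have "\<alpha> = x * \<beta>" using ab(2,3) by simp
  then show "m = 0" using ideal_ord_coprime_mult[OF x ab(1)] ab(4) by simp
qed

lemma finite_abs_coprime: "x \<in> integers \<Longrightarrow> x \<notin> P \<Longrightarrow> finite_abs K P x = 1"
  unfolding finite_abs_def using valuation_coprime ideal_norm_pos by simp

section \<open>Residue fields, orders and products of primes\<close>

text \<open>Used for multiplication by a unit in \<open>fermat_little\<close> and for translation by
  1 in \<open>norm_in_P\<close>.\<close>

lemma residue_permutation:
  assumes S: "finite S" and f: "\<And>s. s \<in> S \<Longrightarrow> \<exists>t\<in>S. f s - t \<in> P"
    and inj: "\<And>s t. s \<in> S \<Longrightarrow> t \<in> S \<Longrightarrow> f s - f t \<in> P \<Longrightarrow> s = t"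
  shows "\<exists>g. bij_betw g S S \<and> (\<forall>s\<in>S. f s - g s \<in> P)"
proof -
  have "\<forall>s\<in>S. \<exists>t. t \<in> S \<and> f s - t \<in> P" using f by blast
  then obtain g where g: "\<And>s. s \<in> S \<Longrightarrow> g s \<in> S" "\<And>s. s \<in> S \<Longrightarrow> f s - g s \<in> P" by metis
  have "inj_on g S"
  proof (rule inj_onI)
    fix s t assume st: "s \<in> S" "t \<in> S" "g s = g t"
    have "(f s - g s) - (f t - g t) \<in> P" by (rule P_diff[OF g(2)[OF st(1)] g(2)[OF st(2)]])
    then show "s = t" using inj[OF st(1,2)] st(3) by simp
  qed
  then have "bij_betw g S S" unfolding bij_betw_def using endo_inj_surj[OF S, of g] g(1) by blast
  then show ?thesis using g(2) by blast
qed

lemma prod_cong_mod: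
  assumes "finite S" "\<And>s. s \<in> S \<Longrightarrow> f s \<in> integers" "\<And>s. s \<in> S \<Longrightarrow> g s \<in> integers"
    "\<And>s. s \<in> S \<Longrightarrow> f s - g s \<in> P"
  shows "prod f S - prod g S \<in> P"
  using assms
proof (induction S rule: finite_induct)
  case (insert s S)
  have "prod f S - prod g S \<in> P" using insert by auto
  then have "f s * (prod f S - prod g S) \<in> P" using insert.prems(1) by (intro P_mult) auto
  moreover have "prod g S * (f s - g s) \<in> P"
    by (rule P_mult) (use insert.prems integers_prod[of S g] in auto)
  ultimately have "f s * (prod f S - prod g S) + prod g S * (f s - g s) \<in> P" by (rule P_add)
  then show ?case using insert by (simp add: algebra_simps)
qed (simp add: P_0)

lemma sum_mem_P: "(\<And>s. s \<in> S \<Longrightarrow> f s \<in> P) \<Longrightarrow> sum f S \<in> P"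
  by (induction S rule: infinite_finite_induct) (auto intro: P_0 P_add)

lemma prod_notin_P:
  "finite S \<Longrightarrow> (\<And>s. s \<in> S \<Longrightarrow> f s \<in> integers) \<Longrightarrow> (\<And>s. s \<in> S \<Longrightarrow> f s \<notin> P) \<Longrightarrow> prod f S \<notin> P"
proof (induction S rule: finite_induct)
  case (insert s S)
  have "prod f S \<in> integers" by (rule integers_prod) (use insert.prems in auto)
  moreover have "prod f S \<notin> P" using insert by auto
  ultimately show ?case using P_prime[of "f s" "prod f S"] insert by auto
qed (simp add: one_notin_P)

lemma fermat_little:
  assumes b: "b \<in> integers" "b \<notin> P"
  shows "b ^ (ideal_norm K P - 1) - 1 \<in> P"
proof -
  obtain R where R: "finite R" "separated P R" "card R = ideal_norm K P"
    "\<forall>y\<in>integers. \<exists>r\<in>R. y - r \<in> P" using norm_residue_system by blast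
  have RO: "R \<subseteq> integers" using R(2) unfolding separated_def by blast
  obtain r0 where r0: "r0 \<in> R" "0 - r0 \<in> P" using R(4) integers_0 by blast
  have r0P: "r0 \<in> P" using P_minus[OF r0(2)] by simp
  \<comment> \<open>Representatives of the nonzero classes. Multiplication by \<open>b\<close>
    permutes them modulo \<open>P\<close>, and their product can be cancelled.\<close>
  define S where "S = R - {r0}"
  have SO: "s \<in> integers" and SP: "s \<notin> P" if s: "s \<in> S" for s
  proof -
    show "s \<in> integers" using s RO unfolding S_def by blast
    show "s \<notin> P"
    proof
      assume "s \<in> P"
      then have "s - r0 \<in> P" using P_diff r0P by blast
      then show False using separatedD[OF R(2)] s r0(1) unfolding S_def by blast
    qed
  qed
  have fin: "finite S" using R(1) by (simp add: S_def)
  have "\<exists>g. bij_betw g S S \<and> (\<forall>s\<in>S. b * s - g s \<in> P)"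
  proof (rule residue_permutation[OF fin])
    fix s assume s: "s \<in> S"
    obtain r where r: "r \<in> R" "b * s - r \<in> P" using R(4) integers_mult[OF b(1) SO[OF s]] by blast
    have "r \<noteq> r0"
    proof
      assume "r = r0"
      then have "b * s - r + r0 \<in> P" using P_add[OF r(2) r0P] by simp
      then have "b * s \<in> P" using \<open>r = r0\<close> by simp
      then show False using P_prime[OF b(1) SO[OF s]] b(2) SP[OF s] by blast
    qed
    then show "\<exists>t\<in>S. b * s - t \<in> P" using r unfolding S_def by blast
  next
    fix s t assume st: "s \<in> S" "t \<in> S" "b * s - b * t \<in> P"
    then have "b * (s - t) \<in> P" by (simp add: right_diff_distrib)
    then have "s - t \<in> P" using P_prime[OF b(1) integers_diff[OF SO[OF st(1)] SO[OF st(2)]]] b(2) by blast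
    then show "s = t" using separatedD[OF R(2)] st(1,2) unfolding S_def by blast
  qed
  then obtain g where g: "bij_betw g S S" "\<And>s. s \<in> S \<Longrightarrow> b * s - g s \<in> P" by blast
  have "(\<Prod>s\<in>S. b * s) - (\<Prod>s\<in>S. g s) \<in> P"
    using fin integers_mult[OF b(1) SO] SO[OF bij_betwE[OF g(1), rule_format]] g(2) by (intro prod_cong_mod) auto
  moreover have "(\<Prod>s\<in>S. g s) = \<Prod>S" using prod.reindex_bij_betw[OF g(1), of "\<lambda>s. s"] by simp
  moreover have "(\<Prod>s\<in>S. b * s) = b ^ card S * \<Prod>S" by (simp add: prod.distrib)
  ultimately have "(b ^ card S - 1) * \<Prod>S \<in> P" by (simp add: left_diff_distrib)
  moreover have "\<Prod>S \<notin> P" using prod_notin_P[OF fin, of "\<lambda>s. s"] SO SP by simp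
  moreover have "b ^ card S - 1 \<in> integers" by (intro integers_diff integers_power integers_1 b(1))
  moreover have "\<Prod>S \<in> integers" by (rule integers_prod) (rule SO)
  ultimately have "b ^ card S - 1 \<in> P" using P_prime by blast
  moreover have "card S = ideal_norm K P - 1" using R(1,3) r0(1) by (simp add: S_def)
  ultimately show ?thesis by simp
qed

text \<open>Translation by 1 permutes the residue classes; comparing the sums of the representatives
  leaves the number of classes.\<close>

lemma norm_in_P: "of_nat (ideal_norm K P) \<in> P"
proof -
  obtain R where R: "finite R" "separated P R" "card R = ideal_norm K P"
    "\<forall>y\<in>integers. \<exists>r\<in>R. y - r \<in> P" using norm_residue_system by blast
  have RO: "R \<subseteq> integers" using R(2) unfolding separated_def by blast
  have "\<exists>g. bij_betw g R R \<and> (\<forall>s\<in>R. (s + 1) - g s \<in> P)"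
  proof (rule residue_permutation[OF R(1)])
    fix s assume s: "s \<in> R"
    then have "s + 1 \<in> integers" using RO integers_add[OF _ integers_1] by blast
    then show "\<exists>t\<in>R. s + 1 - t \<in> P" using R(4) by blast
  next
    fix s t assume "s \<in> R" "t \<in> R" "s + 1 - (t + 1) \<in> P"
    then show "s = t" using separatedD[OF R(2)] by simp
  qed
  then obtain g where g: "bij_betw g R R" "\<And>s. s \<in> R \<Longrightarrow> (s + 1) - g s \<in> P" by blast
  have "(\<Sum>s\<in>R. (s + 1) - g s) \<in> P" by (rule sum_mem_P) (rule g(2))
  moreover have "(\<Sum>s\<in>R. g s) = \<Sum>R" using sum.reindex_bij_betw[OF g(1), of "\<lambda>s. s"] by simp
  ultimately show ?thesis using R(3) by (simp add: sum_subtractf sum.distrib)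
qed

section \<open>Multiplicative orders modulo a prime\<close>

lemma power_minus_one_dvd:
  assumes "b \<in> integers" "m dvd n"
  shows "\<exists>w\<in>integers. b ^ n - 1 = w * (b ^ m - 1)"
proof -
  obtain k where k: "n = m * k" using assms(2) by blast
  have "b ^ n - 1 = (\<Sum>i<k. (b ^ m) ^ i) * (b ^ m - 1)"
    unfolding k power_mult using power_diff_1_eq[of "b ^ m" k] by (simp add: mult.commute)
  moreover have "(\<Sum>i<k. (b ^ m) ^ i) \<in> integers" using assms(1) by (intro integers_sum integers_power)
  ultimately show ?thesis by blast
qed

definition order_mod :: "complex \<Rightarrow> nat"
  where "order_mod b = (LEAST d. d > 0 \<and> b ^ d - 1 \<in> P)"

lemma order_mod:
  assumes "n > 0" "b ^ n - 1 \<in> P"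
  shows "order_mod b > 0" "b ^ order_mod b - 1 \<in> P" "d > 0 \<Longrightarrow> b ^ d - 1 \<in> P \<Longrightarrow> order_mod b \<le> d"
  using LeastI[of "\<lambda>d. d > 0 \<and> b ^ d - 1 \<in> P" n] Least_le[of "\<lambda>d. d > 0 \<and> b ^ d - 1 \<in> P" d] assms
  unfolding order_mod_def by auto

lemma order_mod_dvd:
  assumes b: "b \<in> integers" and n: "n > 0" "b ^ n - 1 \<in> P" and m: "b ^ m - 1 \<in> P"
  shows "order_mod b dvd m"
proof (rule ccontr)
  let ?d = "order_mod b"
  assume "\<not> ?d dvd m"
  then have r: "m mod ?d > 0" by (simp add: mod_greater_zero_iff_not_dvd)
  obtain w where w: "w \<in> integers" "b ^ (?d * (m div ?d)) - 1 = w * (b ^ ?d - 1)"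
    using power_minus_one_dvd[OF b, of ?d "?d * (m div ?d)"] by auto
  have "b ^ (?d * (m div ?d)) - 1 \<in> P" unfolding w(2) by (rule P_mult[OF w(1) order_mod(2)[OF n]])
  then have "b ^ m - 1 - b ^ (m mod ?d) * (b ^ (?d * (m div ?d)) - 1) \<in> P"
    by (rule P_diff[OF m P_mult[OF integers_power[OF b]]])
  moreover have "b ^ m = b ^ (m mod ?d) * b ^ (?d * (m div ?d))"
    by (metis add.commute mult_div_mod_eq power_add)
  ultimately have "b ^ (m mod ?d) - 1 \<in> P" by (simp add: right_diff_distrib)
  then have "?d \<le> m mod ?d" using order_mod(3)[OF n r] by blast
  moreover have "m mod ?d < ?d" using order_mod(1)[OF n] by simp
  ultimately show False by simp
qed

lemma power_one_plus:
  assumes "u \<in> integers"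
  shows "\<exists>w\<in>integers. (1 + u) ^ e = 1 + of_nat e * u + u * u * w"
proof (induction e)
  case (Suc e)
  then obtain w where w: "w \<in> integers" "(1 + u) ^ e = 1 + of_nat e * u + u * u * w" by blast
  have "(1 + u) ^ Suc e = (1 + u) * (1 + of_nat e * u + u * u * w)" by (simp add: w(2))
  also have "\<dots> = 1 + of_nat (Suc e) * u + u * u * (of_nat e + w + u * w)" by (simp add: algebra_simps)
  finally have "(1 + u) ^ Suc e = 1 + of_nat (Suc e) * u + u * u * (of_nat e + w + u * w)" .
  moreover have "of_nat e + w + u * w \<in> integers"
    using assms w(1) by (intro integers_add integers_mult integers_of_nat)
  ultimately show ?case by blast
qed (auto intro: bexI[of _ 0] integers_0)

text \<open>
  With \<open>d\<close> the order of \<open>a\<close> and \<open>a\<^sup>d = 1 + u\<close>, one has \<open>a\<^sup>q\<^sup>-\<^sup>1 - 1 \<equiv> e u\<close> modulo the square of \<open>P\<close>, where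
  \<open>e = (q - 1) / d\<close> is prime to \<open>P\<close> because \<open>q \<in> P\<close>.
\<close>

lemma non_wieferich_criterion:
  assumes a: "a \<in> integers" and n: "n > 0" "a ^ n - 1 \<in> P" "a ^ n - 1 \<notin> P2"
  shows "non_wieferich_place K a P" "order_mod a dvd ideal_norm K P - 1"
proof -
  let ?q = "ideal_norm K P" and ?d = "order_mod a"
  have aP: "a \<notin> P"
  proof
    assume "a \<in> P"
    then have "a ^ n \<in> P"
      using P_mult2[OF integers_power[OF a], of a "n - 1"] n(1) by (simp flip: power_Suc)
    then have "a ^ n - (a ^ n - 1) \<in> P" using P_diff n(2) by blast
    then show False using one_notin_P by simp
  qed
  have fer: "a ^ (?q - 1) - 1 \<in> P" by (rule fermat_little[OF a aP])
  show dq: "?d dvd ?q - 1" by (rule order_mod_dvd[OF a n(1,2) fer])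
  then obtain e where e: "?q - 1 = ?d * e" by blast
  define u where "u = a ^ ?d - 1"
  have uP: "u \<in> P" unfolding u_def by (rule order_mod(2)[OF n(1,2)])
  have uO: "u \<in> integers" using P_subset[OF uP] .
  \<comment> \<open>The order divides \<open>n\<close>, so \<open>a ^ n - 1\<close> is a multiple of
    \<open>u\<close> and would lie in \<open>P2\<close> along with it.\<close>
  have uP2: "u \<notin> P2"
  proof
    assume u2: "u \<in> P2"
    obtain w where w: "w \<in> integers" "a ^ n - 1 = w * u"
      using power_minus_one_dvd[OF a order_mod_dvd[OF a n(1,2) n(2)]] unfolding u_def by blast
    then show False using P2_mult[OF w(1) u2] n(3) by simp
  qed
  obtain w where w: "w \<in> integers" "(1 + u) ^ e = 1 + of_nat e * u + u * u * w"
    using power_one_plus[OF uO] by blast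
  have "a ^ (?q - 1) - 1 = (1 + u) ^ e - 1" unfolding e by (simp add: u_def power_mult)
  then have eq: "a ^ (?q - 1) - 1 = of_nat e * u + u * u * w" using w(2) by simp
  have eP: "of_nat e \<notin> P"
  proof
    assume "of_nat e \<in> P"
    then have "of_nat ?d * of_nat e \<in> P" using P_mult integers_of_nat by blast
    then have "of_nat (?q - 1) \<in> P" unfolding e by simp
    then have "of_nat ?q - of_nat (?q - 1) \<in> P" using P_diff norm_in_P by blast
    moreover have "of_nat ?q - of_nat (?q - 1) = (1 :: complex)"
      using ideal_norm_pos by (simp add: of_nat_diff Suc_le_eq)
    ultimately show False using one_notin_P by simp
  qed
  have "a ^ (?q - 1) - 1 \<notin> P2"
  proof
    assume "a ^ (?q - 1) - 1 \<in> P2"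
    then have "of_nat e * u + u * u * w - w * (u * u) \<in> P2"
      unfolding eq using P2_diff P2_mult[OF w(1) P2_prod[OF uP uP]] by blast
    then have "of_nat e * u \<in> P2" by (simp add: mult_ac)
    then show False using P2_coprime[OF integers_of_nat eP uP] uP2 by blast
  qed
  then show "non_wieferich_place K a P"
    unfolding non_wieferich_place_def using place ideal_ord_eq_1[OF fer] by simp
qed

end

context galois_field
begin

section \<open>Finiteness of sets of places and products of norms\<close>

lemma placeI: "P \<in> finite_places K \<Longrightarrow> place K P"
  by (intro place.intro place_axioms.intro galois_field_axioms)

text \<open>A prime containing \<open>x\<close> is a union of classes modulo \<open>x\<close>, so
  its trace on a finite residue system determines it.\<close>

lemma finite_places_containing:
  assumes x: "x \<in> integers" "x \<noteq> 0"
  shows "finite {P \<in> finite_places K. x \<in> P}"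
proof -
  obtain R where R: "finite R" "R \<subseteq> integers" "\<forall>y\<in>integers. \<exists>r\<in>R. y - r \<in> principal x"
    using principal_residue_system[OF x] by blast
  have "P = Q" if P: "P \<in> finite_places K" "x \<in> P" and Q: "Q \<in> finite_places K" "x \<in> Q" and eq: "P \<inter> R = Q \<inter> R"
    for P Q
  proof -
    have sub: "P \<subseteq> Q" if P: "P \<in> finite_places K" "x \<in> P" and Q: "Q \<in> finite_places K" "x \<in> Q" and eq: "P \<inter> R = Q \<inter> R"
      for P Q
    proof
      interpret P: place K P using P(1) by (rule placeI)
      interpret Q: place K Q using Q(1) by (rule placeI)
      fix y assume y: "y \<in> P"
      obtain r where r: "r \<in> R" "y - r \<in> principal x" using R(3) P.P_subset[OF y] by blast
      have "y - (y - r) \<in> P" using P.P_diff[OF y] P.principal_subset_P[OF P(2)] r(2) by blast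
      then have "r \<in> Q" using r(1) eq by auto
      moreover have "y - r \<in> Q" using Q.principal_subset_P[OF Q(2)] r(2) by blast
      ultimately show "y \<in> Q" using Q.P_add[of "y - r" r] by simp
    qed
    show ?thesis using sub[OF P Q eq] sub[OF Q P eq[symmetric]] by blast
  qed
  then have "inj_on (\<lambda>P. P \<inter> R) {P \<in> finite_places K. x \<in> P}" by (intro inj_onI) auto
  moreover have "finite ((\<lambda>P. P \<inter> R) ` {P \<in> finite_places K. x \<in> P})"
    by (rule finite_subset[of _ "Pow R"]) (use R(1) in auto)
  ultimately show ?thesis using finite_imageD by blast
qed

text \<open>A prime of norm \<open>q\<close> contains the integer \<open>q\<close>. Finiteness is
  what makes the \<open>card\<close> in the final count meaningful.\<close>

lemma finite_places_norm_le: "finite {P \<in> finite_places K. real (ideal_norm K P) \<le> x}"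
proof (rule finite_subset)
  show "finite (\<Union>q\<in>{1..nat \<lfloor>x\<rfloor>}. {P \<in> finite_places K. of_nat q \<in> P})"
    by (intro finite_UN_I finite_places_containing integers_of_nat) auto
  show "{P \<in> finite_places K. real (ideal_norm K P) \<le> x} \<subseteq> (\<Union>q\<in>{1..nat \<lfloor>x\<rfloor>}. {P \<in> finite_places K. of_nat q \<in> P})"
  proof
    fix P assume P: "P \<in> {P \<in> finite_places K. real (ideal_norm K P) \<le> x}"
    interpret place K P using P by (intro placeI) blast
    have "ideal_norm K P \<in> {1..nat \<lfloor>x\<rfloor>}" using P ideal_norm_pos by (auto simp: le_nat_floor Suc_le_eq)
    then show "P \<in> (\<Union>q\<in>{1..nat \<lfloor>x\<rfloor>}. {P \<in> finite_places K. of_nat q \<in> P})" using P norm_in_P by blast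
  qed
qed

lemma ex_mem_not_mem_place:
  assumes "P \<in> finite_places K" "Q \<in> finite_places K" "P \<noteq> Q"
  shows "\<exists>w\<in>Q. w \<notin> P"
proof (rule ccontr)
  interpret P: place K P using assms(1) by (rule placeI)
  interpret Q: place K Q using assms(2) by (rule placeI)
  assume "\<not> (\<exists>w\<in>Q. w \<notin> P)"
  then have QP: "Q \<subseteq> P" by blast
  then obtain p where p: "p \<in> P" "p \<notin> Q" using assms(3) by blast
  obtain s q where "s \<in> integers" "q \<in> Q" "1 = s * p + q" using Q.P_inverse[OF P.P_subset[OF p(1)] p(2)] by blast
  then have "1 \<in> P" using P.P_add[OF P.P_mult[OF _ p(1)], of s q] QP by auto
  then show False using P.one_notin_P by simp
qed

text \<open>The intersection of the primes in \<open>S\<close>, with squares at the places of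
  \<open>T\<close>, contains \<open>x\<close>. Its index is at least the left-hand side because each
  place, and each square, multiplies the index by at least a norm; the index of
  \<open>principal x\<close> bounds it from above.\<close>

lemma prod_norm_le_norm:
  assumes S: "finite S" "S \<subseteq> finite_places K" and T: "T \<subseteq> S" and x: "x \<in> integers" "x \<noteq> 0"
    and xS: "\<And>P. P \<in> S \<Longrightarrow> x \<in> P" and xT: "\<And>P. P \<in> T \<Longrightarrow> x \<in> place.P2 K P"
  shows "(\<Prod>P\<in>S. real (ideal_norm K P)) * (\<Prod>P\<in>T. real (ideal_norm K P)) \<le> norm_K x"
proof -
  define lvl where "lvl P = (if P \<in> T then place.P2 K P else P)" for P
  define I where "I S = {x \<in> integers. \<forall>P\<in>S. x \<in> lvl P}" for S
  have lvl: "lvl P \<subseteq> P" "\<And>u v. u \<in> lvl P \<Longrightarrow> v \<in> lvl P \<Longrightarrow> u + v \<in> lvl P"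
    "\<And>u v. u \<in> lvl P \<Longrightarrow> v \<in> lvl P \<Longrightarrow> u - v \<in> lvl P"
    "\<And>r u. r \<in> integers \<Longrightarrow> u \<in> lvl P \<Longrightarrow> r * u \<in> lvl P"
    "\<And>u. u \<in> P \<Longrightarrow> u * u \<in> lvl P" if "P \<in> finite_places K" for P
  proof -
    interpret place K P using that by (rule placeI)
    show "lvl P \<subseteq> P" "\<And>u v. u \<in> lvl P \<Longrightarrow> v \<in> lvl P \<Longrightarrow> u + v \<in> lvl P"
      "\<And>u v. u \<in> lvl P \<Longrightarrow> v \<in> lvl P \<Longrightarrow> u - v \<in> lvl P"
      "\<And>r u. r \<in> integers \<Longrightarrow> u \<in> lvl P \<Longrightarrow> r * u \<in> lvl P"
      "\<And>u. u \<in> P \<Longrightarrow> u * u \<in> lvl P"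
      unfolding lvl_def
      using P2_subset P2_add P2_diff P2_mult P2_prod P_add P_diff P_mult P_subset by auto
  qed
  have I_closed: "\<And>u v. u \<in> I S \<Longrightarrow> v \<in> I S \<Longrightarrow> u + v \<in> I S" "\<And>u v. u \<in> I S \<Longrightarrow> v \<in> I S \<Longrightarrow> u - v \<in> I S"
    "\<And>r u. r \<in> integers \<Longrightarrow> u \<in> I S \<Longrightarrow> r * u \<in> I S" if "S \<subseteq> finite_places K" for S
    unfolding I_def
    by (auto intro: integers_add integers_diff integers_mult lvl(2-4)[OF subsetD[OF that]])
  have "\<exists>Y. finite Y \<and> separated (I S) Y \<and>
      card Y = (\<Prod>P\<in>S. ideal_norm K P * (if P \<in> T then ideal_norm K P else 1))"
    using S
  proof (induction S rule: finite_induct)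
    case empty
    show ?case using integers_0 by (intro exI[of _ "{0}"]) (simp add: separated_def)
  next
    case (insert P S)
    then obtain Y where Y: "finite Y" "separated (I S) Y"
      "card Y = (\<Prod>P\<in>S. ideal_norm K P * (if P \<in> T then ideal_norm K P else 1))" by auto
    have Pf: "P \<in> finite_places K" and Sf: "S \<subseteq> finite_places K" using insert.prems by auto
    interpret place K P using Pf by (rule placeI)
    have "\<forall>Q\<in>S. \<exists>w. w \<in> Q \<and> w \<notin> P" using ex_mem_not_mem_place[OF Pf] Sf insert.hyps(2) by blast
    then obtain w where w: "\<And>Q. Q \<in> S \<Longrightarrow> w Q \<in> Q" "\<And>Q. Q \<in> S \<Longrightarrow> w Q \<notin> P" by metis
    have wO: "w Q \<in> integers" if "Q \<in> S" for Q
      using place.P_subset[OF placeI] w(1)[OF that] Sf that by blast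
    \<comment> \<open>As in the Chinese remainder theorem: the squared factors reach the required
      level at every earlier place, and primality keeps the product outside
      \<open>P\<close>.\<close>
    define w0 where "w0 = (\<Prod>Q\<in>S. w Q * w Q)"
    have w0O: "w0 \<in> integers" unfolding w0_def by (rule integers_prod) (intro integers_mult wO)
    have w0P: "w0 \<notin> P" unfolding w0_def
      by (rule prod_notin_P[OF insert.hyps(1)]) (use wO w(2) P_prime integers_mult in blast)+
    have "w0 \<in> lvl Q" if Q: "Q \<in> S" for Q
    proof -
      have "w0 = (\<Prod>Q\<in>S - {Q}. w Q * w Q) * (w Q * w Q)"
        unfolding w0_def using prod.remove[OF insert.hyps(1) Q, of "\<lambda>Q. w Q * w Q"] by (simp add: mult.commute)
      moreover have "(\<Prod>Q\<in>S - {Q}. w Q * w Q) \<in> integers"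
        by (rule integers_prod) (intro integers_mult wO, blast+)
      moreover have "Q \<in> finite_places K" using Q Sf by blast
      ultimately show ?thesis using lvl(4,5) w(1)[OF Q] by metis
    qed
    then have w0I: "w0 \<in> I S" using w0O unfolding I_def by blast
    define J where "J = I S \<inter> P"
    have J_closed: "\<And>u v. u \<in> J \<Longrightarrow> v \<in> J \<Longrightarrow> u + v \<in> J" "\<And>u v. u \<in> J \<Longrightarrow> v \<in> J \<Longrightarrow> u - v \<in> J"
      "\<And>r u. r \<in> integers \<Longrightarrow> u \<in> J \<Longrightarrow> r * u \<in> J"
      using I_closed[OF Sf] P_add P_diff P_mult unfolding J_def by auto
    have "\<exists>Z. finite Z \<and> separated J Z \<and> card Z = card Y * ideal_norm K P"
    proof (rule separated_step[OF Y(1,2) w0I _ w0O])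
      show "w0 \<notin> J" using w0P unfolding J_def by blast
      show "J \<subseteq> I S" unfolding J_def by blast
      show "z * w0 \<in> J" if "z \<in> P" for z
        using I_closed(3)[OF Sf P_subset[OF that] w0I] P_mult2[OF w0O that] unfolding J_def by blast
    qed (use I_closed[OF Sf] J_closed in blast)+
    then obtain Z where Z: "finite Z" "separated J Z" "card Z = card Y * ideal_norm K P" by blast
    show ?case
    proof (cases "P \<in> T")
      case False
      have "I (insert P S) = J" unfolding I_def J_def lvl_def using False by auto
      then show ?thesis using Z Y(3) insert.hyps False by (intro exI[of _ Z]) (simp add: mult.commute)
    next
      case True
      have IJ: "I (insert P S) = J \<inter> P2" unfolding I_def J_def lvl_def using True P2_subset by auto
      \<comment> \<open>For the further step from \<open>P\<close> to \<open>P2\<close> the witness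
        is \<open>w0 * p\<close>, which stays outside \<open>P2\<close> because \<open>w0\<close> is
        prime to \<open>P\<close>.\<close>
      obtain p where p: "p \<in> P" "p \<notin> P2" using P_not_idempotent by blast
      have wpJ: "w0 * p \<in> J"
        using I_closed(3)[OF Sf P_subset[OF p(1)] w0I] P_mult[OF w0O p(1)] unfolding J_def by (simp add: mult.commute)
      have wpO: "w0 * p \<in> integers" using w0O P_subset[OF p(1)] by (rule integers_mult)
      have "\<exists>Z'. finite Z' \<and> separated (J \<inter> P2) Z' \<and> card Z' = card Z * ideal_norm K P"
      proof (rule separated_step[OF Z(1,2) wpJ _ wpO])
        show "w0 * p \<notin> J \<inter> P2" using P2_coprime[OF w0O w0P p(1)] p(2) by blast
        show "z * (w0 * p) \<in> J \<inter> P2" if z: "z \<in> P" for z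
        proof
          show "z * (w0 * p) \<in> J" by (rule J_closed(3)[OF P_subset[OF z] wpJ])
          show "z * (w0 * p) \<in> P2" using P2_mult[OF w0O P2_prod[OF z p(1)]] by (simp add: mult.left_commute)
        qed
      qed (use J_closed P2_add P2_mult in auto)
      then obtain Z' where "finite Z'" "separated (J \<inter> P2) Z'" "card Z' = card Z * ideal_norm K P" by blast
      then show ?thesis using Z(3) Y(3) insert.hyps True by (intro exI[of _ Z']) (simp add: IJ mult_ac)
    qed
  qed
  then obtain Y where Y: "finite Y" "separated (I S) Y"
      "card Y = (\<Prod>P\<in>S. ideal_norm K P * (if P \<in> T then ideal_norm K P else 1))" by blast
  have "x \<in> I S" unfolding I_def lvl_def using x(1) xS xT by auto
  then have "principal x \<subseteq> I S"
    unfolding principal_def using I_closed(3)[OF S(2), of _ x] by (auto simp: mult.commute)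
  then have "real (card Y) \<le> norm_K x" using card_separated_le_norm[OF x Y(1)] separated_mono[OF Y(2)] by blast
  moreover have "card Y = (\<Prod>P\<in>S. ideal_norm K P) * (\<Prod>P\<in>T. ideal_norm K P)"
    unfolding Y(3) prod.distrib using prod.inter_restrict[OF S(1), of "ideal_norm K" T] T by (simp add: Int_absorb1)
  ultimately show ?thesis by simp
qed

end

section \<open>The abc conjecture and the counting argument\<close>

text \<open>Some prime \<open>p\<close> occurs in \<open>k\<close> more often than in
  \<open>d\<close>, say \<open>v\<close> times in \<open>d\<close>. Then it occurs at least
  \<open>(v + 1) * j\<close> times in \<open>k ^ j\<close>, and this is at least
  \<open>v + j\<close>, which leaves room to remove \<open>p ^ j\<close>.\<close>

lemma dvd_div_prime_power:
  fixes d k m j :: nat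
  assumes "d > 0" "k > 0" "j > 0" and dvd: "d dvd k ^ j * m" and not_dvd: "\<not> k dvd d"
  shows "\<exists>p\<in>prime_factors k. p ^ j dvd k ^ j * m \<and> d dvd k ^ j * m div p ^ j"
proof -
  have "\<exists>p. normalization_semidom_class.prime p \<and> \<not> multiplicity p k \<le> multiplicity p d"
    using multiplicity_le_imp_dvd[of k d] assms(2) not_dvd by blast
  then obtain p where p: "normalization_semidom_class.prime p" "multiplicity p d < multiplicity p k"
    by (auto simp: not_le)
  define v where "v = multiplicity p d"
  obtain d' where d': "d = p ^ v * d'" "\<not> p dvd d'"
    using multiplicity_decompose'[of d p] assms(1) p(1) unfolding v_def by (metis not_gr0 not_prime_unit)
  have pk: "p dvd k" using p(2) by (metis gr_implies_not0 not_dvd_imp_multiplicity_0)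
  have "j + v \<le> multiplicity p k * j"
  proof -
    have "Suc v \<le> multiplicity p k" using p(2) by (simp add: v_def)
    then have "Suc v * j \<le> multiplicity p k * j" by (rule mult_le_mono1)
    moreover have "j + v \<le> Suc v * j" using assms(3) by simp
    ultimately show ?thesis by (rule order_trans[rotated])
  qed
  then have "p ^ (j + v) dvd (p ^ multiplicity p k) ^ j"
    unfolding power_mult[symmetric] by (rule le_imp_power_dvd)
  also have "\<dots> dvd k ^ j" using multiplicity_dvd[of p k] by (intro dvd_power_same)
  finally have 1: "p ^ (j + v) dvd k ^ j * m" by simp
  have 2: "d' dvd k ^ j * m" using dvd d'(1) by (metis dvd_mult_right)
  have "Rings.coprime p d'" using prime_imp_coprime[OF p(1) d'(2)] .
  then have "Rings.coprime (p ^ (j + v)) d'" by simp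
  then have "p ^ (j + v) * d' dvd k ^ j * m" using divides_mult[OF 1 2] by blast
  then have dv: "p ^ j * d dvd k ^ j * m" by (simp add: d'(1) power_add mult.assoc)
  have pj: "p ^ j dvd k ^ j * m" using dv dvd_mult_left by blast
  have "p ^ j > 0" using p(1) by (simp add: prime_gt_0_nat)
  then have "d dvd k ^ j * m div p ^ j" using dv pj by (metis div_dvd_iff_mult dvd_div_iff_mult mult.commute not_gr0)
  moreover have "p \<in> prime_factors k" using p(1) pk assms(2) by (simp add: prime_factors_dvd)
  ultimately show ?thesis using pj by blast
qed

lemma sum_UN_le:
  fixes f :: "'a \<Rightarrow> real"
  assumes "finite I" "\<And>i. i \<in> I \<Longrightarrow> finite (A i)" "\<And>i x. i \<in> I \<Longrightarrow> x \<in> A i \<Longrightarrow> f x \<ge> 0"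
  shows "sum f (\<Union>i\<in>I. A i) \<le> (\<Sum>i\<in>I. sum f (A i))"
  using assms
proof (induction I rule: finite_induct)
  case (insert i I)
  have "sum f (A i \<union> (\<Union>i\<in>I. A i)) + sum f (A i \<inter> (\<Union>i\<in>I. A i)) = sum f (A i) + sum f (\<Union>i\<in>I. A i)"
    by (rule sum.union_inter) (use insert in auto)
  moreover have "sum f (A i \<inter> (\<Union>i\<in>I. A i)) \<ge> 0" by (rule sum_nonneg) (use insert in auto)
  moreover have "sum f (\<Union>i\<in>I. A i) \<le> (\<Sum>i\<in>I. sum f (A i))" using insert by auto
  ultimately show ?case using insert by simp
qed simp

text \<open>The map sending \<open>m\<close> to \<open>Q * m div d\<close> is injective on these
  \<open>m\<close>, with values from 1 to \<open>Q * N div d\<close>.\<close>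

lemma card_multiples_le:
  fixes d Q N :: nat
  assumes "d > 0" "Q > 0"
  shows "d * card {m\<in>{1..N}. d dvd Q * m} \<le> Q * N"
proof -
  have "card {m\<in>{1..N}. d dvd Q * m} \<le> card {1..Q * N div d}"
  proof (rule card_inj_on_le)
    show "inj_on (\<lambda>m. Q * m div d) {m\<in>{1..N}. d dvd Q * m}"
    proof (rule inj_onI)
      fix a b assume "a \<in> {m\<in>{1..N}. d dvd Q * m}" "b \<in> {m\<in>{1..N}. d dvd Q * m}" "Q * a div d = Q * b div d"
      then have "Q * a = Q * b" by (metis (no_types, lifting) dvd_div_mult_self mem_Collect_eq)
      then show "a = b" using assms(2) by simp
    qed
    show "(\<lambda>m. Q * m div d) ` {m\<in>{1..N}. d dvd Q * m} \<subseteq> {1..Q * N div d}"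
    proof (rule image_subsetI)
      fix m assume m: "m \<in> {m\<in>{1..N}. d dvd Q * m}"
      have "d \<le> Q * m" using m assms by (auto intro: dvd_imp_le)
      then have "Q * m div d > 0" using assms(1) by (simp add: div_greater_zero_iff)
      moreover have "Q * m div d \<le> Q * N div d" using m by (intro div_le_mono) simp
      ultimately show "Q * m div d \<in> {1..Q * N div d}" by simp
    qed
  qed simp
  then have "d * card {m\<in>{1..N}. d dvd Q * m} \<le> d * (Q * N div d)" by simp
  also have "\<dots> \<le> Q * N" by simp
  finally show ?thesis .
qed

locale abc_field = galois_field +
  fixes a :: complex
  assumes a_int: "a \<in> carrier (ring_of_integers K)"
    and a_large: "\<And>\<sigma>. \<sigma> \<in> Gal K \<Longrightarrow> cmod (\<sigma> a) \<ge> 2"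
    and abc: "abc_conjecture K"
begin

lemma a: "a \<in> integers"
  using a_int by simp

section \<open>Logarithmic norms and the abc inequality\<close>

definition L :: real
  where "L = ln (norm_K a)"

definition ln_norm :: "complex set \<Rightarrow> real"
  where "ln_norm P = ln (real (ideal_norm K P))"

definition divisors :: "complex \<Rightarrow> complex set set"
  where "divisors x = {P \<in> finite_places K. x \<in> P}"

definition square_divisors :: "complex \<Rightarrow> complex set set"
  where "square_divisors x = {P \<in> finite_places K. x \<in> place.P2 K P}"

lemma norm_ge_1: "P \<in> finite_places K \<Longrightarrow> real (ideal_norm K P) \<ge> 1"
  using place.ideal_norm_pos[OF placeI] by (simp add: Suc_le_eq)

lemma ln_norm_nonneg: "P \<in> finite_places K \<Longrightarrow> ln_norm P \<ge> 0"
  unfolding ln_norm_def using norm_ge_1 by (simp add: ln_ge_zero)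

lemma norm_pos: "P \<in> finite_places K \<Longrightarrow> real (ideal_norm K P) > 0"
  using norm_ge_1[of P] by linarith

lemma prod_norm_pos: "S \<subseteq> finite_places K \<Longrightarrow> (\<Prod>P\<in>S. real (ideal_norm K P)) > 0"
  by (rule prod_pos) (rule norm_pos, blast)

lemma ln_prod_norm:
  assumes "finite S" "S \<subseteq> finite_places K"
  shows "ln (\<Prod>P\<in>S. real (ideal_norm K P)) = sum ln_norm S"
  unfolding ln_norm_def
proof (rule ln_prod[OF assms(1)])
  fix P assume "P \<in> S"
  then have "P \<in> finite_places K" using assms(2) by blast
  then show "real (ideal_norm K P) \<noteq> 0" using norm_pos[of P] by simp
qed

lemma norm_a: "norm_K a \<ge> 2"
proof -
  have "(2::real) ^ 1 \<le> 2 ^ card (Gal K)" using card_Gal_pos by (intro power_increasing) auto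
  also have "\<dots> = (\<Prod>\<sigma>\<in>Gal K. 2)" by simp
  also have "\<dots> \<le> norm_K a" unfolding norm_K_def by (intro prod_mono) (auto simp: a_large)
  finally show ?thesis by simp
qed

lemma L_pos: "L > 0"
  unfolding L_def using norm_a by simp

lemma exp_L: "norm_K a ^ n = exp (real n * L)"
  unfolding L_def using norm_a by (simp add: exp_of_nat_mult)

lemma power_a_ne_1: "n > 0 \<Longrightarrow> a ^ n - 1 \<noteq> 0"
proof
  assume n: "n > 0" and "a ^ n - 1 = 0"
  then have "cmod a ^ n = 1" by (metis eq_iff_diff_eq_0 norm_one norm_power)
  moreover have "cmod a \<ge> 2" using a_large[OF id_in_Gal] integers_subset_K[OF a] by simp
  ultimately show False using one_less_power[of "cmod a" n] n by simp
qed

lemma power_a_integers: "a ^ n \<in> integers" "a ^ n - 1 \<in> integers"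
  by (intro integers_closed a)+

text \<open>For each conjugate \<open>z\<close> of \<open>a\<close>,
  \<open>|z ^ n - 1| \<le> 2 |z| ^ n \<le> |z| ^ (n + 1)\<close>, by
  \<open>|z| \<ge> 2\<close>.\<close>

lemma norm_power_minus_1: "norm_K (a ^ n - 1) \<le> norm_K a ^ (n + 1)"
proof -
  have "cmod (\<sigma> (a ^ n - 1)) \<le> cmod (\<sigma> a) ^ (n + 1)" if s: "\<sigma> \<in> Gal K" for \<sigma>
  proof -
    note em = Gal_embedding[OF s]
    have aK: "a \<in> K" "a ^ n \<in> K" using a power_a_integers(1) integers_subset_K by blast+
    have "\<sigma> (a ^ n - 1) = \<sigma> a ^ n - 1"
      using embedding_hom(6)[OF em aK(2) K_closed(2)] embedding_power[OF em aK(1)] embedding_hom(3)[OF em] by simp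
    then have "cmod (\<sigma> (a ^ n - 1)) \<le> cmod (\<sigma> a) ^ n + 1"
      using norm_triangle_ineq4[of "\<sigma> a ^ n" 1] by (simp add: norm_power)
    also have "\<dots> \<le> 2 * cmod (\<sigma> a) ^ n" using one_le_power[of "cmod (\<sigma> a)" n] a_large[OF s] by simp
    also have "\<dots> \<le> cmod (\<sigma> a) * cmod (\<sigma> a) ^ n" using a_large[OF s] by (intro mult_right_mono) auto
    finally show ?thesis by simp
  qed
  then have "norm_K (a ^ n - 1) \<le> (\<Prod>\<sigma>\<in>Gal K. cmod (\<sigma> a) ^ (n + 1))"
    unfolding norm_K_def by (intro prod_mono) auto
  also have "\<dots> = norm_K a ^ (n + 1)" unfolding norm_K_def by (rule prod_power_distrib[symmetric])
  finally show ?thesis .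
qed

lemma ln_norm_power_minus_1: "n > 0 \<Longrightarrow> ln (norm_K (a ^ n - 1)) \<le> real (n + 1) * L"
proof -
  assume n: "n > 0"
  have "norm_K (a ^ n - 1) > 0"
    using norm_K_pos power_a_ne_1[OF n] power_a_integers(2) integers_subset_K by blast
  then have "ln (norm_K (a ^ n - 1)) \<le> ln (norm_K a ^ (n + 1))" by (rule ln_mono[OF norm_power_minus_1])
  then show ?thesis unfolding exp_L by simp
qed

lemma sum_divisors_le:
  assumes x: "x \<in> integers" "x \<noteq> 0"
  shows "sum ln_norm (divisors x) + sum ln_norm (divisors x \<inter> square_divisors x) \<le> ln (norm_K x)"
proof -
  have fin: "finite (divisors x)" unfolding divisors_def by (rule finite_places_containing[OF x])
  have sub: "divisors x \<subseteq> finite_places K" "divisors x \<inter> square_divisors x \<subseteq> finite_places K"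
    unfolding divisors_def by auto
  let ?s = "\<Prod>P\<in>divisors x. real (ideal_norm K P)"
  let ?t = "\<Prod>P\<in>divisors x \<inter> square_divisors x. real (ideal_norm K P)"
  have "?s * ?t \<le> norm_K x"
    by (rule prod_norm_le_norm[OF fin sub(1) _ x]) (auto simp: divisors_def square_divisors_def)
  moreover have pos: "?s > 0" "?t > 0" using sub by (auto intro: prod_norm_pos)
  ultimately have "ln (?s * ?t) \<le> ln (norm_K x)" by (intro ln_mono mult_pos_pos)
  then have "ln ?s + ln ?t \<le> ln (norm_K x)" using pos by (simp add: ln_mult)
  then show ?thesis using ln_prod_norm fin sub by simp
qed

lemma abc_height_lower:
  "(norm_K a ^ n) powr (1 / real (field_degree K)) \<le> abc_height K (a ^ n - 1) 1 (a ^ n)"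
proof -
  define s where "s = 1 / real (field_degree K)"
  let ?h = "\<lambda>v. Max {infinite_abs K v (a ^ n - 1), infinite_abs K v 1, infinite_abs K v (a ^ n)}"
  let ?f = "\<lambda>P. Max {finite_abs K P (a ^ n - 1), finite_abs K P 1, finite_abs K P (a ^ n)}"
  have aK: "a \<in> K" using a integers_subset_K by blast
  have h1: "?h v \<ge> 1" if "v \<in> embeddings K" for v
  proof -
    have "infinite_abs K v 1 = 1" unfolding infinite_abs_def using embedding_hom(3)[OF that] by simp
    then show ?thesis by (simp add: le_max_iff_disj)
  qed
  have "(norm_K a ^ n) powr s = (\<Prod>\<sigma>\<in>Gal K. (cmod (\<sigma> a) ^ n) powr s)"
    unfolding norm_K_def prod_power_distrib prod_powr_distrib ..
  also have "\<dots> \<le> (\<Prod>\<sigma>\<in>Gal K. ?h \<sigma>)"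
  proof (intro prod_mono conjI)
    fix \<sigma> assume s: "\<sigma> \<in> Gal K"
    have "(cmod (\<sigma> a) ^ n) powr s = infinite_abs K \<sigma> (a ^ n)"
      unfolding infinite_abs_def s_def using embedding_power[OF Gal_embedding[OF s] aK] by (simp add: norm_power)
    then show "(cmod (\<sigma> a) ^ n) powr s \<le> ?h \<sigma>" by simp
  qed simp
  also have "\<dots> \<le> (\<Prod>v\<in>embeddings K. ?h v)"
  proof (rule prod_mono2[OF finite_embeddings])
    show "Gal K \<subseteq> embeddings K" using Gal_embedding by blast
    show "1 \<le> ?h v" if "v \<in> embeddings K - Gal K" for v using h1 that by blast
    show "0 \<le> ?h v" if "v \<in> Gal K" for v using h1[OF Gal_embedding[OF that]] by linarith
  qed
  finally have 1: "(norm_K a ^ n) powr s \<le> (\<Prod>v\<in>embeddings K. ?h v)" .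
  have 2: "(\<Prod>P\<in>abc_places K (a ^ n - 1) 1 (a ^ n). ?f P) \<ge> 1"
  proof (rule prod_ge_1)
    fix P assume "P \<in> abc_places K (a ^ n - 1) 1 (a ^ n)"
    then interpret place K P by (intro placeI) (simp add: abc_places_def)
    show "?f P \<ge> 1" using finite_abs_coprime[OF integers_1 one_notin_P] by (simp add: le_max_iff_disj)
  qed
  have "(\<Prod>v\<in>embeddings K. ?h v) \<ge> 1" by (rule prod_ge_1) (rule h1)
  then have "(\<Prod>v\<in>embeddings K. ?h v) \<ge> 0" by linarith
  then have "(\<Prod>v\<in>embeddings K. ?h v) * 1 \<le> abc_height K (a ^ n - 1) 1 (a ^ n)"
    unfolding abc_height_def using 2 by (intro mult_left_mono)
  then show ?thesis using 1 unfolding s_def by simp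
qed

text \<open>A place in the conductor contains \<open>a ^ n - 1\<close> or \<open>a ^ n\<close>, and
  in the second case \<open>a\<close> itself; those contribute an amount independent of
  \<open>n\<close>.\<close>

lemma abc_conductor_upper:
  assumes n: "n > 0"
  shows "0 < abc_conductor K (a ^ n - 1) 1 (a ^ n)"
    "real (field_degree K) * ln (abc_conductor K (a ^ n - 1) 1 (a ^ n))
      \<le> sum ln_norm (divisors a) + sum ln_norm (divisors (a ^ n - 1))"
proof -
  let ?A = "abc_places K (a ^ n - 1) 1 (a ^ n)"
  define s where "s = 1 / real (field_degree K)"
  have a0: "a \<noteq> 0" using norm_a a_large[OF id_in_Gal] integers_subset_K[OF a] by auto
  have fin: "finite (divisors a)" "finite (divisors (a ^ n - 1))"
    unfolding divisors_def
    using finite_places_containing[OF a a0] finite_places_containing[OF power_a_integers(2) power_a_ne_1[OF n]] by auto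
  have sub: "?A \<subseteq> divisors a \<union> divisors (a ^ n - 1)"
  proof
    fix P assume P: "P \<in> ?A"
    then have Pf: "P \<in> finite_places K" by (simp add: abc_places_def)
    interpret place K P using Pf by (rule placeI)
    have "a ^ n - 1 \<in> P \<or> a ^ n \<in> P"
      using P finite_abs_coprime power_a_integers integers_1 one_notin_P unfolding abc_places_def by blast
    then show "P \<in> divisors a \<union> divisors (a ^ n - 1)"
      using P_power[OF a] Pf unfolding divisors_def by blast
  qed
  have Af: "?A \<subseteq> finite_places K" by (auto simp: abc_places_def)
  have finA: "finite ?A" using finite_subset[OF sub] fin by blast
  have eq: "abc_conductor K (a ^ n - 1) 1 (a ^ n) = (\<Prod>P\<in>?A. real (ideal_norm K P)) powr s"
    unfolding abc_conductor_def s_def prod_powr_distrib ..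
  have pos: "(\<Prod>P\<in>?A. real (ideal_norm K P)) > 0" by (rule prod_norm_pos[OF Af])
  then show "0 < abc_conductor K (a ^ n - 1) 1 (a ^ n)" unfolding eq by simp
  have "real (field_degree K) * ln (abc_conductor K (a ^ n - 1) 1 (a ^ n)) = ln (\<Prod>P\<in>?A. real (ideal_norm K P))"
    unfolding eq using pos field_degree_pos by (simp add: ln_powr s_def)
  also have "\<dots> = sum ln_norm ?A" by (rule ln_prod_norm[OF finA Af])
  also have "\<dots> \<le> sum ln_norm (divisors a \<union> divisors (a ^ n - 1))"
    using sub fin ln_norm_nonneg by (intro sum_mono2) (auto simp: divisors_def)
  also have "\<dots> \<le> sum ln_norm (divisors a) + sum ln_norm (divisors (a ^ n - 1))"
    using fin sum.union_inter[of "divisors a" "divisors (a ^ n - 1)" ln_norm]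
      sum_nonneg[of "divisors a \<inter> divisors (a ^ n - 1)" ln_norm] ln_norm_nonneg
    by (auto simp: divisors_def)
  finally show "real (field_degree K) * ln (abc_conductor K (a ^ n - 1) 1 (a ^ n))
      \<le> sum ln_norm (divisors a) + sum ln_norm (divisors (a ^ n - 1))" .
qed

text \<open>
  Write \<open>s\<close> and \<open>t\<close> for the norms of the primes dividing \<open>a\<^sup>n - 1\<close> exactly once and at least twice. Then
  \<open>s t\<^sup>2 \<le> \<bar>N(a)\<bar>\<^sup>n\<^sup>+\<^sup>1\<close>, while the \<open>abc\<close> conjecture for \<open>(a\<^sup>n - 1) + 1 = a\<^sup>n\<close> with exponent \<open>4/3\<close> bounds \<open>s t\<close>
  from below by \<open>\<bar>N(a)\<bar>\<^sup>3\<^sup>n\<^sup>/\<^sup>4\<close> up to a constant.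
\<close>

lemma squarefree_part_lower:
  "\<exists>c. \<forall>n>0. real n * L / 2 - c \<le> sum ln_norm (divisors (a ^ n - 1) - square_divisors (a ^ n - 1))"
proof -
  let ?D = "real (field_degree K)"
  have D: "?D > 0" using field_degree_pos by simp
  have "(1/3::real) > 0" by simp
  then obtain C0 :: real where C0: "\<forall>\<alpha>\<in>K. \<forall>\<beta>\<in>K. \<alpha> \<noteq> 0 \<longrightarrow> \<beta> \<noteq> 0 \<longrightarrow> \<alpha> + \<beta> \<noteq> 0 \<longrightarrow>
      abc_height K \<alpha> \<beta> (\<alpha> + \<beta>) \<le> C0 * abc_conductor K \<alpha> \<beta> (\<alpha> + \<beta>) powr (1 + 1/3)"
    using abc unfolding abc_conjecture_def by blast
  \<comment> \<open>The conjecture says nothing about the sign of its constant, and a positive one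
    is needed for logarithms.\<close>
  define C where "C = max C0 1"
  have C: "C > 0" "C0 \<le> C" unfolding C_def by auto
  define \<alpha> where "\<alpha> = sum ln_norm (divisors a)"
  \<comment> \<open>From \<open>3/4 * n * L \<le> 3/4 * D * ln C + \<alpha> + \<beta>\<close> and
    \<open>\<beta> + \<tau> \<le> n * L + L\<close>, with \<open>D\<close> the degree: the wanted
    sum is \<open>\<beta> - \<tau> = 2 * \<beta> - (\<beta> + \<tau>)\<close>.\<close>
  define c where "c = L + 3/2 * (?D * ln C) + 2 * \<alpha>"
  have "real n * L / 2 - c \<le> sum ln_norm (divisors (a ^ n - 1) - square_divisors (a ^ n - 1))" if n: "n > 0" for n
  proof -
    let ?x = "a ^ n - 1"
    let ?cond = "abc_conductor K ?x 1 (a ^ n)"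
    define \<beta> where "\<beta> = sum ln_norm (divisors ?x)"
    define \<tau> where "\<tau> = sum ln_norm (divisors ?x \<inter> square_divisors ?x)"
    have a0: "a ^ n \<noteq> 0" using a_large[OF id_in_Gal] integers_subset_K[OF a] by auto
    have x0: "?x \<noteq> 0" by (rule power_a_ne_1[OF n])
    have xK: "?x \<in> K" using power_a_integers(2) integers_subset_K by blast
    have "abc_height K ?x 1 (?x + 1) \<le> C0 * abc_conductor K ?x 1 (?x + 1) powr (1 + 1/3)"
      using C0[rule_format, OF xK K_closed(2) x0 one_neq_zero] a0 by simp
    then have "abc_height K ?x 1 (a ^ n) \<le> C0 * ?cond powr (4/3)" by simp
    also have "\<dots> \<le> C * ?cond powr (4/3)" using C(2) by (intro mult_right_mono) auto
    finally have ineq: "(norm_K a ^ n) powr (1 / ?D) \<le> C * ?cond powr (4/3)"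
      using abc_height_lower[of n] by linarith
    have "norm_K a > 0" using norm_a by linarith
    then have "0 < (norm_K a ^ n) powr (1 / ?D)" by simp
    then have "ln ((norm_K a ^ n) powr (1 / ?D)) \<le> ln (C * ?cond powr (4/3))" by (rule ln_mono[OF ineq])
    moreover have "ln ((norm_K a ^ n) powr (1 / ?D)) = real n * L / ?D"
      unfolding exp_L by (simp add: ln_powr)
    moreover have "ln (C * ?cond powr (4/3)) = ln C + 4/3 * ln ?cond"
      using C(1) abc_conductor_upper(1)[OF n] by (simp add: ln_mult ln_powr)
    ultimately have "real n * L / ?D \<le> ln C + 4/3 * ln ?cond" by linarith
    then have "real n * L \<le> (ln C + 4/3 * ln ?cond) * ?D" using D by (simp add: pos_divide_le_eq)
    then have 1: "real n * L \<le> ?D * ln C + 4/3 * (?D * ln ?cond)" by (simp add: algebra_simps)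
    have 2: "?D * ln ?cond \<le> \<alpha> + \<beta>" unfolding \<alpha>_def \<beta>_def by (rule abc_conductor_upper(2)[OF n])
    have 3: "\<beta> + \<tau> \<le> real n * L + L"
      using sum_divisors_le[OF power_a_integers(2) x0] ln_norm_power_minus_1[OF n]
      unfolding \<beta>_def \<tau>_def by (simp add: algebra_simps)
    have fin: "finite (divisors ?x)"
      unfolding divisors_def by (rule finite_places_containing[OF power_a_integers(2) x0])
    have "sum ln_norm (divisors ?x - square_divisors ?x) = \<beta> - \<tau>"
      unfolding \<beta>_def \<tau>_def using sum.Int_Diff[OF fin, of ln_norm "square_divisors ?x"] by simp
    then show ?thesis using 1 2 3 unfolding c_def by linarith
  qed
  then show ?thesis by blast
qed

text \<open>The condition on the order forces the congruence, since at these places the order of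
  \<open>a\<close> divides the norm minus 1.\<close>

definition good_places :: "nat \<Rightarrow> nat \<Rightarrow> complex set set"
  where "good_places k n = {P \<in> divisors (a ^ n - 1) - square_divisors (a ^ n - 1). k dvd place.order_mod P a}"

lemma finite_divisors_power: "n > 0 \<Longrightarrow> finite (divisors (a ^ n - 1))"
  unfolding divisors_def by (rule finite_places_containing[OF power_a_integers(2) power_a_ne_1])

lemma sum_divisors_power_le:
  assumes n: "n > 0"
  shows "sum ln_norm (divisors (a ^ n - 1)) \<le> real (n + 1) * L"
proof -
  have "sum ln_norm (divisors (a ^ n - 1) \<inter> square_divisors (a ^ n - 1)) \<ge> 0"
    using ln_norm_nonneg by (intro sum_nonneg) (auto simp: divisors_def)
  then show ?thesis
    using sum_divisors_le[OF power_a_integers(2) power_a_ne_1[OF n]] ln_norm_power_minus_1[OF n] by linarith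
qed

text \<open>
  A prime whose order \<open>d\<close> divides \<open>n\<close> but is not divisible by \<open>k\<close> already divides \<open>a\<^bsup>n / p\<^sup>j\<^esup> - 1\<close> for some
  prime factor \<open>p\<close> of \<open>k\<close>, and the exponent \<open>j = k + 2\<close> makes all these contributions small.
\<close>

lemma good_part_lower:
  assumes k: "k > 0"
  shows "\<exists>c. \<forall>m>0. real (k ^ (k + 2) * m) * L / 4 - c \<le> sum ln_norm (good_places k (k ^ (k + 2) * m))"
proof -
  define j where "j = k + 2"
  obtain c where c: "\<And>n. n > 0 \<Longrightarrow> real n * L / 2 - c \<le> sum ln_norm (divisors (a ^ n - 1) - square_divisors (a ^ n - 1))"
    using squarefree_part_lower by blast
  have "real (k ^ j * m) * L / 4 - (c + real k * L) \<le> sum ln_norm (good_places k (k ^ j * m))" if m: "m > 0" for m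
  proof -
    define n where "n = k ^ j * m"
    have n: "n > 0" using k m by (simp add: n_def)
    define S where "S = divisors (a ^ n - 1) - square_divisors (a ^ n - 1)"
    define F where "F = {p \<in> prime_factors k. p ^ j dvd n}"
    have finS: "finite S" unfolding S_def using finite_divisors_power[OF n] by blast
    have finF: "finite F" unfolding F_def by simp
    have Fpos: "n div p ^ j > 0" if "p \<in> F" for p
      using that n unfolding F_def by (auto simp: dvd_div_eq_0_iff intro!: Nat.gr0I)
    have bad: "S - good_places k n \<subseteq> (\<Union>p\<in>F. divisors (a ^ (n div p ^ j) - 1))"
    proof
      fix P assume P: "P \<in> S - good_places k n"
      then have Pf: "P \<in> finite_places K" and Pn: "a ^ n - 1 \<in> P" and nk: "\<not> k dvd place.order_mod P a"
        unfolding S_def good_places_def divisors_def by auto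
      interpret place K P using Pf by (rule placeI)
      have "order_mod a dvd k ^ j * m" using order_mod_dvd[OF a n Pn Pn] unfolding n_def .
      then obtain p where p: "p \<in> prime_factors k" "p ^ j dvd k ^ j * m" "order_mod a dvd k ^ j * m div p ^ j"
        using dvd_div_prime_power[of "order_mod a" k j m] order_mod(1)[OF n Pn] k nk unfolding j_def by auto
      obtain w where w: "w \<in> integers" "a ^ (n div p ^ j) - 1 = w * (a ^ order_mod a - 1)"
        using power_minus_one_dvd[OF a p(3)] unfolding n_def by blast
      have "a ^ (n div p ^ j) - 1 \<in> P" unfolding w(2) by (rule P_mult[OF w(1) order_mod(2)[OF n Pn]])
      then show "P \<in> (\<Union>p\<in>F. divisors (a ^ (n div p ^ j) - 1))"
        using p Pf unfolding F_def divisors_def n_def by blast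
    qed
    have fin_div: "finite (divisors (a ^ (n div p ^ j) - 1))" if "p \<in> F" for p
      by (rule finite_divisors_power[OF Fpos[OF that]])
    have each: "sum ln_norm (divisors (a ^ (n div p ^ j) - 1)) \<le> (real n / 2 ^ j + 1) * L" if p: "p \<in> F" for p
    proof -
      have "normalization_semidom_class.prime p" using p unfolding F_def by (auto dest: in_prime_factors_imp_prime)
      then have "p \<ge> 2" by (rule prime_ge_2_nat)
      then have "(2::real) ^ j \<le> real p ^ j" by (intro power_mono) auto
      moreover have "real (n div p ^ j) \<le> real n / real (p ^ j)" using p unfolding F_def by (simp add: real_of_nat_div)
      moreover have "real n / real (p ^ j) \<le> real n / 2 ^ j"
        using \<open>(2::real) ^ j \<le> real p ^ j\<close> by (intro frac_le) auto
      ultimately have "real (n div p ^ j + 1) \<le> real n / 2 ^ j + 1" by linarith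
      then have "real (n div p ^ j + 1) * L \<le> (real n / 2 ^ j + 1) * L" using L_pos by (intro mult_right_mono) auto
      then show ?thesis using sum_divisors_power_le[OF Fpos[OF p]] by linarith
    qed
    have "F \<subseteq> {1..k}"
    proof
      fix p assume "p \<in> F"
      then have "p dvd k" "normalization_semidom_class.prime p"
        unfolding F_def by (auto dest: in_prime_factors_imp_prime in_prime_factors_imp_dvd)
      then show "p \<in> {1..k}" using k prime_gt_0_nat[of p] dvd_imp_le[of p k] by simp
    qed
    then have "card F \<le> card {1..k}" by (intro card_mono) simp_all
    then have cardF: "real (card F) \<le> real k" by simp
    have "sum ln_norm (S - good_places k n) \<le> sum ln_norm (\<Union>p\<in>F. divisors (a ^ (n div p ^ j) - 1))"
      using bad finF fin_div ln_norm_nonneg by (intro sum_mono2) (auto simp: divisors_def)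
    also have "\<dots> \<le> (\<Sum>p\<in>F. sum ln_norm (divisors (a ^ (n div p ^ j) - 1)))"
      using finF fin_div ln_norm_nonneg by (intro sum_UN_le) (auto simp: divisors_def)
    also have "\<dots> \<le> (\<Sum>p\<in>F. (real n / 2 ^ j + 1) * L)" by (rule sum_mono) (rule each)
    also have "\<dots> \<le> real k * ((real n / 2 ^ j + 1) * L)"
      using cardF L_pos by (simp add: mult_right_mono)
    also have "\<dots> = real k / 2 ^ j * (real n * L) + real k * L" by (simp add: algebra_simps)
    also have "\<dots> \<le> 1 / 4 * (real n * L) + real k * L"
    proof -
      \<comment> \<open>\<open>2 ^ j\<close> is \<open>4 * 2 ^ k\<close>, so the bad primes take at
        most \<open>n * L / 4\<close>, up to a constant, out of the available
        \<open>n * L / 2\<close>.\<close>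
      have "real k \<le> 2 ^ k" by (simp add: less_imp_le)
      then have "real k / 2 ^ j \<le> 1 / 4" by (simp add: j_def power_add field_simps)
      then show ?thesis using L_pos by (intro add_right_mono mult_right_mono) auto
    qed
    finally have badsum: "sum ln_norm (S - good_places k n) \<le> 1 / 4 * (real n * L) + real k * L" .
    have "good_places k n \<subseteq> S" unfolding good_places_def S_def by blast
    then have "sum ln_norm S = sum ln_norm (S - good_places k n) + sum ln_norm (good_places k n)"
      by (rule sum.subset_diff[OF _ finS])
    then show ?thesis using badsum c[OF n] unfolding S_def n_def[symmetric] by linarith
  qed
  then show ?thesis unfolding j_def by blast
qed

lemma good_place_properties:
  assumes n: "n > 0" and P: "P \<in> good_places k n"
  shows "P \<in> finite_places K" "non_wieferich_place K a P" "[ideal_norm K P = 1] (mod k)"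
    "0 < place.order_mod P a" "place.order_mod P a dvd n"
    "ln_norm P \<le> real (place.order_mod P a + 1) * L"
proof -
  show Pf: "P \<in> finite_places K" using P unfolding good_places_def divisors_def by blast
  interpret place K P using Pf by (rule placeI)
  have Pn: "a ^ n - 1 \<in> P" "a ^ n - 1 \<notin> P2" and kd: "k dvd order_mod a"
    using P Pf unfolding good_places_def divisors_def square_divisors_def by auto
  note crit = non_wieferich_criterion[OF a n Pn]
  show "non_wieferich_place K a P" by (rule crit(1))
  have "k dvd ideal_norm K P - 1" using kd crit(2) by (rule dvd_trans)
  then obtain e where "ideal_norm K P - 1 = k * e" by blast
  then have "ideal_norm K P = 1 + k * e" using ideal_norm_pos by linarith
  then show "[ideal_norm K P = 1] (mod k)" by (simp only: cong_def mod_mult_self2)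
  show d: "0 < order_mod a" by (rule order_mod(1)[OF n Pn(1)])
  show "order_mod a dvd n" by (rule order_mod_dvd[OF a n Pn(1) Pn(1)])
  \<comment> \<open>Using the exponent \<open>order_mod a\<close> instead of \<open>n\<close> bounds
    the norm by the order, which offsets the number of times the place recurs.\<close>
  have "P \<in> divisors (a ^ order_mod a - 1)" using order_mod(2)[OF n Pn(1)] Pf unfolding divisors_def by blast
  then have "ln_norm P \<le> sum ln_norm (divisors (a ^ order_mod a - 1))"
    using finite_divisors_power[OF d] ln_norm_nonneg by (intro member_le_sum) (auto simp: divisors_def)
  then show "ln_norm P \<le> real (order_mod a + 1) * L" using sum_divisors_power_le[OF d] by linarith
qed

text \<open>
  In the sum over \<open>m \<le> N\<close> a prime of order \<open>d\<close> contributes its logarithmic norm, which is \<open>O(d)\<close>, for at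
  most \<open>k\<^bsup>k + 2\<^esup> N / d\<close> values of \<open>m\<close>. So each prime contributes \<open>O(N)\<close> to a sum of order \<open>N\<^sup>2\<close>.
\<close>

lemma many_good_places:
  assumes k: "k > 0"
  shows "\<exists>c. \<forall>N. real N / 16 - c \<le> real (card (\<Union>m\<in>{1..N}. good_places k (k ^ (k + 2) * m)))"
proof -
  define Q where "Q = k ^ (k + 2)"
  have Q: "Q > 0" using k by (simp add: Q_def)
  obtain c where c: "\<forall>m>0. real (Q * m) * L / 4 - c \<le> sum ln_norm (good_places k (Q * m))"
    using good_part_lower[OF k] unfolding Q_def by blast
  \<comment> \<open>A place of order \<open>d\<close> has logarithmic norm at most
    \<open>(d + 1) * L \<le> 2 * d * L\<close> and recurs at most \<open>Q * N / d\<close> times,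
    which makes \<open>N * B\<close> in total.\<close>
  define B where "B = 2 * real Q * L"
  have B: "B > 0" using Q L_pos by (simp add: B_def)
  have "real N / 16 - \<bar>c\<bar> / B \<le> real (card (\<Union>m\<in>{1..N}. good_places k (Q * m)))" for N
  proof (cases "N = 0")
    case True
    then show ?thesis using B by simp
  next
    case False
    define T where "T = (\<Union>m\<in>{1..N}. good_places k (Q * m))"
    have fin: "finite (good_places k (Q * m))" if "m \<in> {1..N}" for m
    proof (rule finite_subset)
      show "good_places k (Q * m) \<subseteq> divisors (a ^ (Q * m) - 1)" unfolding good_places_def by blast
      show "finite (divisors (a ^ (Q * m) - 1))" using that Q by (intro finite_divisors_power) simp
    qed
    have finT: "finite T" unfolding T_def using fin by blast
    have contribution: "(\<Sum>m\<in>{m\<in>{1..N}. P \<in> good_places k (Q * m)}. ln_norm P) \<le> real N * B" if P: "P \<in> T" for P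
    proof -
      let ?d = "place.order_mod P a"
      obtain m0 where m0: "m0 \<in> {1..N}" "P \<in> good_places k (Q * m0)" using P unfolding T_def by blast
      have "Q * m0 > 0" using m0(1) Q by simp
      note good = good_place_properties[OF this m0(2)]
      have d: "?d > 0" by (rule good(4))
      have sub: "{m\<in>{1..N}. P \<in> good_places k (Q * m)} \<subseteq> {m\<in>{1..N}. ?d dvd Q * m}"
        using good_place_properties(5) Q by auto
      have "(\<Sum>m\<in>{m\<in>{1..N}. P \<in> good_places k (Q * m)}. ln_norm P)
          = real (card {m\<in>{1..N}. P \<in> good_places k (Q * m)}) * ln_norm P" by simp
      also have "\<dots> \<le> real (card {m\<in>{1..N}. ?d dvd Q * m}) * ln_norm P"
        using ln_norm_nonneg[OF good(1)] card_mono[OF _ sub] by (intro mult_right_mono) auto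
      also have "\<dots> \<le> real (card {m\<in>{1..N}. ?d dvd Q * m}) * (2 * real ?d * L)"
      proof (intro mult_left_mono)
        have "real (?d + 1) * L \<le> 2 * real ?d * L" using d L_pos by (intro mult_right_mono) auto
        then show "ln_norm P \<le> 2 * real ?d * L" using good(6) by linarith
      qed simp
      also have "\<dots> = real (?d * card {m\<in>{1..N}. ?d dvd Q * m}) * (2 * L)" by simp
      also have "\<dots> \<le> real (Q * N) * (2 * L)"
        using card_multiples_le[OF d Q, of N] L_pos by (intro mult_right_mono) (auto simp only: of_nat_le_iff)
      finally show ?thesis by (simp add: B_def mult_ac)
    qed
    have gauss: "(\<Sum>m\<in>{1..n}. real m) = real n * (real n + 1) / 2" for n
      by (induction n) (auto simp: field_simps)
    have "(\<Sum>m\<in>{1..N}. real (Q * m) * L / 4 - \<bar>c\<bar>) = (\<Sum>m\<in>{1..N}. real Q * L / 4 * real m) - real N * \<bar>c\<bar>"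
      by (simp add: sum_subtractf mult_ac)
    also have "\<dots> = real Q * L / 4 * (real N * (real N + 1) / 2) - real N * \<bar>c\<bar>"
      unfolding sum_distrib_left[symmetric] gauss ..
    finally have eq: "(\<Sum>m\<in>{1..N}. real (Q * m) * L / 4 - \<bar>c\<bar>)
        = real Q * L / 4 * (real N * (real N + 1) / 2) - real N * \<bar>c\<bar>" .
    have "real Q * L * real N \<ge> 0" using L_pos by simp
    \<comment> \<open>The main term \<open>Q * L * N ^ 2 / 8\<close> equals
      \<open>B * N ^ 2 / 16\<close>.\<close>
    then have "real N * (real N * B / 16 - \<bar>c\<bar>) \<le> (\<Sum>m\<in>{1..N}. real (Q * m) * L / 4 - \<bar>c\<bar>)"
      unfolding eq by (simp add: B_def algebra_simps)
    also have "\<dots> \<le> (\<Sum>m\<in>{1..N}. sum ln_norm (good_places k (Q * m)))"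
    proof (rule sum_mono)
      fix m assume "m \<in> {1..N}"
      then have "real (Q * m) * L / 4 - c \<le> sum ln_norm (good_places k (Q * m))" using c by simp
      then show "real (Q * m) * L / 4 - \<bar>c\<bar> \<le> sum ln_norm (good_places k (Q * m))" by linarith
    qed
    also have "\<dots> = (\<Sum>m\<in>{1..N}. \<Sum>P\<in>{P\<in>T. P \<in> good_places k (Q * m)}. ln_norm P)"
    proof (intro sum.cong refl)
      fix m assume "m \<in> {1..N}"
      then show "good_places k (Q * m) = {P\<in>T. P \<in> good_places k (Q * m)}" unfolding T_def by blast
    qed
    also have "\<dots> = (\<Sum>P\<in>T. \<Sum>m\<in>{m\<in>{1..N}. P \<in> good_places k (Q * m)}. ln_norm P)"
      by (rule sum.swap_restrict) (simp_all add: finT)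
    also have "\<dots> \<le> (\<Sum>P\<in>T. real N * B)" by (rule sum_mono) (rule contribution)
    finally have "real N * (real N * B / 16 - \<bar>c\<bar>) \<le> real N * (real (card T) * B)" by (simp add: mult_ac)
    then have "real N * B / 16 - \<bar>c\<bar> \<le> real (card T) * B" using False by simp
    then have "(real N * B / 16 - \<bar>c\<bar>) / B \<le> real (card T)" using B by (simp add: pos_divide_le_eq)
    then show ?thesis using B unfolding T_def by (simp add: diff_divide_distrib)
  qed
  then show ?thesis unfolding Q_def by blast
qed

lemma non_wieferich_count_lower:
  assumes k: "k > 0"
  shows "\<exists>c::real. c > 0 \<and> (\<forall>\<^sub>F x::real in at_top.
    real (card {P. non_wieferich_place K a P \<and> real (ideal_norm K P) \<le> x \<and> [ideal_norm K P = 1] (mod k)}) \<ge> c * ln x)"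
proof -
  define Q where "Q = k ^ (k + 2)"
  have Q: "Q > 0" using k by (simp add: Q_def)
  define B where "B = 2 * real Q * L"
  have B: "B > 0" using Q L_pos by (simp add: B_def)
  obtain c where c: "\<And>N. real N / 16 - c \<le> real (card (\<Union>m\<in>{1..N}. good_places k (Q * m)))"
    using many_good_places[OF k] unfolding Q_def by blast
  let ?W = "\<lambda>x. {P. non_wieferich_place K a P \<and> real (ideal_norm K P) \<le> x \<and> [ideal_norm K P = 1] (mod k)}"
  \<comment> \<open>The threshold makes \<open>ln x / (32 * B)\<close> at least
    \<open>1/16 + |c|\<close>. This absorbs the rounding of \<open>N\<close> and the constant
    \<open>c\<close> at the price of half the factor 1/16.\<close>
  have "1 / (32 * B) * ln x \<le> real (card (?W x))"
    if x: "x \<ge> 1" "x \<ge> exp (32 * B * (1 / 16 + \<bar>c\<bar>))" for x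
  proof -
    \<comment> \<open>The largest \<open>N\<close> with \<open>N * B \<le> ln x\<close>: an order
      \<open>d\<close> dividing \<open>Q * m\<close> with \<open>m \<le> N\<close> gives logarithmic
      norm at most \<open>2 * Q * N * L = N * B\<close>.\<close>
    define N where "N = nat \<lfloor>ln x / B\<rfloor>"
    have lnx: "ln x \<ge> 0" using x(1) by simp
    then have "real N = of_int \<lfloor>ln x / B\<rfloor>" using B by (simp add: N_def)
    then have N: "real N \<le> ln x / B" "ln x / B < real N + 1" by linarith+
    have "(\<Union>m\<in>{1..N}. good_places k (Q * m)) \<subseteq> ?W x"
    proof
      fix P assume "P \<in> (\<Union>m\<in>{1..N}. good_places k (Q * m))"
      then obtain m where m: "m \<in> {1..N}" "P \<in> good_places k (Q * m)" by blast
      have Qm: "Q * m > 0" using m(1) Q by simp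
      note good = good_place_properties[OF Qm m(2)]
      let ?d = "place.order_mod P a"
      have "?d \<le> Q * m" using good(5) Qm by (rule dvd_imp_le)
      also have "\<dots> \<le> Q * N" using m(1) by simp
      finally have "real ?d \<le> real (Q * N)" by (simp only: of_nat_le_iff)
      moreover have "real (?d + 1) \<le> 2 * real ?d" using good(4) by simp
      ultimately have "real (?d + 1) \<le> 2 * real (Q * N)" by linarith
      then have "real (?d + 1) * L \<le> 2 * real (Q * N) * L" using L_pos by (intro mult_right_mono) auto
      also have "\<dots> = real N * B" by (simp add: B_def)
      also have "\<dots> \<le> ln x" using N(1) B by (simp add: pos_le_divide_eq)
      finally have "ln_norm P \<le> ln x" using good(6) by linarith
      then have "real (ideal_norm K P) \<le> x"
        using norm_pos[OF good(1)] x(1) unfolding ln_norm_def by simp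
      then show "P \<in> ?W x" using good by blast
    qed
    moreover have "finite (?W x)"
      by (rule finite_subset[OF _ finite_places_norm_le[of x]]) (auto simp: non_wieferich_place_def)
    ultimately have "card (\<Union>m\<in>{1..N}. good_places k (Q * m)) \<le> card (?W x)" by (intro card_mono)
    then have "real N / 16 - c \<le> real (card (?W x))" using c[of N] by linarith
    moreover have "ln x / B \<ge> 32 * (1 / 16 + \<bar>c\<bar>)"
    proof -
      have "32 * B * (1 / 16 + \<bar>c\<bar>) \<le> ln x" using x ln_ge_iff[of x "32 * B * (1 / 16 + \<bar>c\<bar>)"] by linarith
      then show ?thesis using B by (simp add: pos_le_divide_eq mult_ac)
    qed
    ultimately have "ln x / B / 32 \<le> real (card (?W x))" using N(2) abs_ge_self[of c] by argo
    moreover have "1 / (32 * B) * ln x = ln x / B / 32" by simp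
    ultimately show ?thesis by (simp only:)
  qed
  then have "\<forall>x \<ge> max 1 (exp (32 * B * (1 / 16 + \<bar>c\<bar>))). real (card (?W x)) \<ge> 1 / (32 * B) * ln x" by simp
  then have "\<forall>\<^sub>F x in at_top. real (card (?W x)) \<ge> 1 / (32 * B) * ln x"
    unfolding eventually_at_top_linorder by blast
  then show ?thesis using B by (intro exI[of _ "1 / (32 * B)"]) simp
qed

end

theorem theorem2:
  fixes K :: "complex set" and k :: nat and a :: complex
  assumes "galois_number_field K"
    and "k > 0"
    and "a \<in> carrier (ring_of_integers K)"
    and "\<And>\<sigma>. \<sigma> \<in> Gal K \<Longrightarrow> cmod (\<sigma> a) \<ge> 2"
    and "abc_conjecture K"
  shows "\<exists>c::real. c > 0 \<and>
    (\<forall>\<^sub>F x::real in at_top.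
      real (card {P. non_wieferich_place K a P \<and> real (ideal_norm K P) \<le> x \<and>
                     [ideal_norm K P = 1] (mod k)})
        \<ge> c * ln x)"
proof -
  interpret abc_field K a
    by (intro abc_field.intro galois_field.intro abc_field_axioms.intro assms)
  show ?thesis by (rule non_wieferich_count_lower[OF assms(2)])
qed

end
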